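(* Let $0<b\le+\infty$, and let $W,R:[0,b)\to[0,\infty)$ be left-continuous, nondecreasing, unbounded functions with $W(0)=R(0)=0$ having no discontinuities in common. Let $m$ be the Neumann $m$-function of the system $$u_1(x)=u_1(0)+\int_{[0,x)}u_2(t)\,dR(t),\qquad u_2(x)=u_2(0)-\lambda\int_{[0,x)}u_1(t)\,dW(t),\qquad x\in[0,b).$$ Then, in any nonreal sector, $$|\mathrm{Re}\, m(\lambda)|=O(|\mathrm{Im}\, m(\lambda)|),\qquad |\lambda|\to 0,$$ if there is $t\in(0,1)$ such that $$S_\infty(t):=\limsup_{x\to+\infty}\frac{(R\circ W^{-1})(xt)}{(R\circ W^{-1})(x)}\neq 1,$$ or equivalently, if $R\circ W^{-1}$ is positively increasing at $\infty$. Conversely, if $S_\infty\equiv 1$ on $(0,1)$, or equivalently, if $R\circ W^{-1}$ is not positively increasing at $\infty$, then $$\sup_{y\in(0,1)}\frac{|\mathrm{Re}\, m(\mathrm{i}y)|}{\mathrm{Im}\, m(\mathrm{i}y)}=+\infty .$$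
   Context: Integrals are Lebesgue--Stieltjes integrals. For $\lambda\in\mathbb{C}\setminus\mathbb{R}$ let $(c,c^{[1]})^T$ and $(s,s^{[1]})^T$ be the solutions $(u_1,u_2)^T$ of the system with initial values $(1,0)^T$ and $(0,1)^T$ at $x=0$, respectively. Since $W$ and $R$ are unbounded, the system is in the limit point case at $b$, and the Neumann $m$-function is defined by the requirement that $m(\lambda)$ is the unique complex number with $\psi(\cdot,\lambda)=s(\cdot,\lambda)-m(\lambda)c(\cdot,\lambda)\in L^2((0,b);dW)$. It is a Herglotz function. The generalized inverse of a nondecreasing left-continuous function $f:(0,b)\to[0,\infty)$ is $f^{-1}(x)=\inf\{y: f(y)\ge x\}$. A nondecreasing function $f$ is called positively increasing at $\infty$ if there is $t\in(0,1)$ with $\limsup_{x\to\infty}f(xt)/f(x)\neq1$. A nonreal sector is a closed sector with vertex at $0$ not meeting the real axis (apart from its vertex), e.g. $\{\rho e^{\mathrm{i}\theta}:\rho>0,\ \theta_1\le\theta\le\theta_2\}$ with $0<\theta_1\le\theta_2<\pi$. *)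

theory Defs
  imports "HOL-Analysis.Analysis" "HOL-Library.Landau_Symbols"
begin

text \<open>
  The half-open interval from \<open>0\<close> to \<open>b\<close>, where \<open>b = \<infinity>\<close> is allowed. Functions on this
  interval are total functions whose values elsewhere play no role.
\<close>

definition dom0 :: "ereal \<Rightarrow> real set" where
  "dom0 b = {x. 0 \<le> x \<and> ereal x < b}"

definition left_continuous_on :: "real set \<Rightarrow> (real \<Rightarrow> real) \<Rightarrow> bool" where
  "left_continuous_on A F \<longleftrightarrow> (\<forall>x\<in>A. continuous (at x within (A \<inter> {..x})) F)"

text \<open>
  The Lebesgue--Stieltjes measure of a left-continuous nondecreasing function. The distribution's
  \<open>interval_measure\<close> does not apply, since it wants a right-continuous function on the whole line;
  here \<open>F\<close> may blow up at a finite \<open>b\<close>, and half-open intervals are closed on the left.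
  An atom at \<open>x\<close> has mass \<open>F(x+) - F(x)\<close>; this includes \<open>x = 0\<close>.
\<close>

definition LS_measure :: "ereal \<Rightarrow> (real \<Rightarrow> real) \<Rightarrow> real measure" where
  "LS_measure b F =
     extend_measure (dom0 b) {(x, y). 0 \<le> x \<and> x \<le> y \<and> ereal y < b}
       (\<lambda>(x, y). {x..<y}) (\<lambda>(x, y). ennreal (F y - F x))"

lemma LS_interval_subset: "(\<lambda>(x, y). {x..<y}) ` {(x, y). 0 \<le> x \<and> x \<le> y \<and> ereal y < b} \<subseteq> Pow (dom0 b)"
proof -
  have "ereal u < b" if "ereal y < b" "u < y" for u y :: real
    using that by (meson ereal_less(2) less_ereal.simps(1) less_trans)
  then show ?thesis by (auto simp: dom0_def)
qed

lemma space_LS_measure [simp]: "space (LS_measure b F) = dom0 b"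
  unfolding LS_measure_def by (rule space_extend_measure[OF LS_interval_subset])

lemma sets_LS_measure:
  "sets (LS_measure b F) =
     sigma_sets (dom0 b) ((\<lambda>(x, y). {x..<y}) ` {(x, y). 0 \<le> x \<and> x \<le> y \<and> ereal y < b})"
  unfolding LS_measure_def by (rule sets_extend_measure[OF LS_interval_subset])

text \<open>
  The measure required in the definition exists: it is the image of Lebesgue measure on the
  half-line under a generalized inverse of \<open>F\<close>.
\<close>

lemma emeasure_LS_measure:
  assumes mono: "mono_on (dom0 b) F" and lc: "left_continuous_on (dom0 b) F"
    and unb: "\<not> bdd_above (F ` dom0 b)" and F0: "F 0 = 0" and b: "0 < b"
    and xy: "0 \<le> x" "x \<le> y" "ereal y < b"
  shows "emeasure (LS_measure b F) {x..<y} = ennreal (F y - F x)"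
proof -
  define g where "g s = Sup {x \<in> dom0 b. F x \<le> s}" for s
  have zero: "0 \<in> dom0 b" using b by (auto simp: dom0_def zero_ereal_def)
  have ex: "\<exists>z\<in>dom0 b. s < F z" for s
    using unb by (auto simp: bdd_above_def not_le)
  have upper: "v < z" if "v \<in> dom0 b" "z \<in> dom0 b" "F v \<le> s" "s < F z" for v z s
    using monotone_onD[OF mono that(2,1)] that(3,4) by (cases "v < z") auto
  have bdd: "bdd_above {x \<in> dom0 b. F x \<le> s}" for s
  proof -
    obtain z where "z \<in> dom0 b" "s < F z" using ex by blast
    then show ?thesis by (intro bdd_aboveI[of _ z]) (auto dest: upper)
  qed
  have g_ge: "v \<le> g s" if "v \<in> dom0 b" "F v \<le> s" for v s
    unfolding g_def by (rule cSup_upper[OF _ bdd]) (use that in auto)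
  have g_le: "g s \<le> z" if "z \<in> dom0 b" "s < F z" "0 \<le> s" for z s
    unfolding g_def
    by (rule cSup_least) (use zero F0 that upper in \<open>auto intro: less_imp_le\<close>)
  have g_dom: "g s \<in> dom0 b" if "0 \<le> s" for s
  proof -
    obtain z where z: "z \<in> dom0 b" "s < F z" using ex by blast
    have "0 \<le> g s" using g_ge[OF zero, of s] F0 that by simp
    moreover have "ereal (g s) < b"
      using g_le[OF z that] z(1) by (auto simp: dom0_def) (metis ereal_less_eq(3) le_less_trans)
    ultimately show ?thesis by (simp add: dom0_def)
  qed
  have key: "g s < v \<longleftrightarrow> s < F v" if "0 \<le> s" "v \<in> dom0 b" for s v
  proof
    assume "g s < v"
    then show "s < F v" using g_ge[OF that(2), of s] by (auto simp: not_le[symmetric])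
  next
    assume sv: "s < F v"
    have "0 < v" using that sv F0 by (cases "v = 0") (auto simp: dom0_def)
    have "(F \<longlongrightarrow> F v) (at v within (dom0 b \<inter> {..v}))"
      using lc that(2) by (auto simp: left_continuous_on_def continuous_within)
    then have "\<forall>\<^sub>F u in at v within (dom0 b \<inter> {..v}). s < F u"
      using sv by (rule order_tendstoD(1))
    then obtain d where d: "d > 0" "\<And>u. u \<in> dom0 b \<Longrightarrow> u < v \<Longrightarrow> dist u v < d \<Longrightarrow> s < F u"
      unfolding eventually_at by (metis IntI atMost_iff less_imp_le less_irrefl)
    define u where "u = max 0 (v - d / 2)"
    have u: "0 \<le> u" "u < v" "dist u v < d"
      using \<open>0 < v\<close> \<open>d > 0\<close> by (auto simp: u_def dist_real_def max_def)
    have "ereal u < ereal v" using u by simp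
    also have "ereal v < b" using that(2) by (simp add: dom0_def)
    finally have "u \<in> dom0 b" using u by (simp add: dom0_def)
    from g_le[OF this d(2)[OF this u(2,3)] that(1)] u(2) show "g s < v" by simp
  qed
  let ?I = "{(x, y). 0 \<le> x \<and> x \<le> y \<and> ereal y < b}"
  let ?G = "\<lambda>(x, y). {x..<y :: real}"
  let ?N = "restrict_space lborel {0::real..}"
  let ?S = "sigma (dom0 b) (?G ` ?I)"
  have dom: "u \<in> dom0 b" "v \<in> dom0 b" if "0 \<le> u" "u \<le> v" "ereal v < b" for u v
    using that by (auto simp: dom0_def) (metis ereal_less_eq(3) le_less_trans)
  have Fnn: "0 \<le> F u" if "u \<in> dom0 b" for u
    using monotone_onD[OF mono zero that] F0 that by (auto simp: dom0_def)
  have pre: "g -` {u..<v} \<inter> {0..} = {F u..<F v}" if "0 \<le> u" "u \<le> v" "ereal v < b" for u v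
  proof -
    have "g s \<in> {u..<v} \<longleftrightarrow> s \<in> {F u..<F v}" if s: "0 \<le> s" for s
      using key[OF s dom(1)] key[OF s dom(2)] that
        \<open>0 \<le> u\<close> \<open>u \<le> v\<close> \<open>ereal v < b\<close> by (auto simp: not_less[symmetric])
    then show ?thesis using Fnn[OF dom(1)[OF that]] by fastforce
  qed
  have meas: "g \<in> measurable ?N ?S"
  proof (rule measurable_measure_of[OF LS_interval_subset])
    show "g \<in> space ?N \<rightarrow> dom0 b" using g_dom by (auto simp: space_restrict_space)
    show "g -` A \<inter> space ?N \<in> sets ?N" if "A \<in> ?G ` ?I" for A
    proof -
      obtain u v where "A = {u..<v}" and uv: "0 \<le> u" "u \<le> v" "ereal v < b" using \<open>A \<in> _\<close> by auto
      moreover have "{F u..<F v} \<in> sets ?N"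
        using Fnn[OF dom(1)[OF uv]] by (subst sets_restrict_space_iff) (auto simp: subset_eq)
      ultimately show ?thesis using pre[OF uv] by (simp add: space_restrict_space)
    qed
  qed
  let ?M = "distr ?N ?S g"
  have setsM: "sets ?M = sets (LS_measure b F)"
    using LS_interval_subset by (simp add: sets_LS_measure)
  show ?thesis
  proof (rule emeasure_extend_measure_Pair[where \<mu>' = "emeasure ?M" and M = "LS_measure b F"
        and \<Omega> = "dom0 b" and I = "\<lambda>x y. 0 \<le> x \<and> x \<le> y \<and> ereal y < b"
        and G = "\<lambda>x y. {x..<y}" and \<mu> = "\<lambda>x y. ennreal (F y - F x)"])
    show "LS_measure b F = extend_measure (dom0 b) {(x, y). 0 \<le> x \<and> x \<le> y \<and> ereal y < b}
       (\<lambda>(x, y). {x..<y}) (\<lambda>(x, y). ennreal (F y - F x))" by (fact LS_measure_def)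
    show "emeasure ?M {u..<v} = ennreal (F v - F u)" if "0 \<le> u \<and> u \<le> v \<and> ereal v < b" for u v
    proof -
      have uv: "0 \<le> u" "u \<le> v" "ereal v < b" using that by auto
      have "{u..<v} \<in> sets ?S"
        using uv LS_interval_subset by (auto intro!: sigma_sets.Basic)
      then have "emeasure ?M {u..<v} = emeasure ?N {F u..<F v}"
        using pre[OF uv] by (subst emeasure_distr[OF meas]) (auto simp: space_restrict_space)
      also have "\<dots> = emeasure lborel {F u..<F v}"
        using Fnn[OF dom(1)[OF uv]] by (intro emeasure_restrict_space) auto
      also have "\<dots> = ennreal (F v - F u)"
        using monotone_onD[OF mono dom[OF uv] uv(2)] by simp
      finally show ?thesis .
    qed
    show "{u..<v} \<in> Pow (dom0 b)" if "0 \<le> u \<and> u \<le> v \<and> ereal v < b" for u v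
      using that LS_interval_subset[of b] by (auto simp: subset_eq)
    show "positive (sets (LS_measure b F)) (emeasure ?M)" by (simp add: positive_def)
    show "countably_additive (sets (LS_measure b F)) (emeasure ?M)"
      unfolding setsM[symmetric] by (rule emeasure_countably_additive)
    show "0 \<le> x \<and> x \<le> y \<and> ereal y < b" using xy by simp
  qed
qed

definition solves_system ::
    "ereal \<Rightarrow> (real \<Rightarrow> real) \<Rightarrow> (real \<Rightarrow> real) \<Rightarrow> complex \<Rightarrow> (real \<Rightarrow> complex) \<Rightarrow> (real \<Rightarrow> complex) \<Rightarrow> bool"
  where
  "solves_system b W R z u1 u2 \<longleftrightarrow>
     (\<forall>x\<in>dom0 b.
        set_integrable (LS_measure b R) {0..<x} u2 \<and>
        set_integrable (LS_measure b W) {0..<x} u1 \<and>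
        u1 x = u1 0 + (LINT t:{0..<x}|LS_measure b R. u2 t) \<and>
        u2 x = u2 0 - z * (LINT t:{0..<x}|LS_measure b W. u1 t))"

definition L2_on :: "'a measure \<Rightarrow> 'a set \<Rightarrow> ('a \<Rightarrow> complex) \<Rightarrow> bool" where
  "L2_on M A f \<longleftrightarrow>
     set_borel_measurable M A f \<and> set_integrable M A (\<lambda>x. (cmod (f x))\<^sup>2)"

text \<open>
  Here \<open>(c, c')\<close> and \<open>(s, s')\<close> are the solutions with initial values \<open>(1, 0)\<close> and \<open>(0, 1)\<close>;
  \<open>c'\<close> and \<open>s'\<close> are the quasi-derivatives.
\<close>

definition Neumann_m :: "ereal \<Rightarrow> (real \<Rightarrow> real) \<Rightarrow> (real \<Rightarrow> real) \<Rightarrow> complex \<Rightarrow> complex" where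
  "Neumann_m b W R z =
     (THE m. \<exists>c c' s s'.
        solves_system b W R z c c' \<and> c 0 = 1 \<and> c' 0 = 0 \<and>
        solves_system b W R z s s' \<and> s 0 = 0 \<and> s' 0 = 1 \<and>
        L2_on (LS_measure b W) {x. 0 < x \<and> ereal x < b} (\<lambda>x. s x - m * c x))"

definition gen_inverse :: "ereal \<Rightarrow> (real \<Rightarrow> real) \<Rightarrow> real \<Rightarrow> real" where
  "gen_inverse b f x = Inf {y. 0 < y \<and> ereal y < b \<and> x \<le> f y}"

definition S_infinity :: "(real \<Rightarrow> real) \<Rightarrow> real \<Rightarrow> ereal" where
  "S_infinity f t = Limsup at_top (\<lambda>x. ereal (f (x * t) / f x))"

text \<open>Meant for functions that are nondecreasing on \<open>{0<..}\<close>.\<close>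

definition positively_increasing_at_infinity :: "(real \<Rightarrow> real) \<Rightarrow> bool" where
  "positively_increasing_at_infinity f \<longleftrightarrow>
     (\<exists>t\<in>{0<..<1}. S_infinity f t \<noteq> 1)"

lemma gen_inverse_comp_mono:
  assumes W: "mono_on (dom0 b) W" "\<not> bdd_above (W ` dom0 b)" "W 0 = 0"
    and R: "mono_on (dom0 b) R"
  shows "mono_on {0<..} (R \<circ> gen_inverse b W)"
proof (rule mono_onI)
  fix x y :: real
  assume xy: "x \<in> {0<..}" "y \<in> {0<..}" "x \<le> y"
  define A where "A x = {y. 0 < y \<and> ereal y < b \<and> x \<le> W y}" for x
  have ne: "A z \<noteq> {}" if z: "z > 0" for z
  proof -
    obtain v where "v \<in> dom0 b" "z < W v"
      using W(2) by (auto simp: bdd_above_def not_le)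
    moreover from this have "v \<noteq> 0" using W(3) z by auto
    ultimately show ?thesis by (auto simp: A_def dom0_def intro!: exI[of _ v])
  qed
  have bdd: "bdd_below (A z)" for z by (auto simp: A_def intro!: bdd_belowI[of _ 0])
  have dom: "Inf (A z) \<in> dom0 b" if z: "z > 0" for z
  proof -
    obtain v where v: "v \<in> A z" using ne[OF z] by blast
    have "Inf (A z) \<le> v" using v bdd by (rule cInf_lower)
    moreover have "ereal v < b" using v by (simp add: A_def)
    ultimately have "ereal (Inf (A z)) < b" by (metis ereal_less_eq(3) le_less_trans)
    moreover have "0 \<le> Inf (A z)" by (rule cInf_greatest[OF ne[OF z]]) (auto simp: A_def)
    ultimately show ?thesis by (simp add: dom0_def)
  qed
  have "Inf (A x) \<le> Inf (A y)"
    using xy by (intro cInf_superset_mono ne bdd) (auto simp: A_def)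
  then show "(R \<circ> gen_inverse b W) x \<le> (R \<circ> gen_inverse b W) y"
    using monotone_onD[OF R dom dom] xy by (simp add: gen_inverse_def A_def)
qed

text \<open>Sectors in the upper as well as in the lower half-plane; the vertex is not included.\<close>

definition nonreal_sector :: "complex set \<Rightarrow> bool" where
  "nonreal_sector S \<longleftrightarrow>
     (\<exists>\<theta>1 \<theta>2. \<theta>1 \<le> \<theta>2 \<and>
        S = {of_real \<rho> * cis \<theta> | \<rho> \<theta>. 0 < \<rho> \<and> \<theta> \<in> {\<theta>1..\<theta>2}} \<and> S \<inter> \<real> = {})"

end

theory Submission
  imports Defs
begin

text \<open>
  The proof is variational. Fix \<open>z\<close> with \<open>Im z > 0\<close>, let \<open>m = m(z)\<close> and \<open>\<psi> = s - m c\<close>, so that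
  \<open>\<psi>(0) = -m\<close> and \<open>\<psi>'(0) = 1\<close>, where \<open>'\<close> is the quasi-derivative. Integration by parts, which
  needs that \<open>W\<close> and \<open>R\<close> have no common discontinuity, gives for every solution
    \<open>u(x) cnj (u'(x)) - u(0) cnj (u'(0)) = \<integral> |u'|\<^sup>2 dR - cnj z \<integral> |u|\<^sup>2 dW\<close> over \<open>[0,x)\<close>.
  Hence \<open>m\<close> lies in nested compact discs (\<open>weyl_disc\<close>); it is unique because \<open>c\<close> is not square
  integrable, and \<open>m = P - cnj z E\<close> with numbers \<open>P, E \<ge> 0\<close> that bound the energies
  \<open>\<integral> |\<psi>'|\<^sup>2 dR\<close> and \<open>\<integral> |\<psi>|\<^sup>2 dW\<close> over each \<open>[0,x)\<close>. So \<open>Im m = Im z E\<close>, and the question is how \<open>P\<close>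
  compares with \<open>|z| E\<close>.

  Testing the system against \<open>1 - R/R(x)\<close> and \<open>1 - W/W(x)\<close>, and using the Cauchy--Schwarz inequality,
  one obtains for every \<open>x\<close> (lemma \<open>Neumann_m_variational\<close>)
    (A)  \<open>1 \<le> sqrt (P / R(x)) + |z| sqrt (E W(x))\<close>,
    (B)  \<open>|m| \<le> sqrt (P R(x)) + sqrt (E / W(x))\<close>.
  Everything else follows from (A) and (B). Put \<open>f = R \<circ> W\<^sup>-\<^sup>1\<close>.

  Suppose first that \<open>|z| E \<le> \<epsilon> P\<close> with \<open>\<epsilon>\<close> small, and put \<open>w = 1/(|z| P)\<close>, which is large for small \<open>z\<close>.
  Then (A) bounds \<open>f(w)\<close> above by a multiple of \<open>P\<close>, and (B) bounds \<open>f(K \<epsilon> w)\<close> below by a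
  multiple of \<open>P\<close>. If \<open>f\<close> is positively increasing, then \<open>f(t^n w) \<le> q^n f(w)\<close> with \<open>q < 1\<close>, which
  is a contradiction once \<open>\<epsilon>\<close> is small enough. Therefore \<open>\<epsilon> P \<le> |z| E\<close> near \<open>0\<close> (lemma \<open>Re_O_Im_upper\<close>).

  Conversely, if \<open>S_infinity\<close> is identically \<open>1\<close>, there are arbitrarily large \<open>x\<close> at which \<open>f(\<eta>^4 x)\<close> and
  \<open>f(x)\<close> nearly agree: the string carries an almost concentrated mass. At \<open>y = 1/(f(x) x \<eta>\<^sup>2)\<close>, up
  to a factor close to \<open>1\<close>, (A) and (B) force \<open>P\<close> to be comparable with \<open>f(x)\<close> and \<open>y E\<close> to be much
  smaller (lemma \<open>Re_div_Im_large\<close>).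
\<close>

section \<open>Truncated Lebesgue--Stieltjes measures\<close>

text \<open>
  The restriction of the Lebesgue--Stieltjes measure to \<open>[0,x)\<close>. All integrals below are taken over
  these finite measures, whose sigma-algebra does not depend on \<open>F\<close>.
\<close>

definition trunc :: "ereal \<Rightarrow> (real \<Rightarrow> real) \<Rightarrow> real \<Rightarrow> real measure" where
  "trunc b F x = restrict_space (LS_measure b F) {0..<x}"

lemma dom0_less: "x \<in> dom0 b \<Longrightarrow> 0 \<le> y \<Longrightarrow> y \<le> x \<Longrightarrow> y \<in> dom0 b"
  by (auto simp: dom0_def) (metis ereal_less_eq(3) le_less_trans)

lemma atLeastLessThan_subset_dom0: "x \<in> dom0 b \<Longrightarrow> {0..<x} \<subseteq> dom0 b"
  using dom0_less by auto

lemma sets_LS_measure_eq: "sets (LS_measure b F) = sets (restrict_space borel (dom0 b))"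
proof
  have sub: "{x..<y} \<subseteq> dom0 b" if "0 \<le> x" "ereal y < b" for x y :: real
    using that by (auto simp: dom0_def) (meson dual_order.strict_trans less_ereal.simps(1))
  show "sets (LS_measure b F) \<subseteq> sets (restrict_space borel (dom0 b))"
    unfolding sets_LS_measure
  proof (rule sets.sigma_sets_subset')
    have "{x..<y} \<in> sets (restrict_space borel (dom0 b))" if "0 \<le> x" "ereal y < b" for x y :: real
      using sub[OF that] by (auto simp: sets_restrict_space intro!: image_eqI[of _ _ "{x..<y}"])
    then show "(\<lambda>(x, y). {x..<y}) ` {(x, y). 0 \<le> x \<and> x \<le> y \<and> ereal y < b}
        \<subseteq> sets (restrict_space borel (dom0 b))" by auto
    show "dom0 b \<in> sets (restrict_space borel (dom0 b))"
      by (auto simp: sets_restrict_space intro!: image_eqI[of _ _ UNIV])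
  qed
  have *: "(\<lambda>x. x) \<in> borel_measurable (LS_measure b F)"
  proof (rule borel_measurableI_less)
    fix y :: real
    show "{w \<in> space (LS_measure b F). w < y} \<in> sets (LS_measure b F)"
    proof (cases "0 \<le> y \<and> ereal y < b")
      case True
      then have "{w \<in> space (LS_measure b F). w < y} = {0..<y}"
        using sub[of 0 y] by (auto simp: dom0_def)
      then show ?thesis using True by (auto simp: sets_LS_measure intro!: sigma_sets.Basic)
    next
      case False
      have "{w \<in> space (LS_measure b F). w < y} = (if y < 0 then {} else space (LS_measure b F))"
        using False by (auto simp: dom0_def) (metis ereal_less_eq(3) le_less_trans not_le)
      then show ?thesis by (simp del: space_LS_measure)
    qed
  qed
  show "sets (restrict_space borel (dom0 b)) \<subseteq> sets (LS_measure b F)"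
    using measurable_sets[OF *] by (auto simp: sets_restrict_space vimage_def Int_def conj_commute)
qed

lemma space_trunc: "x \<in> dom0 b \<Longrightarrow> space (trunc b F x) = {0..<x}"
  using atLeastLessThan_subset_dom0 by (auto simp: trunc_def space_restrict_space)

lemma sets_trunc: "x \<in> dom0 b \<Longrightarrow> sets (trunc b F x) = sets (restrict_space borel {0..<x})"
  using atLeastLessThan_subset_dom0[of x b]
  by (simp add: trunc_def sets_restrict_space_cong[OF sets_LS_measure_eq] sets_restrict_restrict_space
      Int_absorb1)

lemma interval_in_LS: "x \<in> dom0 b \<Longrightarrow> {0..<x} \<inter> space (LS_measure b F) \<in> sets (LS_measure b F)"
  using atLeastLessThan_subset_dom0[of x b]
  by (auto simp: sets_LS_measure_eq sets_restrict_space intro!: image_eqI[of _ _ "{0..<x}"])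

lemma set_integrable_LS_iff:
  fixes f :: "real \<Rightarrow> 'a::{banach, second_countable_topology}"
  assumes "x \<in> dom0 b"
  shows "set_integrable (LS_measure b F) {0..<x} f \<longleftrightarrow> integrable (trunc b F x) f"
  using interval_in_LS[OF assms] by (simp add: set_integrable_def trunc_def integrable_restrict_space)

lemma set_integral_LS_eq:
  fixes f :: "real \<Rightarrow> 'a::{banach, second_countable_topology}"
  assumes "x \<in> dom0 b"
  shows "(LINT t:{0..<x}|LS_measure b F. f t) = integral\<^sup>L (trunc b F x) f"
  using interval_in_LS[OF assms]
  by (simp add: set_lebesgue_integral_def trunc_def integral_restrict_space)

lemma trunc_restrict:
  assumes "x \<in> dom0 b" "0 \<le> t" "t \<le> x"
  shows "trunc b F t = restrict_space (trunc b F x) {..<t}" "{..<t} \<inter> space (trunc b F x) \<in> sets (trunc b F x)"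
proof -
  have "{0..<x} \<inter> {..<t} = {0..<t}" using assms by auto
  then show "trunc b F t = restrict_space (trunc b F x) {..<t}"
    unfolding trunc_def using interval_in_LS[OF assms(1)]
    by (subst restrict_restrict_space)
       (auto simp: sets_LS_measure_eq sets_restrict_space intro!: image_eqI[of _ _ "{..<t}"])
  show "{..<t} \<inter> space (trunc b F x) \<in> sets (trunc b F x)"
    using assms by (auto simp: sets_trunc space_trunc sets_restrict_space intro!: image_eqI[of _ _ "{..<t}"])
qed

lemma integrable_trunc_iff:
  fixes f :: "real \<Rightarrow> 'a::{banach, second_countable_topology}"
  assumes "x \<in> dom0 b" "0 \<le> t" "t \<le> x"
  shows "integrable (trunc b F t) f \<longleftrightarrow> integrable (trunc b F x) (\<lambda>s. indicator {..<t} s *\<^sub>R f s)"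
  using trunc_restrict[OF assms] by (simp add: integrable_restrict_space)

lemma integral_trunc_eq:
  fixes f :: "real \<Rightarrow> 'a::{banach, second_countable_topology}"
  assumes "x \<in> dom0 b" "0 \<le> t" "t \<le> x"
  shows "integral\<^sup>L (trunc b F t) f = (\<integral>s. indicator {..<t} s *\<^sub>R f s \<partial>trunc b F x)"
  using trunc_restrict[OF assms] by (simp add: integral_restrict_space)

lemma integrable_trunc_mono:
  fixes f :: "real \<Rightarrow> 'a::{banach, second_countable_topology}"
  assumes "x \<in> dom0 b" "0 \<le> t" "t \<le> x" "integrable (trunc b F x) f"
  shows "integrable (trunc b F t) f"
  unfolding integrable_trunc_iff[OF assms(1-3)]
proof (rule Bochner_Integration.integrable_bound[OF assms(4)])
  have "{..<t} \<inter> space (trunc b F x) \<in> sets (trunc b F x)" by (rule trunc_restrict(2)[OF assms(1-3)])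
  then show "(\<lambda>s. indicator {..<t} s *\<^sub>R f s) \<in> borel_measurable (trunc b F x)"
    using assms(4) by (intro borel_measurable_scaleR borel_measurable_indicator_iff[THEN iffD2]) auto
qed (auto simp: indicator_def)

lemma measurable_trunc_borel:
  assumes "x \<in> dom0 b" "f \<in> borel_measurable borel"
  shows "f \<in> borel_measurable (trunc b F x)"
  unfolding measurable_cong_sets[OF sets_trunc[OF assms(1)] refl]
  by (rule measurable_restrict_space1[OF assms(2)])

lemma singleton_sets_trunc: "x \<in> dom0 b \<Longrightarrow> 0 \<le> t \<Longrightarrow> t < x \<Longrightarrow> {t} \<in> sets (trunc b F x)"
  by (auto simp: sets_trunc sets_restrict_space intro!: image_eqI[of _ _ "{t}"])

lemma lessThan_measurable_pair:
  assumes "x \<in> dom0 b"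
  shows "{p \<in> space (trunc b F x \<Otimes>\<^sub>M trunc b G x). snd p < (fst p::real)} \<in> sets (trunc b F x \<Otimes>\<^sub>M trunc b G x)"
    "{p \<in> space (trunc b F x \<Otimes>\<^sub>M trunc b G x). fst p < (snd p::real)} \<in> sets (trunc b F x \<Otimes>\<^sub>M trunc b G x)"
    "{p \<in> space (trunc b F x \<Otimes>\<^sub>M trunc b G x). fst p = (snd p::real)} \<in> sets (trunc b F x \<Otimes>\<^sub>M trunc b G x)"
proof -
  have [measurable]: "fst \<in> borel_measurable (trunc b F x \<Otimes>\<^sub>M trunc b G x)"
    using measurable_trunc_borel[OF assms, of "\<lambda>t. t" F] measurable_compose[OF measurable_fst, of "\<lambda>t. t" "trunc b F x" borel "trunc b G x"] by simp
  have [measurable]: "snd \<in> borel_measurable (trunc b F x \<Otimes>\<^sub>M trunc b G x)"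
    using measurable_trunc_borel[OF assms, of "\<lambda>t. t" G] measurable_compose[OF measurable_snd, of "\<lambda>t. t" "trunc b G x" borel "trunc b F x"] by simp
  show "{p \<in> space (trunc b F x \<Otimes>\<^sub>M trunc b G x). snd p < (fst p::real)} \<in> sets (trunc b F x \<Otimes>\<^sub>M trunc b G x)"
    "{p \<in> space (trunc b F x \<Otimes>\<^sub>M trunc b G x). fst p < (snd p::real)} \<in> sets (trunc b F x \<Otimes>\<^sub>M trunc b G x)"
    "{p \<in> space (trunc b F x \<Otimes>\<^sub>M trunc b G x). fst p = (snd p::real)} \<in> sets (trunc b F x \<Otimes>\<^sub>M trunc b G x)"
    by measurable
qed

text \<open>
  A function that qualifies as a mass or length distribution on \<open>[0,b)\<close>. Both \<open>W\<close> and \<open>R\<close> are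
  instances, and most of the development treats them symmetrically.
\<close>

locale stieltjes =
  fixes b :: ereal and F :: "real \<Rightarrow> real"
  assumes b_pos: "0 < b"
    and mono: "mono_on (dom0 b) F"
    and left_cont: "left_continuous_on (dom0 b) F"
    and unbounded: "\<not> bdd_above (F ` dom0 b)"
    and zero: "F 0 = 0"
begin

lemma zero_dom: "0 \<in> dom0 b" using b_pos by (auto simp: dom0_def zero_ereal_def)

lemma le: "x \<in> dom0 b \<Longrightarrow> 0 \<le> t \<Longrightarrow> t \<le> x \<Longrightarrow> F t \<le> F x"
  using monotone_onD[OF mono dom0_less] by blast

lemma nonneg: "x \<in> dom0 b \<Longrightarrow> 0 \<le> F x"
  using le[of x 0] zero by (auto simp: dom0_def)

lemma ex_gt: "\<exists>x\<in>dom0 b. K < F x"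
  using unbounded by (auto simp: bdd_above_def not_le)

lemma emeasure_trunc:
  assumes "x \<in> dom0 b" "0 \<le> u" "u \<le> v" "v \<le> x"
  shows "emeasure (trunc b F x) {u..<v} = ennreal (F v - F u)"
proof -
  have "v \<in> dom0 b" using dom0_less[OF assms(1), of v] assms by auto
  then have "emeasure (LS_measure b F) {u..<v} = ennreal (F v - F u)"
    by (intro emeasure_LS_measure mono left_cont unbounded zero b_pos)
       (use assms in \<open>auto simp: dom0_def\<close>)
  moreover have "emeasure (trunc b F x) {u..<v} = emeasure (LS_measure b F) {u..<v}"
    unfolding trunc_def using interval_in_LS[OF assms(1)] assms by (intro emeasure_restrict_space) auto
  ultimately show ?thesis by simp
qed

lemma emeasure_space_trunc: "x \<in> dom0 b \<Longrightarrow> emeasure (trunc b F x) (space (trunc b F x)) = ennreal (F x)"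
  using emeasure_trunc[of x 0 x] zero by (auto simp: space_trunc dom0_def)

lemma measure_space_trunc: "x \<in> dom0 b \<Longrightarrow> measure (trunc b F x) (space (trunc b F x)) = F x"
  by (simp add: measure_def emeasure_space_trunc nonneg)

lemma finite_trunc: "x \<in> dom0 b \<Longrightarrow> finite_measure (trunc b F x)"
  by (rule finite_measureI) (simp add: emeasure_space_trunc)

lemma measure_trunc:
  assumes "x \<in> dom0 b" "0 \<le> u" "u \<le> v" "v \<le> x"
  shows "measure (trunc b F x) {u..<v} = F v - F u"
proof -
  have "F u \<le> F v" using le[of v u] dom0_less[OF assms(1)] assms by auto
  then show ?thesis using emeasure_trunc[OF assms] by (simp add: measure_def)
qed

lemma integrable_trunc_bounded:
  fixes f :: "real \<Rightarrow> 'a::{banach, second_countable_topology}"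
  assumes "x \<in> dom0 b" "f \<in> borel_measurable (trunc b F x)" "\<And>t. 0 \<le> t \<Longrightarrow> t < x \<Longrightarrow> norm (f t) \<le> B"
  shows "integrable (trunc b F x) f"
  by (rule finite_measure.integrable_const_bound[OF finite_trunc[OF assms(1)], where B = B])
     (use assms in \<open>auto simp: space_trunc\<close>)

lemma norm_integral_trunc_le:
  fixes f :: "real \<Rightarrow> 'a::{banach, second_countable_topology}"
  assumes "x \<in> dom0 b" "\<And>t. 0 \<le> t \<Longrightarrow> t < x \<Longrightarrow> norm (f t) \<le> B" "0 \<le> B"
  shows "norm (integral\<^sup>L (trunc b F x) f) \<le> B * F x"
proof (cases "integrable (trunc b F x) f")
  case True
  interpret finite_measure "trunc b F x" by (rule finite_trunc[OF assms(1)])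
  have "norm (integral\<^sup>L (trunc b F x) f) \<le> (\<integral>t. norm (f t) \<partial>trunc b F x)" by (rule integral_norm_bound)
  also have "\<dots> \<le> (\<integral>t. B \<partial>trunc b F x)"
    using True assms(2) by (intro integral_mono) (auto simp: space_trunc[OF assms(1)])
  also have "\<dots> = B * F x" by (simp add: measure_space_trunc[OF assms(1)])
  finally show ?thesis .
qed (use assms nonneg in \<open>simp add: not_integrable_integral_eq\<close>)

text \<open>A point at which \<open>F\<close> is continuous carries no mass.\<close>

lemma null_singleton:
  assumes x: "x \<in> dom0 b" "0 \<le> t" "t < x" and cont: "continuous (at t within dom0 b) F"
  shows "measure (trunc b F x) {t} = 0"
proof (rule antisym[OF field_le_epsilon measure_nonneg])
  fix e :: real assume "0 < e"
  then obtain d where d: "d > 0" "\<And>u. u \<in> dom0 b \<Longrightarrow> dist u t < d \<Longrightarrow> dist (F u) (F t) < e"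
    using cont unfolding continuous_within_eps_delta by meson
  define u where "u = min x (t + d / 2)"
  have u: "t < u" "u \<le> x" "dist u t < d" using d(1) x by (auto simp: u_def dist_real_def)
  have ud: "u \<in> dom0 b" using dom0_less[OF x(1)] u x by auto
  interpret finite_measure "trunc b F x" by (rule finite_trunc[OF x(1)])
  have "{t..<u} \<in> sets (trunc b F x)"
    using u x by (auto simp: sets_trunc sets_restrict_space intro!: image_eqI[of _ _ "{t..<u}"])
  then have "measure (trunc b F x) {t} \<le> measure (trunc b F x) {t..<u}"
    using u by (intro finite_measure_mono) auto
  also have "\<dots> = F u - F t" using x u by (intro measure_trunc) auto
  also have "\<dots> \<le> 0 + e" using d(2)[OF ud u(3)] by (simp add: dist_real_def)
  finally show "measure (trunc b F x) {t} \<le> 0 + e" .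
qed

end

section \<open>Fubini's theorem on the two triangles\<close>

text \<open>
  The square \<open>[0,x) \<times> [0,x)\<close> is split into the two open triangles and the diagonal. With
  atoms in common the diagonal contributes; for nonnegative integrands it may be dropped.
\<close>

lemma Fubini_triangles:
  fixes f g :: "real \<Rightarrow> 'a::{real_normed_field, banach, second_countable_topology}"
  assumes "stieltjes b F" "stieltjes b G" and x: "x \<in> dom0 b"
    and f: "integrable (trunc b F x) f" and g: "integrable (trunc b G x) g"
  shows "integral\<^sup>L (trunc b F x) f * integral\<^sup>L (trunc b G x) g =
      (\<integral>s. f s * integral\<^sup>L (trunc b G s) g \<partial>trunc b F x)
    + (\<integral>t. integral\<^sup>L (trunc b F t) f * g t \<partial>trunc b G x)
    + (\<integral>s. measure (trunc b G x) {s} *\<^sub>R (f s * g s) \<partial>trunc b F x)"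
    and "integrable (trunc b F x) (\<lambda>s. f s * integral\<^sup>L (trunc b G s) g)"
    and "integrable (trunc b G x) (\<lambda>t. integral\<^sup>L (trunc b F t) f * g t)"
proof -
  interpret F: stieltjes b F by fact
  interpret G: stieltjes b G by fact
  let ?M = "trunc b F x" and ?N = "trunc b G x"
  interpret FM: finite_measure ?M by (rule F.finite_trunc[OF x])
  interpret GM: finite_measure ?N by (rule G.finite_trunc[OF x])
  interpret pair_sigma_finite ?M ?N ..
  interpret sw: pair_sigma_finite ?N ?M ..
  note [measurable] = borel_measurable_integrable[OF f] borel_measurable_integrable[OF g]
  have int: "integrable (?M \<Otimes>\<^sub>M ?N) (\<lambda>p. f (fst p) * g (snd p))"
  proof (rule Fubini_integrable)
    show "integrable ?M (\<lambda>s. \<integral>t. norm (f (fst (s, t)) * g (snd (s, t))) \<partial>?N)"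
      using f g by (simp add: norm_mult)
    show "AE s in ?M. integrable ?N (\<lambda>t. f (fst (s, t)) * g (snd (s, t)))" using g by simp
  qed measurable
  define A where "A = {p \<in> space (?M \<Otimes>\<^sub>M ?N). snd p < fst p}"
  define B where "B = {p \<in> space (?M \<Otimes>\<^sub>M ?N). fst p < snd p}"
  define D where "D = {p \<in> space (?M \<Otimes>\<^sub>M ?N). fst p = snd p}"
  have meas: "A \<in> sets (?M \<Otimes>\<^sub>M ?N)" "B \<in> sets (?M \<Otimes>\<^sub>M ?N)" "D \<in> sets (?M \<Otimes>\<^sub>M ?N)"
    using lessThan_measurable_pair[OF x] by (auto simp: A_def B_def D_def)
  let ?h = "\<lambda>p. f (fst p) * g (snd p)"
  have intS: "integrable (?M \<Otimes>\<^sub>M ?N) (\<lambda>p. indicator S p *\<^sub>R ?h p)" if "S \<in> sets (?M \<Otimes>\<^sub>M ?N)" for S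
    by (rule integrable_mult_indicator[OF that int])
  have *: "integral\<^sup>L ?M f * integral\<^sup>L ?N g = (\<integral>p. ?h p \<partial>(?M \<Otimes>\<^sub>M ?N))"
    using integral_fst'[OF int] by simp
  have "(\<integral>p. ?h p \<partial>(?M \<Otimes>\<^sub>M ?N)) = (\<integral>p. indicator A p *\<^sub>R ?h p + indicator B p *\<^sub>R ?h p + indicator D p *\<^sub>R ?h p \<partial>(?M \<Otimes>\<^sub>M ?N))"
    by (rule Bochner_Integration.integral_cong)
       (auto simp: A_def B_def D_def indicator_def)
  also have "\<dots> = (\<integral>p. indicator A p *\<^sub>R ?h p \<partial>(?M \<Otimes>\<^sub>M ?N)) + (\<integral>p. indicator B p *\<^sub>R ?h p \<partial>(?M \<Otimes>\<^sub>M ?N))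
      + (\<integral>p. indicator D p *\<^sub>R ?h p \<partial>(?M \<Otimes>\<^sub>M ?N))"
    using intS meas by simp
  finally have sum: "(\<integral>p. ?h p \<partial>(?M \<Otimes>\<^sub>M ?N)) = \<dots>" .
  have eA: "(\<integral>t. indicator A (s, t) *\<^sub>R ?h (s, t) \<partial>?N) = f s * integral\<^sup>L (trunc b G s) g" if "s \<in> space ?M" for s
  proof -
    have s: "0 \<le> s" "s \<le> x" using that by (auto simp: space_trunc[OF x])
    have "(\<integral>t. indicator A (s, t) *\<^sub>R ?h (s, t) \<partial>?N) = (\<integral>t. f s * (indicator {..<s} t *\<^sub>R g t) \<partial>?N)"
      by (rule Bochner_Integration.integral_cong)
         (use that in \<open>auto simp: A_def indicator_def space_pair_measure\<close>)
    then show ?thesis by (simp only: integral_trunc_eq[OF x s] integral_mult_right_zero)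
  qed
  have eB: "(\<integral>s. indicator B (s, t) *\<^sub>R ?h (s, t) \<partial>?M) = integral\<^sup>L (trunc b F t) f * g t" if "t \<in> space ?N" for t
  proof -
    have t: "0 \<le> t" "t \<le> x" using that by (auto simp: space_trunc[OF x])
    have "(\<integral>s. indicator B (s, t) *\<^sub>R ?h (s, t) \<partial>?M) = (\<integral>s. (indicator {..<t} s *\<^sub>R f s) * g t \<partial>?M)"
      by (rule Bochner_Integration.integral_cong)
         (use that in \<open>auto simp: B_def indicator_def space_pair_measure\<close>)
    then show ?thesis by (simp only: integral_trunc_eq[OF x t] integral_mult_left_zero)
  qed
  have eD: "(\<integral>t. indicator D (s, t) *\<^sub>R ?h (s, t) \<partial>?N) = measure ?N {s} *\<^sub>R (f s * g s)" if "s \<in> space ?M" for s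
  proof -
    have s: "0 \<le> s" "s < x" using that by (auto simp: space_trunc[OF x])
    have "(\<integral>t. indicator D (s, t) *\<^sub>R ?h (s, t) \<partial>?N) = (\<integral>t. indicator {s} t *\<^sub>R (f s * g s) \<partial>?N)"
      by (rule Bochner_Integration.integral_cong)
         (use that in \<open>auto simp: D_def indicator_def space_pair_measure\<close>)
    also have "\<dots> = measure ?N {s} *\<^sub>R (f s * g s)"
      using singleton_sets_trunc[OF x s] sets.sets_into_space[OF singleton_sets_trunc[OF x s]]
      by (subst integral_scaleR_left) (auto simp: Int_absorb2 GM.emeasure_eq_measure)
    finally show ?thesis .
  qed
  note iA = integrable_fst'[OF intS[OF meas(1)]] and iD = integrable_fst'[OF intS[OF meas(3)]]
    and iB = sw.integrable_fst'[OF integrable_product_swap[OF intS[OF meas(2)]]]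
  show "integrable ?M (\<lambda>s. f s * integral\<^sup>L (trunc b G s) g)"
    using iA by (rule Bochner_Integration.integrable_cong[THEN iffD1, rotated 2]) (use eA in auto)
  show "integrable ?N (\<lambda>t. integral\<^sup>L (trunc b F t) f * g t)"
    using iB by (rule Bochner_Integration.integrable_cong[THEN iffD1, rotated 2]) (use eB in auto)
  have "(\<integral>p. indicator A p *\<^sub>R ?h p \<partial>(?M \<Otimes>\<^sub>M ?N)) = (\<integral>s. f s * integral\<^sup>L (trunc b G s) g \<partial>?M)"
    unfolding integral_fst'[OF intS[OF meas(1)], symmetric]
    by (rule Bochner_Integration.integral_cong[OF refl eA])
  moreover have "(\<integral>p. indicator B p *\<^sub>R ?h p \<partial>(?M \<Otimes>\<^sub>M ?N)) = (\<integral>t. integral\<^sup>L (trunc b F t) f * g t \<partial>?N)"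
    unfolding integral_product_swap[OF borel_measurable_integrable[OF intS[OF meas(2)]], symmetric]
      sw.integral_fst'[OF integrable_product_swap[OF intS[OF meas(2)]], symmetric]
    by (rule Bochner_Integration.integral_cong[OF refl]) (use eB in auto)
  moreover have "(\<integral>p. indicator D p *\<^sub>R ?h p \<partial>(?M \<Otimes>\<^sub>M ?N)) = (\<integral>s. measure ?N {s} *\<^sub>R (f s * g s) \<partial>?M)"
    unfolding integral_fst'[OF intS[OF meas(3)], symmetric]
    by (rule Bochner_Integration.integral_cong[OF refl eD])
  ultimately show "integral\<^sup>L ?M f * integral\<^sup>L ?N g =
      (\<integral>s. f s * integral\<^sup>L (trunc b G s) g \<partial>?M)
    + (\<integral>t. integral\<^sup>L (trunc b F t) f * g t \<partial>?N)
    + (\<integral>s. measure ?N {s} *\<^sub>R (f s * g s) \<partial>?M)"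
    using * sum by simp
qed

section \<open>Iterated integrals and the fundamental solutions\<close>

lemma mono_on_measurable_trunc:
  fixes h :: "real \<Rightarrow> real"
  assumes "x \<in> dom0 b" "mono_on (dom0 b) h"
  shows "h \<in> borel_measurable (trunc b F x)"
  unfolding measurable_cong_sets[OF sets_trunc[OF assms(1)] refl]
  by (rule borel_measurable_mono_on_fnc[OF mono_on_subset[OF assms(2) atLeastLessThan_subset_dom0[OF assms(1)]]])

text \<open>
  Monotone functions are measurable and bounded on \<open>[0,x)\<close>, so iterated integrals of such functions
  need no further integrability argument.
\<close>

definition nonneg_mono :: "ereal \<Rightarrow> (real \<Rightarrow> real) \<Rightarrow> bool" where
  "nonneg_mono b h \<longleftrightarrow> mono_on (dom0 b) h \<and> (\<forall>x\<in>dom0 b. 0 \<le> h x)"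

lemma nonneg_mono_const: "0 \<le> c \<Longrightarrow> nonneg_mono b (\<lambda>_. c)"
  by (simp add: nonneg_mono_def monotone_on_def)

context stieltjes begin

lemma integrable_nonneg_mono:
  assumes x: "x \<in> dom0 b" and h: "nonneg_mono b h"
  shows "integrable (trunc b F x) h"
proof (rule integrable_trunc_bounded[OF x])
  show "h \<in> borel_measurable (trunc b F x)"
    using mono_on_measurable_trunc[OF x] h by (simp add: nonneg_mono_def)
  show "norm (h t) \<le> h x" if "0 \<le> t" "t < x" for t
    using h x dom0_less[OF x that(1)] that by (auto simp: nonneg_mono_def monotone_on_def)
qed

lemma integral_nonneg_mono_le:
  assumes x: "x \<in> dom0 b" and h: "nonneg_mono b h"
  shows "integral\<^sup>L (trunc b F x) h \<le> h x * F x"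
proof -
  have "\<bar>integral\<^sup>L (trunc b F x) h\<bar> \<le> h x * F x"
    using norm_integral_trunc_le[OF x, of h "h x"] h x dom0_less[OF x]
    by (auto simp: nonneg_mono_def monotone_on_def)
  then show ?thesis by simp
qed

lemma integral_trunc_nonneg:
  fixes h :: "real \<Rightarrow> real"
  assumes x: "x \<in> dom0 b" and h: "\<And>t. t \<in> dom0 b \<Longrightarrow> 0 \<le> h t"
  shows "0 \<le> integral\<^sup>L (trunc b F x) h"
  by (rule integral_nonneg_AE) (use h dom0_less[OF x] in \<open>auto simp: space_trunc[OF x]\<close>)

lemma integral_trunc_mono:
  fixes h :: "real \<Rightarrow> real"
  assumes x: "x \<in> dom0 b" and t: "0 \<le> t" "t \<le> x"
    and i: "integrable (trunc b F x) h" and h: "\<And>t. t \<in> dom0 b \<Longrightarrow> 0 \<le> h t"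
  shows "integral\<^sup>L (trunc b F t) h \<le> integral\<^sup>L (trunc b F x) h"
  unfolding integral_trunc_eq[OF x t]
proof (rule integral_mono)
  show "integrable (trunc b F x) (\<lambda>s. indicator {..<t} s *\<^sub>R h s)"
    using integrable_trunc_mono[OF x t i] integrable_trunc_iff[OF x t] by blast
  show "indicator {..<t} s *\<^sub>R h s \<le> h s" if "s \<in> space (trunc b F x)" for s
    using h[of s] that dom0_less[OF x] by (auto simp: indicator_def space_trunc[OF x])
qed (rule i)

lemma nonneg_mono_integral:
  assumes h: "nonneg_mono b h"
  shows "nonneg_mono b (\<lambda>x. integral\<^sup>L (trunc b F x) h)"
  unfolding nonneg_mono_def
proof (intro conjI mono_onI ballI)
  fix t x assume tx: "t \<in> dom0 b" "x \<in> dom0 b" "t \<le> x"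
  show "integral\<^sup>L (trunc b F t) h \<le> integral\<^sup>L (trunc b F x) h"
    using tx h integrable_nonneg_mono[OF tx(2) h]
    by (intro integral_trunc_mono) (auto simp: nonneg_mono_def dom0_def)
next
  fix x assume "x \<in> dom0 b"
  then show "0 \<le> integral\<^sup>L (trunc b F x) h"
    using h by (intro integral_trunc_nonneg) (auto simp: nonneg_mono_def)
qed

lemma integral_trunc_const: "x \<in> dom0 b \<Longrightarrow> integral\<^sup>L (trunc b F x) (\<lambda>_. c::real) = c * F x"
  using measure_space_trunc[of x] by simp

end

text \<open>
  Iterated integrals of the constant \<open>1\<close> against a single measure. If \<open>F\<close> is continuous then
  the \<open>n\<close>-th one is \<open>F ^ n / fact n\<close>; in general this is an upper bound.
\<close>

primrec iter_int :: "ereal \<Rightarrow> (real \<Rightarrow> real) \<Rightarrow> nat \<Rightarrow> real \<Rightarrow> real" where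
  "iter_int b F 0 = (\<lambda>x. 1)"
| "iter_int b F (Suc n) = (\<lambda>x. integral\<^sup>L (trunc b F x) (iter_int b F n))"

lemma (in stieltjes) nonneg_mono_iter_int: "nonneg_mono b (iter_int b F n)"
  by (induction n) (simp_all add: nonneg_mono_integral nonneg_mono_const)

text \<open>
  Induction on \<open>n\<close>: write \<open>F(x)\<close> as the integral of \<open>1\<close> and expand the product with the iterated
  integral over the two triangles, where the diagonal is nonnegative.
\<close>

lemma (in stieltjes) iter_int_Suc_le:
  assumes x: "x \<in> dom0 b"
  shows "real (Suc n) * iter_int b F (Suc n) x \<le> F x * iter_int b F n x"
  using x
proof (induction n arbitrary: x)
  case 0
  then show ?case by (simp add: integral_trunc_const del: lebesgue_integral_const)
next
  case (Suc n)
  note x = Suc.prems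
  let ?I = "iter_int b F"
  have sj: "stieltjes b F" ..
  note int = integrable_nonneg_mono[OF x nonneg_mono_iter_int]
  note Fub = Fubini_triangles[where f = "iter_int b F n" and g = "\<lambda>_. 1", OF sj sj x int]
  have i1: "integrable (trunc b F x) (\<lambda>_. 1::real)"
    using finite_measure.integrable_const[OF finite_trunc[OF x]] by blast
  have FF: "integral\<^sup>L (trunc b F s) (\<lambda>_. 1) = F s" if "s \<in> space (trunc b F x)" for s
    using integral_trunc_const[of s 1] dom0_less[OF x] that by (auto simp: space_trunc[OF x])
  have c: "integrable (trunc b F x) (\<lambda>s. ?I n s * integral\<^sup>L (trunc b F s) (\<lambda>_. 1))
      = integrable (trunc b F x) (\<lambda>s. F s * ?I n s)"
    by (rule Bochner_Integration.integrable_cong) (use FF in auto)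
  have c': "integral\<^sup>L (trunc b F x) (\<lambda>s. ?I n s * integral\<^sup>L (trunc b F s) (\<lambda>_. 1))
      = integral\<^sup>L (trunc b F x) (\<lambda>s. F s * ?I n s)"
    by (rule Bochner_Integration.integral_cong) (use FF in auto)
  have diag: "0 \<le> (\<integral>s. measure (trunc b F x) {s} *\<^sub>R (?I n s * 1) \<partial>trunc b F x)"
    using nonneg_mono_iter_int[of n] dom0_less[OF x]
    by (intro integral_nonneg_AE) (auto simp: nonneg_mono_def space_trunc[OF x])
  have "real (Suc n) * ?I (Suc (Suc n)) x = (\<integral>t. real (Suc n) * ?I (Suc n) t \<partial>trunc b F x)" by simp
  also have "\<dots> \<le> (\<integral>t. F t * ?I n t \<partial>trunc b F x)"
  proof (rule integral_mono)
    show "integrable (trunc b F x) (\<lambda>t. real (Suc n) * ?I (Suc n) t)"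
      using int[of "Suc n"] by simp
    show "integrable (trunc b F x) (\<lambda>s. F s * ?I n s)" using Fub(2)[OF i1] c by simp
    show "real (Suc n) * ?I (Suc n) t \<le> F t * ?I n t" if "t \<in> space (trunc b F x)" for t
      using Suc.IH[of t] dom0_less[OF x] that by (auto simp: space_trunc[OF x])
  qed
  finally have 1: "real (Suc n) * ?I (Suc (Suc n)) x \<le> (\<integral>t. F t * ?I n t \<partial>trunc b F x)" .
  have "F x * ?I (Suc n) x = ?I (Suc n) x * integral\<^sup>L (trunc b F x) (\<lambda>_. 1)"
    using integral_trunc_const[OF x, of 1] by (simp add: mult.commute)
  also have "\<dots> = (\<integral>t. F t * ?I n t \<partial>trunc b F x) + ?I (Suc (Suc n)) x
      + (\<integral>s. measure (trunc b F x) {s} *\<^sub>R (?I n s * 1) \<partial>trunc b F x)"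
    using Fub(1)[OF i1] c' by simp
  finally show ?case using 1 diag by (simp add: algebra_simps)
qed

lemma (in stieltjes) iter_int_le:
  assumes x: "x \<in> dom0 b"
  shows "iter_int b F n x \<le> F x ^ n / fact n"
proof (induction n)
  case (Suc n)
  have "real (Suc n) * iter_int b F (Suc n) x \<le> F x * (F x ^ n / fact n)"
    using iter_int_Suc_le[OF x, of n] Suc mult_left_mono[OF Suc nonneg[OF x]] by linarith
  then have "fact n * (real (Suc n) * iter_int b F (Suc n) x) \<le> fact n * (F x * (F x ^ n / fact n))"
    by (rule mult_left_mono) simp
  then have "iter_int b F (Suc n) x * fact (Suc n) \<le> F x ^ Suc n"
    unfolding fact_Suc power_Suc by (simp add: mult_ac del: iter_int.simps of_nat_Suc)
  then show ?case by (simp add: pos_le_divide_eq del: iter_int.simps fact_Suc power_Suc)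
qed simp

text \<open>
  Integrals alternating between \<open>dF\<close> and \<open>dG\<close>: these are the coefficients of the power series in
  the spectral parameter of the solutions. \<open>alt_int b F G n\<close> has \<open>n\<close> integrations against each measure,
  the outermost against \<open>dG\<close>, and \<open>alt_int'\<close> adds one against \<open>dF\<close>.
\<close>

primrec alt_int :: "ereal \<Rightarrow> (real \<Rightarrow> real) \<Rightarrow> (real \<Rightarrow> real) \<Rightarrow> nat \<Rightarrow> real \<Rightarrow> real" where
  "alt_int b F G 0 = (\<lambda>x. 1)"
| "alt_int b F G (Suc n) = (\<lambda>x. \<integral>t. integral\<^sup>L (trunc b F t) (alt_int b F G n) \<partial>trunc b G x)"

abbreviation alt_int' :: "ereal \<Rightarrow> (real \<Rightarrow> real) \<Rightarrow> (real \<Rightarrow> real) \<Rightarrow> nat \<Rightarrow> real \<Rightarrow> real" where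
  "alt_int' b F G n x \<equiv> integral\<^sup>L (trunc b F x) (alt_int b F G n)"

locale stieltjes_pair = F: stieltjes b F + G: stieltjes b G for b F G
begin

lemma nonneg_mono_alt: "nonneg_mono b (alt_int b F G n)" "nonneg_mono b (alt_int' b F G n)"
proof -
  show *: "nonneg_mono b (alt_int b F G n)" for n
    by (induction n)
       (simp_all add: nonneg_mono_const F.nonneg_mono_integral G.nonneg_mono_integral)
  then show "nonneg_mono b (alt_int' b F G n)" by (intro F.nonneg_mono_integral)
qed

lemma alt_int_nonneg: "x \<in> dom0 b \<Longrightarrow> 0 \<le> alt_int b F G n x" "x \<in> dom0 b \<Longrightarrow> 0 \<le> alt_int' b F G n x"
  using nonneg_mono_alt unfolding nonneg_mono_def by blast+

lemma alt_int_le_iter: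
  assumes "x \<in> dom0 b"
  shows "alt_int b F G n x \<le> iter_int b F n x * iter_int b G n x"
    and "alt_int' b F G n x \<le> iter_int b F (Suc n) x * iter_int b G n x"
proof -
  have dom: "s \<in> dom0 b" "s \<le> x" if "x \<in> dom0 b" "s \<in> space (trunc b H x)" for s x H
    using that dom0_less[OF that(1)] by (auto simp: space_trunc)
  note nm = F.nonneg_mono_iter_int G.nonneg_mono_iter_int
  have nn: "0 \<le> iter_int b F n x" "0 \<le> iter_int b G n x" if "x \<in> dom0 b" for n x
    using nm that by (auto simp: nonneg_mono_def)
  have mn: "iter_int b F n s \<le> iter_int b F n x" "iter_int b G n s \<le> iter_int b G n x"
    if "s \<in> dom0 b" "x \<in> dom0 b" "s \<le> x" for n s x
    using nm that by (auto simp: nonneg_mono_def monotone_on_def)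
  have *: "alt_int' b F G n x \<le> iter_int b F (Suc n) x * iter_int b G n x"
    if x: "x \<in> dom0 b" and IH: "\<And>t. t \<in> dom0 b \<Longrightarrow> alt_int b F G n t \<le> iter_int b F n t * iter_int b G n t" for n x
  proof -
    have "alt_int' b F G n x \<le> (\<integral>t. iter_int b F n t * iter_int b G n x \<partial>trunc b F x)"
    proof (rule integral_mono)
      show "integrable (trunc b F x) (alt_int b F G n)" by (rule F.integrable_nonneg_mono[OF x nonneg_mono_alt(1)])
      show "integrable (trunc b F x) (\<lambda>t. iter_int b F n t * iter_int b G n x)"
        using F.integrable_nonneg_mono[OF x nm(1)] by simp
      fix t assume "t \<in> space (trunc b F x)"
      note t = dom[OF x this]
      have "iter_int b F n t * iter_int b G n t \<le> iter_int b F n t * iter_int b G n x"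
        using mn(2)[OF t(1) x t(2)] nn[OF t(1)] by (intro mult_left_mono) auto
      then show "alt_int b F G n t \<le> iter_int b F n t * iter_int b G n x" using IH[OF t(1)] by linarith
    qed
    then show ?thesis by simp
  qed
  have **: "alt_int b F G n x \<le> iter_int b F n x * iter_int b G n x" if x: "x \<in> dom0 b" for n x
    using x
  proof (induction n arbitrary: x)
    case (Suc n)
    note x = Suc.prems
    have "alt_int b F G (Suc n) x \<le> (\<integral>t. iter_int b F (Suc n) x * iter_int b G n t \<partial>trunc b G x)"
      unfolding alt_int.simps
    proof (rule integral_mono)
      show "integrable (trunc b G x) (alt_int' b F G n)" by (rule G.integrable_nonneg_mono[OF x nonneg_mono_alt(2)])
      show "integrable (trunc b G x) (\<lambda>t. iter_int b F (Suc n) x * iter_int b G n t)"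
        using G.integrable_nonneg_mono[OF x nm(2)] by simp
      fix t assume "t \<in> space (trunc b G x)"
      note t = dom[OF x this]
      have "iter_int b F (Suc n) t * iter_int b G n t \<le> iter_int b F (Suc n) x * iter_int b G n t"
        by (intro mult_right_mono mn(1)[OF t(1) x t(2)] nn(2)[OF t(1)])
      then show "alt_int' b F G n t \<le> iter_int b F (Suc n) x * iter_int b G n t"
        using *[OF t(1) Suc.IH] by linarith
    qed
    then show ?case by simp
  qed simp
  show "alt_int b F G n x \<le> iter_int b F n x * iter_int b G n x" by (rule **[OF assms])
  show "alt_int' b F G n x \<le> iter_int b F (Suc n) x * iter_int b G n x"
    by (rule *[OF assms **])
qed

lemma alt_int_le:
  assumes x: "x \<in> dom0 b" and t: "0 \<le> t" "t \<le> x"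
  shows "alt_int b F G n t \<le> (F x * G x) ^ n / fact n"
    and "alt_int' b F G n t \<le> (F x * G x) ^ n / fact n * F x"
proof -
  have *: "alt_int b F G n x \<le> (F x * G x) ^ n / fact n" if x: "x \<in> dom0 b" for x
  proof -
    have nn: "0 \<le> F x" "0 \<le> G x" using F.nonneg G.nonneg x by auto
    have "alt_int b F G n x \<le> iter_int b F n x * iter_int b G n x" by (rule alt_int_le_iter[OF x])
    also have "\<dots> \<le> F x ^ n / fact n * (G x ^ n / fact n)"
      using G.nonneg_mono_iter_int[of n] x nn
      by (intro mult_mono F.iter_int_le G.iter_int_le) (auto simp: nonneg_mono_def)
    also have "\<dots> \<le> F x ^ n / fact n * (G x ^ n / 1)"
      using nn by (intro mult_left_mono divide_left_mono) auto
    finally show ?thesis by (simp add: power_mult_distrib)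
  qed
  have td: "t \<in> dom0 b" by (rule dom0_less[OF x t])
  have "alt_int b F G n t \<le> alt_int b F G n x" "alt_int' b F G n t \<le> alt_int' b F G n x"
    using nonneg_mono_alt td x t by (auto simp: nonneg_mono_def monotone_on_def)
  moreover have "alt_int' b F G n x \<le> alt_int b F G n x * F x"
    by (rule F.integral_nonneg_mono_le[OF x nonneg_mono_alt(1)])
  moreover have "alt_int b F G n x * F x \<le> (F x * G x) ^ n / fact n * F x"
    by (intro mult_right_mono * x F.nonneg)
  ultimately show "alt_int b F G n t \<le> (F x * G x) ^ n / fact n"
      "alt_int' b F G n t \<le> (F x * G x) ^ n / fact n * F x" using *[OF x] by linarith+
qed

text \<open>
  The solution \<open>p =\<close> \<open>even_series\<close> and \<open>r =\<close> \<open>odd_series\<close> of \<open>p = 1 + z \<integral> r dG\<close>, \<open>r = \<integral> p dF\<close>, as power series in \<open>z\<close>;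
  the coefficients of \<open>p\<close> are integrals of even, those of \<open>r\<close> of odd multiplicity. With \<open>-z\<close> for \<open>z\<close>,
  the choice \<open>F = W\<close>, \<open>G = R\<close> yields \<open>c = p\<close>, and the choice \<open>F = R\<close>, \<open>G = W\<close> yields \<open>s = r\<close>.
\<close>

definition even_series :: "complex \<Rightarrow> real \<Rightarrow> complex" where
  "even_series z x = (\<Sum>n. of_real (alt_int b F G n x) * z ^ n)"

definition odd_series :: "complex \<Rightarrow> real \<Rightarrow> complex" where
  "odd_series z x = (\<Sum>n. of_real (alt_int' b F G n x) * z ^ n)"

lemma summable_bound: "summable (\<lambda>n. (K::real) ^ n / fact n * C)"
  using summable_exp_generic[of K] by (intro summable_mult2) (simp add: divide_inverse mult.commute)

lemma norm_terms:
  assumes x: "x \<in> dom0 b" and t: "0 \<le> t" "t \<le> x"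
  shows "norm (of_real (alt_int b F G n t) * z ^ n) \<le> (F x * G x * cmod z) ^ n / fact n * 1"
    and "norm (of_real (alt_int' b F G n t) * z ^ n) \<le> (F x * G x * cmod z) ^ n / fact n * F x"
proof -
  have td: "t \<in> dom0 b" by (rule dom0_less[OF x t])
  have "norm (of_real (alt_int b F G n t) * z ^ n) = alt_int b F G n t * cmod z ^ n"
    using alt_int_nonneg(1)[OF td] by (simp add: norm_mult norm_power)
  also have "\<dots> \<le> ((F x * G x) ^ n / fact n) * cmod z ^ n"
    by (intro mult_right_mono alt_int_le[OF x t]) auto
  finally show "norm (of_real (alt_int b F G n t) * z ^ n) \<le> (F x * G x * cmod z) ^ n / fact n * 1"
    by (simp add: power_mult_distrib)
  have "norm (of_real (alt_int' b F G n t) * z ^ n) = alt_int' b F G n t * cmod z ^ n"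
    using alt_int_nonneg(2)[OF td] by (simp add: norm_mult norm_power)
  also have "\<dots> \<le> ((F x * G x) ^ n / fact n * F x) * cmod z ^ n"
    by (intro mult_right_mono alt_int_le[OF x t]) auto
  finally show "norm (of_real (alt_int' b F G n t) * z ^ n) \<le> (F x * G x * cmod z) ^ n / fact n * F x"
    by (simp add: power_mult_distrib mult_ac)
qed

lemma summable_terms:
  fixes z :: complex
  assumes "x \<in> dom0 b"
  shows "summable (\<lambda>n. norm (of_real (alt_int b F G n x) * z ^ n))"
    "summable (\<lambda>n. norm (of_real (alt_int' b F G n x) * z ^ n))"
proof -
  have x: "0 \<le> x" "x \<le> x" using assms by (auto simp: dom0_def)
  show "summable (\<lambda>n. norm (of_real (alt_int b F G n x) * z ^ n))"
    by (rule summable_comparison_test'[OF summable_bound, of 0]) (subst real_norm_def, subst abs_norm_cancel, rule norm_terms(1)[OF assms x])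
  show "summable (\<lambda>n. norm (of_real (alt_int' b F G n x) * z ^ n))"
    by (rule summable_comparison_test'[OF summable_bound, of 0]) (subst real_norm_def, subst abs_norm_cancel, rule norm_terms(2)[OF assms x])
qed

lemma termwise:
  fixes f :: "nat \<Rightarrow> real \<Rightarrow> complex"
  assumes H: "stieltjes b H" and x: "x \<in> dom0 b"
    and f: "\<And>n. f n \<in> borel_measurable (trunc b H x)"
    and B: "\<And>n t. 0 \<le> t \<Longrightarrow> t < x \<Longrightarrow> norm (f n t) \<le> B n" "summable B"
  shows "integrable (trunc b H x) (\<lambda>t. \<Sum>n. f n t)"
    "(\<integral>t. (\<Sum>n. f n t) \<partial>trunc b H x) = (\<Sum>n. integral\<^sup>L (trunc b H x) (f n))"
proof -
  interpret H: stieltjes b H by fact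
  have int: "integrable (trunc b H x) (f n)" for n
    by (rule H.integrable_trunc_bounded[OF x f B(1)])
  have A: "AE t in trunc b H x. summable (\<lambda>n. norm (f n t))"
    using B by (intro AE_I2) (auto simp: space_trunc[OF x] intro!: summable_comparison_test'[OF B(2), of 0])
  have S: "summable (\<lambda>n. \<integral>t. norm (f n t) \<partial>trunc b H x)"
  proof (cases "0 < x")
    case False
    then have "H x = 0" "x = 0" using x H.zero by (auto simp: dom0_def)
    then have "norm (\<integral>t. norm (f n t) \<partial>trunc b H x) \<le> 0" for n
      using H.norm_integral_trunc_le[OF x, of "\<lambda>t. norm (f n t)" 0] by auto
    then have "(\<lambda>n. \<integral>t. norm (f n t) \<partial>trunc b H x) = (\<lambda>n. 0)" by (intro ext antisym) auto
    then show ?thesis by (simp only: summable_zero)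
  next
    case True
    have B0: "0 \<le> B n" for n using B(1)[of 0 n] True norm_ge_zero order_trans by blast
    have "norm (\<integral>t. norm (f n t) \<partial>trunc b H x) \<le> B n * H x" for n
      using H.norm_integral_trunc_le[OF x, of "\<lambda>t. norm (f n t)" "B n"] B(1) B0 by auto
    then show ?thesis by (intro summable_comparison_test'[OF summable_mult2[OF B(2)], of 0]) auto
  qed
  show "integrable (trunc b H x) (\<lambda>t. \<Sum>n. f n t)" by (rule integrable_suminf[OF int A S])
  show "(\<integral>t. (\<Sum>n. f n t) \<partial>trunc b H x) = (\<Sum>n. integral\<^sup>L (trunc b H x) (f n))"
    by (rule integral_suminf[OF int A S])
qed

lemma series_solution:
  assumes x: "x \<in> dom0 b"
  shows "integrable (trunc b F x) (even_series z)" "odd_series z x = integral\<^sup>L (trunc b F x) (even_series z)"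
    "integrable (trunc b G x) (odd_series z)" "even_series z x = 1 + z * integral\<^sup>L (trunc b G x) (odd_series z)"
proof -
  have H: "stieltjes b F" "stieltjes b G" ..
  have m1: "(\<lambda>t. of_real (alt_int b F G n t) * z ^ n) \<in> borel_measurable (trunc b F x)" for n
    using mono_on_measurable_trunc[OF x, of "alt_int b F G n" F] nonneg_mono_alt by (simp add: nonneg_mono_def)
  have m2: "(\<lambda>t. of_real (alt_int' b F G n t) * z ^ n) \<in> borel_measurable (trunc b G x)" for n
    using mono_on_measurable_trunc[OF x, of "alt_int' b F G n" G] nonneg_mono_alt by (simp add: nonneg_mono_def)
  note t1 = termwise[where B = "\<lambda>n. (F x * G x * cmod z) ^ n / fact n * 1", OF H(1) x m1 norm_terms(1)[OF x _ less_imp_le] summable_bound]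
  note t2 = termwise[where B = "\<lambda>n. (F x * G x * cmod z) ^ n / fact n * F x", OF H(2) x m2 norm_terms(2)[OF x _ less_imp_le] summable_bound]
  have e: "even_series z = (\<lambda>t. \<Sum>n. of_real (alt_int b F G n t) * z ^ n)"
    "odd_series z = (\<lambda>t. \<Sum>n. of_real (alt_int' b F G n t) * z ^ n)"
    by (auto simp: even_series_def odd_series_def)
  show "integrable (trunc b F x) (even_series z)" unfolding e by (rule t1(1))
  show "integrable (trunc b G x) (odd_series z)" unfolding e by (rule t2(1))
  show "odd_series z x = integral\<^sup>L (trunc b F x) (even_series z)"
  proof -
    have "odd_series z x = (\<Sum>n. \<integral>t. of_real (alt_int b F G n t) * z ^ n \<partial>trunc b F x)" by (simp add: e)
    also have "\<dots> = integral\<^sup>L (trunc b F x) (even_series z)" unfolding e by (rule t1(2)[symmetric])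
    finally show ?thesis .
  qed
  have "even_series z x = of_real (alt_int b F G 0 x) * z ^ 0 + (\<Sum>n. of_real (alt_int b F G (Suc n) x) * z ^ Suc n)"
    unfolding e using suminf_split_head[OF summable_norm_cancel[OF summable_terms(1)[OF x, of z]]] by simp
  also have "(\<Sum>n. of_real (alt_int b F G (Suc n) x) * z ^ Suc n)
      = (\<Sum>n. z * (of_real (alt_int b F G (Suc n) x) * z ^ n))" by (simp add: mult_ac)
  also have "\<dots> = (\<Sum>n. z * (\<integral>t. of_real (alt_int' b F G n t) * z ^ n \<partial>trunc b G x))"
    by simp
  also have "\<dots> = (\<Sum>n. (\<integral>t. z * (of_real (alt_int' b F G n t) * z ^ n) \<partial>trunc b G x))"
    by simp
  also have "\<dots> = (\<integral>t. (\<Sum>n. z * (of_real (alt_int' b F G n t) * z ^ n)) \<partial>trunc b G x)"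
  proof (rule termwise(2)[OF H(2) x, symmetric])
    show "(\<lambda>t. z * (of_real (alt_int' b F G n t) * z ^ n)) \<in> borel_measurable (trunc b G x)" for n
      by (rule borel_measurable_times[OF borel_measurable_const m2])
    show "norm (z * (of_real (alt_int' b F G n t) * z ^ n)) \<le> cmod z * ((F x * G x * cmod z) ^ n / fact n * F x)"
      if "0 \<le> t" "t < x" for n t
      using mult_left_mono[OF norm_terms(2)[OF x that(1) less_imp_le[OF that(2)], of n z], of "cmod z"]
      by (simp add: norm_mult)
    show "summable (\<lambda>n. cmod z * ((F x * G x * cmod z) ^ n / fact n * F x))"
      by (intro summable_mult summable_bound)
  qed
  also have "\<dots> = (\<integral>t. z * odd_series z t \<partial>trunc b G x)"
  proof (rule Bochner_Integration.integral_cong[OF refl])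
    fix t assume "t \<in> space (trunc b G x)"
    then have "t \<in> dom0 b" using dom0_less[OF x] by (auto simp: space_trunc[OF x])
    from suminf_mult[OF summable_norm_cancel[OF summable_terms(2)[OF this, of z]], of z]
    show "(\<Sum>n. z * (of_real (alt_int' b F G n t) * z ^ n)) = z * odd_series z t" by (simp add: e)
  qed
  finally show "even_series z x = 1 + z * integral\<^sup>L (trunc b G x) (odd_series z)" by simp
qed

text \<open>
  The homogeneous system with zero initial values has only the zero solution: iterating the two
  equations bounds \<open>u\<close> by the \<open>n\<close>-th term of an exponential series, for every \<open>n\<close>.
\<close>

lemma zero_solution:
  assumes i: "\<And>x. x \<in> dom0 b \<Longrightarrow> integrable (trunc b F x) u" "\<And>x. x \<in> dom0 b \<Longrightarrow> integrable (trunc b G x) v"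
    and e: "\<And>x. x \<in> dom0 b \<Longrightarrow> v x = integral\<^sup>L (trunc b F x) u"
      "\<And>x. x \<in> dom0 b \<Longrightarrow> u x = (z::complex) * integral\<^sup>L (trunc b G x) v"
    and x: "x \<in> dom0 b"
  shows "u x = 0" "v x = 0"
proof -
  define B where "B = cmod z * (\<integral>t. norm (v t) \<partial>trunc b G x)"
  have B0: "0 \<le> B" by (simp add: B_def)
  have le: "norm (u t) \<le> B * cmod z ^ n * alt_int b F G n t" if "0 \<le> t" "t \<le> x" for n t
    using that
  proof (induction n arbitrary: t)
    case 0
    have td: "t \<in> dom0 b" using dom0_less[OF x] 0 by auto
    have "norm (u t) \<le> cmod z * (\<integral>t. norm (v t) \<partial>trunc b G t)"
      unfolding e(2)[OF td] norm_mult by (intro mult_left_mono integral_norm_bound) auto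
    also have "\<dots> \<le> B"
      unfolding B_def using 0 i(2)[OF x] by (intro mult_left_mono G.integral_trunc_mono x) auto
    finally show ?case by simp
  next
    case (Suc n)
    let ?K = "B * cmod z ^ n"
    have v: "norm (v s) \<le> ?K * alt_int' b F G n s" if s: "0 \<le> s" "s \<le> x" for s
    proof -
      have sd: "s \<in> dom0 b" using dom0_less[OF x] s by auto
      have "norm (v s) \<le> (\<integral>t. norm (u t) \<partial>trunc b F s)" unfolding e(1)[OF sd] by (rule integral_norm_bound)
      also have "\<dots> \<le> (\<integral>t. ?K * alt_int b F G n t \<partial>trunc b F s)"
        using Suc.IH s i(1)[OF sd] F.integrable_nonneg_mono[OF sd nonneg_mono_alt(1)]
        by (intro integral_mono) (auto simp: space_trunc[OF sd])
      finally show ?thesis by simp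
    qed
    have td: "t \<in> dom0 b" using dom0_less[OF x] Suc by auto
    have "norm (u t) \<le> cmod z * (\<integral>s. norm (v s) \<partial>trunc b G t)"
      unfolding e(2)[OF td] norm_mult by (intro mult_left_mono integral_norm_bound) auto
    also have "\<dots> \<le> cmod z * (\<integral>s. ?K * alt_int' b F G n s \<partial>trunc b G t)"
      using v Suc.prems i(2)[OF td] G.integrable_nonneg_mono[OF td nonneg_mono_alt(2)]
      by (intro mult_left_mono integral_mono) (auto simp: space_trunc[OF td])
    finally show ?case by (simp add: mult_ac)
  qed
  have "norm (u t) = 0" if t: "0 \<le> t" "t \<le> x" for t
  proof -
    have "norm (u t) \<le> B * ((F x * G x * cmod z) ^ n / fact n * 1)" for n
    proof -
      have "B * cmod z ^ n * alt_int b F G n t \<le> B * cmod z ^ n * ((F x * G x) ^ n / fact n)"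
        using B0 by (intro mult_left_mono alt_int_le[OF x t]) auto
      then show ?thesis using le[OF t, of n] by (simp add: power_mult_distrib mult_ac)
    qed
    moreover have "(\<lambda>n. B * ((F x * G x * cmod z) ^ n / fact n * 1)) \<longlonglongrightarrow> B * 0"
      by (intro tendsto_mult tendsto_const summable_LIMSEQ_zero summable_bound)
    ultimately have "norm (u t) \<le> B * 0" by (intro LIMSEQ_le_const) auto
    then show ?thesis by simp
  qed
  then have u0: "u t = 0" if "0 \<le> t" "t \<le> x" for t using that by simp
  show "u x = 0" using u0[of x] x by (auto simp: dom0_def)
  have "(\<integral>t. u t \<partial>trunc b F x) = (\<integral>t. 0 \<partial>trunc b F x)"
    by (rule Bochner_Integration.integral_cong) (use u0 in \<open>auto simp: space_trunc[OF x]\<close>)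
  then show "v x = 0" using e(1)[OF x] by simp
qed

end

section \<open>Square integrability and the Cauchy--Schwarz inequality\<close>

text \<open>
  The integral of \<open>|u|\<^sup>2\<close> over \<open>[0,x)\<close> against \<open>dF\<close>. It is used with \<open>F = W\<close> for a solution and with
  \<open>F = R\<close> for its quasi-derivative.
\<close>

definition energy :: "ereal \<Rightarrow> (real \<Rightarrow> real) \<Rightarrow> (real \<Rightarrow> complex) \<Rightarrow> real \<Rightarrow> real" where
  "energy b F u x = (\<integral>t. (cmod (u t))\<^sup>2 \<partial>trunc b F x)"

lemma integral_trunc_cong:
  assumes "x \<in> dom0 b" "\<And>t. 0 \<le> t \<Longrightarrow> t < x \<Longrightarrow> f t = g t"
  shows "integral\<^sup>L (trunc b F x) f = integral\<^sup>L (trunc b F x) g"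
  by (rule Bochner_Integration.integral_cong) (use assms in \<open>auto simp: space_trunc\<close>)

lemma integrable_trunc_cong:
  assumes "x \<in> dom0 b" "\<And>t. 0 \<le> t \<Longrightarrow> t < x \<Longrightarrow> f t = g t"
  shows "integrable (trunc b F x) f \<longleftrightarrow> integrable (trunc b F x) g"
  by (rule Bochner_Integration.integrable_cong) (use assms in \<open>auto simp: space_trunc\<close>)

context stieltjes begin

lemma integral_trunc_0 [simp]:
  fixes f :: "real \<Rightarrow> 'a::{banach, second_countable_topology}"
  shows "integral\<^sup>L (trunc b F 0) f = 0"
  using norm_integral_trunc_le[OF zero_dom, of f 0] by auto

lemma integral_trunc_const':
  fixes c :: "'a::{banach, second_countable_topology}"
  shows "x \<in> dom0 b \<Longrightarrow> integral\<^sup>L (trunc b F x) (\<lambda>_. c) = F x *\<^sub>R c"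
  by (simp add: measure_space_trunc)

lemma integrable_trunc_const: "x \<in> dom0 b \<Longrightarrow> integrable (trunc b F x) (\<lambda>_. c)"
  using finite_measure.integrable_const[OF finite_trunc] .

lemma energy_nonneg: "0 \<le> energy b F u x"
  by (simp add: energy_def)

lemma energy_mono:
  assumes "x \<in> dom0 b" "integrable (trunc b F x) (\<lambda>t. (cmod (u t))\<^sup>2)" "0 \<le> t" "t \<le> x"
  shows "energy b F u t \<le> energy b F u x"
  unfolding energy_def using assms by (intro integral_trunc_mono) auto

lemma Cauchy_Schwarz_trunc:
  fixes u :: "real \<Rightarrow> complex"
  assumes x: "x \<in> dom0 b" and u: "integrable (trunc b F x) u" and u2: "integrable (trunc b F x) (\<lambda>t. (cmod (u t))\<^sup>2)"
    and w: "\<And>t. 0 \<le> t \<Longrightarrow> t < x \<Longrightarrow> cmod (w t) \<le> cmod (u t)"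
  shows "cmod (integral\<^sup>L (trunc b F x) w) \<le> sqrt (energy b F u x * F x)"
proof -
  let ?M = "trunc b F x"
  define I where "I = (\<integral>t. cmod (u t) \<partial>?M)"
  have I0: "0 \<le> I" by (simp add: I_def)
  have "cmod (integral\<^sup>L ?M w) \<le> I"
  proof (cases "integrable ?M w")
    case True
    have "cmod (integral\<^sup>L ?M w) \<le> (\<integral>t. cmod (w t) \<partial>?M)" by (rule integral_norm_bound)
    also have "\<dots> \<le> I" unfolding I_def
      using True u w by (intro integral_mono) (auto simp: space_trunc[OF x])
    finally show ?thesis .
  qed (simp add: not_integrable_integral_eq I0)
  moreover have "I\<^sup>2 \<le> energy b F u x * F x"
  proof -
    have "0 \<le> (\<integral>t. (F x * cmod (u t) - I)\<^sup>2 \<partial>?M)" by simp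
    also have "\<dots> = (\<integral>t. F x ^ 2 * (cmod (u t))\<^sup>2 - 2 * F x * I * cmod (u t) + I\<^sup>2 \<partial>?M)"
      by (rule Bochner_Integration.integral_cong) (simp_all add: power2_eq_square algebra_simps)
    also have "\<dots> = F x ^ 2 * energy b F u x - 2 * F x * I * I + I\<^sup>2 * F x"
    proof -
      have i1: "integrable ?M (\<lambda>t. F x ^ 2 * (cmod (u t))\<^sup>2)" using u2 by simp
      have i2: "integrable ?M (\<lambda>t. 2 * F x * I * cmod (u t))" using integrable_norm[OF u] by simp
      have i3: "integrable ?M (\<lambda>t. I\<^sup>2)" by (rule integrable_trunc_const[OF x])
      show ?thesis
        unfolding Bochner_Integration.integral_add[OF Bochner_Integration.integrable_diff[OF i1 i2] i3]
          Bochner_Integration.integral_diff[OF i1 i2] integral_trunc_const[OF x]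
          integral_mult_right_zero energy_def I_def[symmetric] ..
    qed
    finally have *: "0 \<le> F x * (F x * energy b F u x - I\<^sup>2)" by (simp add: power2_eq_square algebra_simps)
    show ?thesis
    proof (cases "F x = 0")
      case True
      have "norm I \<le> 0"
      proof -
        interpret finite_measure ?M by (rule finite_trunc[OF x])
        have "emeasure ?M (space ?M) = 0" using emeasure_space_trunc[OF x] True by simp
        then have "AE t in ?M. cmod (u t) = 0" by (intro AE_I[of _ _ "space ?M"]) auto
        then have "I = (\<integral>t. 0 \<partial>?M)" unfolding I_def using u by (intro integral_cong_AE) auto
        then show ?thesis by simp
      qed
      then show ?thesis using True by simp
    next
      case False
      then show ?thesis using * nonneg[OF x] by (simp add: zero_le_mult_iff mult.commute)
    qed
  qed
  ultimately show ?thesis by (meson order_trans real_le_rsqrt)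
qed

text \<open>
  The interval in \<open>L2_on\<close> omits the point \<open>0\<close>, which carries finite mass and hence plays no role.
\<close>

lemma L2_on_iff:
  fixes u :: "real \<Rightarrow> complex"
  assumes u: "\<And>x. x \<in> dom0 b \<Longrightarrow> integrable (trunc b F x) u"
    and u2: "\<And>x. x \<in> dom0 b \<Longrightarrow> integrable (trunc b F x) (\<lambda>t. (cmod (u t))\<^sup>2)"
  shows "L2_on (LS_measure b F) {x. 0 < x \<and> ereal x < b} u \<longleftrightarrow> (\<exists>K. \<forall>x\<in>dom0 b. energy b F u x \<le> K)"
proof -
  let ?M = "LS_measure b F" and ?A = "{x. 0 < x \<and> ereal x < b}"
  have en: "energy b F u x = (\<integral>t. indicator {0..<x} t *\<^sub>R (cmod (u t))\<^sup>2 \<partial>?M)" if "x \<in> dom0 b" for x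
    using set_integral_LS_eq[OF that, of F "\<lambda>t. (cmod (u t))\<^sup>2"] by (simp add: energy_def set_lebesgue_integral_def)
  have i2: "integrable ?M (\<lambda>t. indicator {0..<x} t *\<^sub>R (cmod (u t))\<^sup>2)" if "x \<in> dom0 b" for x
    using set_integrable_LS_iff[OF that, of F "\<lambda>t. (cmod (u t))\<^sup>2"] u2[OF that] by (simp add: set_integrable_def)
  have i1: "integrable ?M (\<lambda>t. indicator {0..<x} t *\<^sub>R u t)" if "x \<in> dom0 b" for x
    using set_integrable_LS_iff[OF that, of F u] u[OF that] by (simp add: set_integrable_def)
  show ?thesis
  proof
    assume "L2_on ?M ?A u"
    then have iA: "integrable ?M (\<lambda>t. indicator ?A t *\<^sub>R (cmod (u t))\<^sup>2)" by (simp add: L2_on_def set_integrable_def)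
    obtain x1 where x1: "x1 \<in> dom0 b" "0 < F x1" using ex_gt by blast
    then have x10: "0 < x1" using zero by (cases "x1 = 0") (auto simp: dom0_def)
    have "energy b F u x \<le> energy b F u x1 + (\<integral>t. indicator ?A t *\<^sub>R (cmod (u t))\<^sup>2 \<partial>?M)" if x: "x \<in> dom0 b" for x
    proof -
      have "energy b F u x \<le> (\<integral>t. indicator {0..<x1} t *\<^sub>R (cmod (u t))\<^sup>2 + indicator ?A t *\<^sub>R (cmod (u t))\<^sup>2 \<partial>?M)"
        unfolding en[OF x]
      proof (rule integral_mono[OF i2[OF x] Bochner_Integration.integrable_add[OF i2[OF x1(1)] iA]])
        fix t assume "t \<in> space ?M"
        then show "indicator {0..<x} t *\<^sub>R (cmod (u t))\<^sup>2 \<le> indicator {0..<x1} t *\<^sub>R (cmod (u t))\<^sup>2 + indicator ?A t *\<^sub>R (cmod (u t))\<^sup>2"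
          using x10 by (auto simp: indicator_def dom0_def)
      qed
      then show ?thesis using i2[OF x1(1)] iA en[OF x1(1)] by simp
    qed
    then show "\<exists>K. \<forall>x\<in>dom0 b. energy b F u x \<le> K" by blast
  next
    assume "\<exists>K. \<forall>x\<in>dom0 b. energy b F u x \<le> K"
    then obtain K where K: "\<And>x. x \<in> dom0 b \<Longrightarrow> energy b F u x \<le> K" by blast
    have "\<forall>n. \<exists>x\<in>dom0 b. real n < F x" using ex_gt by blast
    then obtain X where X: "\<And>n. X n \<in> dom0 b" "\<And>n. real n < F (X n)" by metis
    have ev: "\<forall>\<^sub>F n in sequentially. indicator {0..<X n} t = (1::real)" if t: "t \<in> space ?M" for t
    proof -
      obtain N :: nat where N: "F t \<le> real N" using real_arch_simple by blast
      have "t < X n" if n: "n \<ge> N" for n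
      proof (rule ccontr)
        assume "\<not> t < X n"
        then have "F (X n) \<le> F t" using le[of t "X n"] t X(1)[of n] by (auto simp: dom0_def)
        then show False using N X(2)[of n] n by linarith
      qed
      then show ?thesis using t by (auto simp: eventually_sequentially dom0_def intro!: exI[of _ N])
    qed
    have mu: "u \<in> borel_measurable ?M"
    proof (rule borel_measurable_LIMSEQ_metric)
      show "(\<lambda>t. indicator {0..<X n} t *\<^sub>R u t) \<in> borel_measurable ?M" for n using i1[OF X(1)] by auto
      show "(\<lambda>n. indicator {0..<X n} t *\<^sub>R u t) \<longlonglongrightarrow> u t" if "t \<in> space ?M" for t
        by (rule tendsto_eventually) (use ev[OF that] in eventually_elim, simp)
    qed
    have K0: "0 \<le> K" using K[OF zero_dom] energy_nonneg order_trans by blast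
    have "(\<integral>\<^sup>+t. ennreal ((cmod (u t))\<^sup>2) \<partial>?M) \<le> (\<integral>\<^sup>+t. liminf (\<lambda>n. ennreal (indicator {0..<X n} t *\<^sub>R (cmod (u t))\<^sup>2)) \<partial>?M)"
    proof (rule nn_integral_mono)
      fix t assume "t \<in> space ?M"
      have "(\<lambda>n. ennreal (indicator {0..<X n} t *\<^sub>R (cmod (u t))\<^sup>2)) \<longlonglongrightarrow> ennreal ((cmod (u t))\<^sup>2)"
        by (rule tendsto_eventually) (use ev[OF \<open>t \<in> _\<close>] in eventually_elim, simp)
      then show "ennreal ((cmod (u t))\<^sup>2) \<le> liminf (\<lambda>n. ennreal (indicator {0..<X n} t *\<^sub>R (cmod (u t))\<^sup>2))"
        by (rule order_eq_refl[OF lim_imp_Liminf[OF trivial_limit_sequentially, symmetric]])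
    qed
    also have "\<dots> \<le> liminf (\<lambda>n. \<integral>\<^sup>+t. ennreal (indicator {0..<X n} t *\<^sub>R (cmod (u t))\<^sup>2) \<partial>?M)"
      using i2[OF X(1)] by (intro nn_integral_liminf) auto
    also have "\<dots> = liminf (\<lambda>n. ennreal (energy b F u (X n)))"
      using i2[OF X(1)] by (subst nn_integral_eq_integral) (auto simp: en[OF X(1)])
    also have "\<dots> \<le> liminf (\<lambda>n::nat. ennreal K)"
      by (intro Liminf_mono always_eventually allI ennreal_leI K X(1))
    also have "\<dots> = ennreal K" by (simp add: Liminf_const)
    finally have fin: "(\<integral>\<^sup>+t. ennreal ((cmod (u t))\<^sup>2) \<partial>?M) < \<infinity>"
      by (rule le_less_trans) simp
    have iu: "integrable ?M (\<lambda>t. (cmod (u t))\<^sup>2)"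
      using mu fin by (intro integrableI_bounded) auto
    have Ain: "?A \<inter> space ?M \<in> sets ?M"
      by (auto simp: sets_LS_measure_eq sets_restrict_space dom0_def intro!: image_eqI[of _ _ "{0<..}"])
    have e: "indicator ?A t *\<^sub>R f t = indicator (?A \<inter> space ?M) t *\<^sub>R f t" if "t \<in> space ?M" for t and f :: "real \<Rightarrow> 'c::real_vector"
      using that by (auto simp: indicator_def)
    have "(\<lambda>t. indicator ?A t *\<^sub>R u t) \<in> borel_measurable ?M \<longleftrightarrow>
        (\<lambda>t. indicator (?A \<inter> space ?M) t *\<^sub>R u t) \<in> borel_measurable ?M"
      by (rule measurable_cong) (rule e)
    then have "set_borel_measurable ?M ?A u"
      using borel_measurable_scaleR[OF borel_measurable_indicator[OF Ain] mu]
      by (simp only: set_borel_measurable_def)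
    moreover have "integrable ?M (\<lambda>t. indicator ?A t *\<^sub>R (cmod (u t))\<^sup>2) \<longleftrightarrow>
        integrable ?M (\<lambda>t. indicator (?A \<inter> space ?M) t *\<^sub>R (cmod (u t))\<^sup>2)"
      by (rule Bochner_Integration.integrable_cong[OF refl]) (rule e)
    then have "set_integrable ?M ?A (\<lambda>t. (cmod (u t))\<^sup>2)"
      using integrable_mult_indicator[OF Ain iu] by (simp only: set_integrable_def)
    ultimately show "L2_on ?M ?A u" by (simp add: L2_on_def)
  qed
qed

end

section \<open>The system: integration by parts and the energy identity\<close>

locale string_system = W: stieltjes b W + R: stieltjes b R for b W R +
  assumes no_common: "\<forall>x\<in>dom0 b. continuous (at x within dom0 b) W \<or> continuous (at x within dom0 b) R"
begin

sublocale WR: stieltjes_pair b W R ..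
sublocale RW: stieltjes_pair b R W ..

lemma AE_no_common_atoms:
  assumes x: "x \<in> dom0 b"
  shows "AE s in trunc b R x. measure (trunc b W x) {s} = 0"
proof -
  let ?D = "{t \<in> dom0 b. \<not> continuous (at t within dom0 b) W} \<inter> {0..<x}"
  have c: "countable ?D" using mono_on_ctble_discont[OF W.mono] by blast
  have "(\<Union>t\<in>?D. {t}) \<in> null_sets (trunc b R x)"
  proof (rule null_sets_UN'[OF c])
    fix t assume t: "t \<in> ?D"
    then have t': "0 \<le> t" "t < x" "continuous (at t within dom0 b) R" using no_common by auto
    interpret finite_measure "trunc b R x" by (rule R.finite_trunc[OF x])
    show "{t} \<in> null_sets (trunc b R x)"
      using R.null_singleton[OF x t'] singleton_sets_trunc[OF x t'(1,2)]
      by (auto simp: null_sets_def emeasure_eq_measure)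
  qed
  moreover have "(\<Union>t\<in>?D. {t}) = ?D" by blast
  ultimately have "?D \<in> null_sets (trunc b R x)" by metis
  then have "AE s in trunc b R x. s \<notin> ?D" by (rule AE_not_in)
  moreover have "AE s in trunc b R x. s \<in> space (trunc b R x)" by (rule AE_space)
  ultimately show ?thesis
  proof eventually_elim
    case (elim s)
    then have "0 \<le> s" "s < x" by (auto simp: space_trunc[OF x])
    moreover from this have "s \<in> dom0 b" using dom0_less[OF x] by auto
    ultimately show ?case using elim by (intro W.null_singleton[OF x]) auto
  qed
qed

lemma integration_by_parts:
  fixes f g F G :: "real \<Rightarrow> complex"
  assumes x: "x \<in> dom0 b"
    and f: "integrable (trunc b R x) f" and g: "integrable (trunc b W x) g"
    and F: "\<And>t. 0 \<le> t \<Longrightarrow> t \<le> x \<Longrightarrow> F t = F0 + integral\<^sup>L (trunc b R t) f"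
    and G: "\<And>t. 0 \<le> t \<Longrightarrow> t \<le> x \<Longrightarrow> G t = G0 + integral\<^sup>L (trunc b W t) g"
  shows "integrable (trunc b R x) (\<lambda>t. f t * G t)" "integrable (trunc b W x) (\<lambda>t. F t * g t)"
    "F x * G x - F0 * G0 = (\<integral>t. f t * G t \<partial>trunc b R x) + (\<integral>t. F t * g t \<partial>trunc b W x)"
proof -
  have st: "stieltjes b R" "stieltjes b W" ..
  note Fub = Fubini_triangles[OF st x f g]
  have x0: "0 \<le> x" "x \<le> x" using x by (auto simp: dom0_def)
  have c1: "f t * G t = f t * G0 + f t * integral\<^sup>L (trunc b W t) g" if "0 \<le> t" "t < x" for t
    using G[of t] that by (simp add: algebra_simps)
  have c2: "F t * g t = F0 * g t + integral\<^sup>L (trunc b R t) f * g t" if "0 \<le> t" "t < x" for t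
    using F[of t] that by (simp add: algebra_simps)
  have i1: "integrable (trunc b R x) (\<lambda>t. f t * G0 + f t * integral\<^sup>L (trunc b W t) g)"
    using f Fub(2) by simp
  have i2: "integrable (trunc b W x) (\<lambda>t. F0 * g t + integral\<^sup>L (trunc b R t) f * g t)"
    using g Fub(3) by simp
  have e1: "(\<integral>t. f t * G t \<partial>trunc b R x) = (\<integral>t. f t * G0 + f t * integral\<^sup>L (trunc b W t) g \<partial>trunc b R x)"
    and j1: "integrable (trunc b R x) (\<lambda>t. f t * G t) \<longleftrightarrow>
      integrable (trunc b R x) (\<lambda>t. f t * G0 + f t * integral\<^sup>L (trunc b W t) g)"
    by (intro integral_trunc_cong integrable_trunc_cong x c1, assumption+)+
  have e2: "(\<integral>t. F t * g t \<partial>trunc b W x) = (\<integral>t. F0 * g t + integral\<^sup>L (trunc b R t) f * g t \<partial>trunc b W x)"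
    and j2: "integrable (trunc b W x) (\<lambda>t. F t * g t) \<longleftrightarrow>
      integrable (trunc b W x) (\<lambda>t. F0 * g t + integral\<^sup>L (trunc b R t) f * g t)"
    by (intro integral_trunc_cong integrable_trunc_cong x c2, assumption+)+
  show "integrable (trunc b R x) (\<lambda>t. f t * G t)" unfolding j1 by (rule i1)
  show "integrable (trunc b W x) (\<lambda>t. F t * g t)" unfolding j2 by (rule i2)
  \<comment> \<open>The diagonal vanishes, as there are no common atoms.\<close>
  have z: "(\<integral>s. measure (trunc b W x) {s} *\<^sub>R (f s * g s) \<partial>trunc b R x) = 0"
    by (rule integral_eq_zero_AE) (use AE_no_common_atoms[OF x] in eventually_elim, simp)
  have "(\<integral>t. f t * G t \<partial>trunc b R x) = integral\<^sup>L (trunc b R x) f * G0 + (\<integral>t. f t * integral\<^sup>L (trunc b W t) g \<partial>trunc b R x)"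
    unfolding e1 using f Fub(2) by simp
  moreover have "(\<integral>t. F t * g t \<partial>trunc b W x) = F0 * integral\<^sup>L (trunc b W x) g + (\<integral>t. integral\<^sup>L (trunc b R t) f * g t \<partial>trunc b W x)"
    unfolding e2 using g Fub(3) by simp
  ultimately show "F x * G x - F0 * G0 = (\<integral>t. f t * G t \<partial>trunc b R x) + (\<integral>t. F t * g t \<partial>trunc b W x)"
    using Fub(1) z F[OF x0] G[OF x0] by (simp add: algebra_simps)
qed

lemma solves_iff:
  "solves_system b W R z u v \<longleftrightarrow> (\<forall>x\<in>dom0 b. integrable (trunc b R x) v \<and> integrable (trunc b W x) u \<and>
     u x = u 0 + integral\<^sup>L (trunc b R x) v \<and> v x = v 0 - z * integral\<^sup>L (trunc b W x) u)"
  unfolding solves_system_def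
  by (intro ball_cong refl) (simp add: set_integrable_LS_iff set_integral_LS_eq)

lemma solves_combination:
  assumes "solves_system b W R z u v" "solves_system b W R z u' v'"
  shows "solves_system b W R z (\<lambda>x. u x - k * u' x) (\<lambda>x. v x - k * v' x)"
  unfolding solves_iff
proof
  fix x assume x: "x \<in> dom0 b"
  have i: "integrable (trunc b R x) v" "integrable (trunc b W x) u" "integrable (trunc b R x) v'" "integrable (trunc b W x) u'"
    and e: "u x = u 0 + integral\<^sup>L (trunc b R x) v" "v x = v 0 - z * integral\<^sup>L (trunc b W x) u"
      "u' x = u' 0 + integral\<^sup>L (trunc b R x) v'" "v' x = v' 0 - z * integral\<^sup>L (trunc b W x) u'"
    using assms x unfolding solves_iff by blast+
  have "u x - k * u' x = u 0 - k * u' 0 + (integral\<^sup>L (trunc b R x) v - k * integral\<^sup>L (trunc b R x) v')"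
    "v x - k * v' x = v 0 - k * v' 0 - z * (integral\<^sup>L (trunc b W x) u - k * integral\<^sup>L (trunc b W x) u')"
    by (simp_all add: e algebra_simps)
  then show "integrable (trunc b R x) (\<lambda>x. v x - k * v' x) \<and> integrable (trunc b W x) (\<lambda>x. u x - k * u' x) \<and>
      u x - k * u' x = u 0 - k * u' 0 + (\<integral>t. v t - k * v' t \<partial>trunc b R x) \<and>
      v x - k * v' x = v 0 - k * v' 0 - z * (\<integral>t. u t - k * u' t \<partial>trunc b W x)"
    using i by simp
qed

lemma solves_unique:
  assumes "solves_system b W R z u v" "solves_system b W R z u' v'" "z \<noteq> 0"
    and "u 0 = u' 0" "v 0 = v' 0" and x: "x \<in> dom0 b"
  shows "u x = u' x" "v x = v' x"
proof -
  define f where "f x = u x - 1 * u' x" for x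
  define g where "g x = v x - 1 * v' x" for x
  have "solves_system b W R z f g" unfolding f_def g_def by (rule solves_combination[OF assms(1,2)])
  moreover have "f 0 = 0" "g 0 = 0" using assms by (auto simp: f_def g_def)
  ultimately have s: "integrable (trunc b R x) g" "integrable (trunc b W x) f"
     "f x = integral\<^sup>L (trunc b R x) g" "g x = - z * integral\<^sup>L (trunc b W x) f" if "x \<in> dom0 b" for x
    using that unfolding solves_iff by auto
  \<comment> \<open>Rescaled, so that both equations have the form required in \<open>zero_solution\<close>.\<close>
  define h where "h x = - g x / z" for x
  have gh: "g = (\<lambda>x. - z * h x)" and hg: "h = (\<lambda>x. (- 1 / z) * g x)"
    using \<open>z \<noteq> 0\<close> by (auto simp: h_def)
  have h: "integrable (trunc b R x) h" "h x = integral\<^sup>L (trunc b W x) f" "f x = - z * integral\<^sup>L (trunc b R x) h"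
    if "x \<in> dom0 b" for x
  proof -
    show "integrable (trunc b R x) h" unfolding hg by (rule integrable_mult_right[OF s(1)[OF that]])
    show "h x = integral\<^sup>L (trunc b W x) f" using s(4)[OF that] \<open>z \<noteq> 0\<close> by (simp add: h_def)
    show "f x = - z * integral\<^sup>L (trunc b R x) h" using s(3)[OF that] unfolding gh by simp
  qed
  have "f x = 0" "h x = 0" using WR.zero_solution[of f h, OF s(2) h(1) h(2) h(3) x] by auto
  then show "u x = u' x" "v x = v' x" using \<open>z \<noteq> 0\<close> by (simp_all add: f_def g_def h_def)
qed

lemma exists_cosine: "\<exists>c c'. solves_system b W R z c c' \<and> c 0 = 1 \<and> c' 0 = 0"
proof (intro exI conjI)
  let ?c = "WR.even_series (- z)" and ?r = "WR.odd_series (- z)"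
  have 0: "?r 0 = 0" "?c 0 = 1"
    unfolding WR.series_solution(2)[OF W.zero_dom] WR.series_solution(4)[OF W.zero_dom] by simp_all
  show "solves_system b W R z ?c (\<lambda>x. - z * ?r x)"
    unfolding solves_iff
  proof (intro ballI conjI)
    fix x assume x: "x \<in> dom0 b"
    note ss = WR.series_solution[OF x, of "- z"]
    show "integrable (trunc b R x) (\<lambda>x. - z * ?r x)" by (rule integrable_mult_right[OF ss(3)])
    show "integrable (trunc b W x) ?c" by (rule ss(1))
    show "?c x = ?c 0 + (\<integral>x. - z * ?r x \<partial>trunc b R x)"
      unfolding 0 integral_mult_right_zero by (rule ss(4))
    show "- z * ?r x = - z * ?r 0 - z * integral\<^sup>L (trunc b W x) ?c"
      unfolding 0 ss(2) by simp
  qed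
  show "?c 0 = 1" "- z * ?r 0 = 0" using 0 by auto
qed

lemma exists_sine: "\<exists>s s'. solves_system b W R z s s' \<and> s 0 = 0 \<and> s' 0 = 1"
proof (intro exI conjI)
  let ?c = "RW.even_series (- z)" and ?r = "RW.odd_series (- z)"
  have 0: "?r 0 = 0" "?c 0 = 1"
    unfolding RW.series_solution(2)[OF W.zero_dom] RW.series_solution(4)[OF W.zero_dom] by simp_all
  show "solves_system b W R z ?r ?c"
    unfolding solves_iff
  proof (intro ballI conjI)
    fix x assume x: "x \<in> dom0 b"
    note ss = RW.series_solution[OF x, of "- z"]
    show "integrable (trunc b R x) ?c" by (rule ss(1))
    show "integrable (trunc b W x) ?r" by (rule ss(3))
    show "?r x = ?r 0 + integral\<^sup>L (trunc b R x) ?c" unfolding 0 by (simp only: ss(2) add_0)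
    show "?c x = ?c 0 - z * integral\<^sup>L (trunc b W x) ?r" unfolding 0 by (subst ss(4)) simp
  qed
  show "?c 0 = 1" "?r 0 = 0" using 0 by auto
qed

lemma energy_identity:
  assumes sol: "solves_system b W R z u v" and "z \<noteq> 0" and x: "x \<in> dom0 b"
  shows "integrable (trunc b R x) (\<lambda>t. (cmod (v t))\<^sup>2)" "integrable (trunc b W x) (\<lambda>t. (cmod (u t))\<^sup>2)"
    "u x * cnj (v x) - u 0 * cnj (v 0) = of_real (energy b R v x) - cnj z * of_real (energy b W u x)"
proof -
  have s: "integrable (trunc b R x) v" "integrable (trunc b W x) u"
     "u x = u 0 + integral\<^sup>L (trunc b R x) v" "v x = v 0 - z * integral\<^sup>L (trunc b W x) u" if "x \<in> dom0 b" for x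
    using sol that unfolding solves_iff by auto
  have g: "integrable (trunc b W x) (\<lambda>t. - cnj z * cnj (u t))" using s(2)[OF x] by simp
  have G: "cnj (v t) = cnj (v 0) + (\<integral>t. - cnj z * cnj (u t) \<partial>trunc b W t)" if "0 \<le> t" "t \<le> x" for t
    using s(4)[OF dom0_less[OF x that]] by simp
  note ibp = integration_by_parts[OF x s(1)[OF x] g s(3)[OF dom0_less[OF x]] G]
  have e1: "v t * cnj (v t) = of_real ((cmod (v t))\<^sup>2)" for t by (simp only: complex_norm_square)
  have e2: "u t * (- cnj z * cnj (u t)) = - cnj z * of_real ((cmod (u t))\<^sup>2)" for t
    by (simp only: complex_norm_square) simp
  have i: "integrable (trunc b R x) (\<lambda>t. complex_of_real ((cmod (v t))\<^sup>2))"
    "integrable (trunc b W x) (\<lambda>t. - cnj z * complex_of_real ((cmod (u t))\<^sup>2))"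
    using ibp(1,2) unfolding e1 e2 by auto
  show "integrable (trunc b R x) (\<lambda>t. (cmod (v t))\<^sup>2)"
    using integrable_Re[OF i(1)] by (simp only: Re_complex_of_real)
  have "integrable (trunc b W x) (\<lambda>t. complex_of_real ((cmod (u t))\<^sup>2))"
    using integrable_mult_right[OF i(2), of "- 1 / cnj z"] \<open>z \<noteq> 0\<close> by simp
  from integrable_Re[OF this] show "integrable (trunc b W x) (\<lambda>t. (cmod (u t))\<^sup>2)"
    by (simp only: Re_complex_of_real)
  show "u x * cnj (v x) - u 0 * cnj (v 0) = of_real (energy b R v x) - cnj z * of_real (energy b W u x)"
    using ibp(3) unfolding e1 e2 energy_def
    by (simp only: integral_complex_of_real integral_mult_right_zero) simp
qed

end

section \<open>The Neumann function by nested discs\<close>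

lemma (in stieltjes) energy_diff:
  assumes x: "x \<in> dom0 b" and i: "integrable (trunc b F x) f" "integrable (trunc b F x) g"
    and i2: "integrable (trunc b F x) (\<lambda>t. (cmod (f t))\<^sup>2)" "integrable (trunc b F x) (\<lambda>t. (cmod (g t))\<^sup>2)"
  shows "energy b F (\<lambda>t. f t - m * g t) x =
    energy b F f x + (cmod m)\<^sup>2 * energy b F g x - 2 * Re (cnj m * (\<integral>t. f t * cnj (g t) \<partial>trunc b F x))"
proof -
  let ?M = "trunc b F x"
  have ig: "integrable ?M (\<lambda>t. f t * cnj (g t))"
  proof (rule Bochner_Integration.integrable_bound)
    show "integrable ?M (\<lambda>t. (cmod (f t))\<^sup>2 + (cmod (g t))\<^sup>2)" using i2 by simp
    show "(\<lambda>t. f t * cnj (g t)) \<in> borel_measurable ?M"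
      using i by (intro borel_measurable_times borel_measurable_integrable) auto
    have "cmod (f t) * cmod (g t) \<le> (cmod (f t))\<^sup>2 + (cmod (g t))\<^sup>2" for t
    proof -
      have "0 \<le> cmod (f t) * cmod (g t)" by simp
      then show ?thesis using sum_squares_bound[of "cmod (f t)" "cmod (g t)"] by linarith
    qed
    then show "AE t in ?M. norm (f t * cnj (g t)) \<le> norm ((cmod (f t))\<^sup>2 + (cmod (g t))\<^sup>2)"
      by (simp add: norm_mult)
  qed
  have pt: "(cmod (f t - m * g t))\<^sup>2 = (cmod (f t))\<^sup>2 + (cmod m)\<^sup>2 * (cmod (g t))\<^sup>2 - 2 * Re (cnj m * (f t * cnj (g t)))" for t
    by (simp only: cmod_power2) (simp add: power2_eq_square algebra_simps)
  have iR: "integrable ?M (\<lambda>t. 2 * Re (cnj m * (f t * cnj (g t))))"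
    by (rule integrable_mult_right[OF integrable_Re[OF integrable_mult_right[OF ig]]])
  have iS: "integrable ?M (\<lambda>t. (cmod (f t))\<^sup>2 + (cmod m)\<^sup>2 * (cmod (g t))\<^sup>2)" using i2 by simp
  have "(\<integral>t. 2 * Re (cnj m * (f t * cnj (g t))) \<partial>?M) = 2 * Re (cnj m * (\<integral>t. f t * cnj (g t) \<partial>?M))"
    by (simp only: integral_mult_right_zero integral_Re[OF integrable_mult_right[OF ig]])
  then show ?thesis
    unfolding energy_def pt Bochner_Integration.integral_diff[OF iS iR] using i2 by simp
qed

lemma (in stieltjes) continuous_energy:
  assumes "x \<in> dom0 b" "integrable (trunc b F x) f" "integrable (trunc b F x) g"
    "integrable (trunc b F x) (\<lambda>t. (cmod (f t))\<^sup>2)" "integrable (trunc b F x) (\<lambda>t. (cmod (g t))\<^sup>2)"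
  shows "continuous_on UNIV (\<lambda>m. energy b F (\<lambda>t. f t - m * g t) x)"
  unfolding energy_diff[OF assms] by (intro continuous_intros)

context string_system begin

lemma solvesD:
  assumes "solves_system b W R z u v" "x \<in> dom0 b"
  shows "integrable (trunc b R x) v" "integrable (trunc b W x) u"
     "u x = u 0 + integral\<^sup>L (trunc b R x) v" "v x = v 0 - z * integral\<^sup>L (trunc b W x) u"
  using assms unfolding solves_iff by blast+

text \<open>
  The system tested against \<open>1 - R/R(x)\<close>, which vanishes at \<open>x\<close>, so that no boundary term
  remains there.
\<close>

lemma trial_function_length:
  assumes sol: "solves_system b W R z u v" and z: "z \<noteq> 0" and x: "x \<in> dom0 b" and Rx: "0 < R x"
  shows "cmod (v 0) \<le> sqrt (energy b R v x / R x) + cmod z * sqrt (energy b W u x * W x)"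
proof -
  note s = solvesD[OF sol] and en = energy_identity[OF sol z x]
  define w where "w t = 1 - complex_of_real (R t / R x)" for t
  have w: "w t = 1 + (\<integral>_. complex_of_real (- 1 / R x) \<partial>trunc b R t)" if "0 \<le> t" "t \<le> x" for t
    unfolding R.integral_trunc_const'[OF dom0_less[OF x that]] by (simp add: w_def scaleR_conv_of_real)
  have g: "integrable (trunc b W x) (\<lambda>t. - z * u t)" using s(2)[OF x] by simp
  have v: "v t = v 0 + (\<integral>t. - z * u t \<partial>trunc b W t)" if "0 \<le> t" "t \<le> x" for t
    using s(4)[OF dom0_less[OF x that]] by simp
  have x0: "0 \<le> x" using x by (simp add: dom0_def)
  have ibp: "w x * v x - 1 * v 0 = (\<integral>t. complex_of_real (- 1 / R x) * v t \<partial>trunc b R x) + (\<integral>t. w t * (- z * u t) \<partial>trunc b W x)"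
    by (rule integration_by_parts(3)[OF x R.integrable_trunc_const[OF x] g w v])
  have wx: "w x = 0" using Rx by (simp add: w_def)
  have pull: "(\<integral>t. w t * (- z * u t) \<partial>trunc b W x) = - z * (\<integral>t. w t * u t \<partial>trunc b W x)"
    unfolding integral_mult_right_zero[symmetric] by (simp add: mult_ac)
  have v0: "v 0 = complex_of_real (1 / R x) * integral\<^sup>L (trunc b R x) v + z * (\<integral>t. w t * u t \<partial>trunc b W x)"
  proof -
    have h: "p = q + r" if "- p = - q - r" for p q r :: complex
      using that by (metis diff_conv_add_uminus minus_add_distrib neg_equal_iff_equal)
    show ?thesis using ibp unfolding pull wx by (intro h) simp
  qed
  have "cmod (v 0) \<le> (1 / R x) * cmod (integral\<^sup>L (trunc b R x) v) + cmod z * cmod (\<integral>t. w t * u t \<partial>trunc b W x)"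
    using v0 norm_triangle_ineq[of "complex_of_real (1 / R x) * integral\<^sup>L (trunc b R x) v" "z * (\<integral>t. w t * u t \<partial>trunc b W x)"] Rx
    by (simp add: norm_mult norm_divide)
  moreover have "cmod (integral\<^sup>L (trunc b R x) v) \<le> sqrt (energy b R v x * R x)"
    by (rule R.Cauchy_Schwarz_trunc[OF x s(1)[OF x] en(1)]) simp
  moreover have "(1 / R x) * sqrt (energy b R v x * R x) = sqrt (energy b R v x / R x)"
    using Rx by (simp add: real_sqrt_mult real_sqrt_divide field_simps)
  moreover have "cmod (\<integral>t. w t * u t \<partial>trunc b W x) \<le> sqrt (energy b W u x * W x)"
  proof (rule W.Cauchy_Schwarz_trunc[OF x s(2)[OF x] en(2)])
    fix t assume t: "0 \<le> t" "t < x"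
    have "0 \<le> R t" "R t \<le> R x" using R.le[OF x] R.nonneg[OF dom0_less[OF x]] t by auto
    then have "0 \<le> 1 - R t / R x" "1 - R t / R x \<le> 1" using Rx by (auto simp: divide_simps)
    moreover have "w t = of_real (1 - R t / R x)" by (simp add: w_def)
    ultimately have "cmod (w t) \<le> 1" by (simp only: norm_of_real)
    then show "cmod (w t * u t) \<le> cmod (u t)" by (simp add: norm_mult mult_left_le_one_le)
  qed
  ultimately show ?thesis
    using mult_left_mono[of "cmod (integral\<^sup>L (trunc b R x) v)" "sqrt (energy b R v x * R x)" "1 / R x"]
      mult_left_mono[of "cmod (\<integral>t. w t * u t \<partial>trunc b W x)" "sqrt (energy b W u x * W x)" "cmod z"] Rx
    by (smt (verit) divide_nonneg_pos norm_ge_zero)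
qed

text \<open>
  The dual estimate, with the function \<open>1 - W/W(x)\<close>.
\<close>

lemma trial_function_mass:
  assumes sol: "solves_system b W R z u v" and z: "z \<noteq> 0" and x: "x \<in> dom0 b" and Wx: "0 < W x"
  shows "cmod (u 0) \<le> sqrt (energy b R v x * R x) + sqrt (energy b W u x / W x)"
proof -
  note s = solvesD[OF sol] and en = energy_identity[OF sol z x]
  define w where "w t = 1 - complex_of_real (W t / W x)" for t
  have w: "w t = 1 + (\<integral>_. complex_of_real (- 1 / W x) \<partial>trunc b W t)" if "0 \<le> t" "t \<le> x" for t
    unfolding W.integral_trunc_const'[OF dom0_less[OF x that]] by (simp add: w_def scaleR_conv_of_real)
  have u: "u t = u 0 + integral\<^sup>L (trunc b R t) v" if "0 \<le> t" "t \<le> x" for t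
    using s(3)[OF dom0_less[OF x that]] by simp
  have ibp: "u x * w x - u 0 * 1 = (\<integral>t. v t * w t \<partial>trunc b R x) + (\<integral>t. u t * complex_of_real (- 1 / W x) \<partial>trunc b W x)"
    by (rule integration_by_parts(3)[OF x s(1)[OF x] W.integrable_trunc_const[OF x] u w])
  have wx: "w x = 0" using Wx by (simp add: w_def)
  have u0: "u 0 = complex_of_real (1 / W x) * integral\<^sup>L (trunc b W x) u + - (\<integral>t. v t * w t \<partial>trunc b R x)"
  proof -
    have h: "p = r + - q" if "- p = q - r" for p q r :: complex
      using that by (metis add.inverse_inverse diff_conv_add_uminus minus_diff_eq)
    show ?thesis using ibp unfolding wx by (intro h) simp
  qed
  have "cmod (u 0) \<le> (1 / W x) * cmod (integral\<^sup>L (trunc b W x) u) + cmod (\<integral>t. v t * w t \<partial>trunc b R x)"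
    using u0 norm_triangle_ineq[of "complex_of_real (1 / W x) * integral\<^sup>L (trunc b W x) u" "- (\<integral>t. v t * w t \<partial>trunc b R x)"] Wx
    by (simp add: norm_mult norm_divide)
  moreover have "cmod (integral\<^sup>L (trunc b W x) u) \<le> sqrt (energy b W u x * W x)"
    by (rule W.Cauchy_Schwarz_trunc[OF x s(2)[OF x] en(2)]) simp
  moreover have "(1 / W x) * sqrt (energy b W u x * W x) = sqrt (energy b W u x / W x)"
    using Wx by (simp add: real_sqrt_mult real_sqrt_divide field_simps)
  moreover have "cmod (\<integral>t. v t * w t \<partial>trunc b R x) \<le> sqrt (energy b R v x * R x)"
  proof (rule R.Cauchy_Schwarz_trunc[OF x s(1)[OF x] en(1)])
    fix t assume t: "0 \<le> t" "t < x"
    have "0 \<le> W t" "W t \<le> W x" using W.le[OF x] W.nonneg[OF dom0_less[OF x]] t by auto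
    then have "0 \<le> 1 - W t / W x" "1 - W t / W x \<le> 1" using Wx by (auto simp: divide_simps)
    moreover have "w t = of_real (1 - W t / W x)" by (simp add: w_def)
    ultimately have "cmod (w t) \<le> 1" by (simp only: norm_of_real)
    then show "cmod (v t * w t) \<le> cmod (v t)" by (simp add: norm_mult mult_left_le)
  qed
  ultimately show ?thesis
    using mult_left_mono[of "cmod (integral\<^sup>L (trunc b W x) u)" "sqrt (energy b W u x * W x)" "1 / W x"] Wx
    by (smt (verit) divide_nonneg_pos)
qed

text \<open>
  If the energy of \<open>c\<close> over \<open>[0,x)\<close> vanishes, then so does \<open>c'\<close>; thus \<open>c = 1\<close> there, and the energy is
  \<open>W(x)\<close>.
\<close>

lemma cosine_energy_pos:
  assumes sol: "solves_system b W R z c c'" and z: "z \<noteq> 0" and c0: "c 0 = 1" "c' 0 = 0"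
    and x: "x \<in> dom0 b" and Wx: "0 < W x"
  shows "0 < energy b W c x"
proof (rule ccontr)
  assume "\<not> 0 < energy b W c x"
  then have E0: "energy b W c x = 0" using W.energy_nonneg[of c x] by linarith
  note s = solvesD[OF sol] and en = energy_identity[OF sol z]
  have c': "c' t = 0" if t: "0 \<le> t" "t \<le> x" for t
  proof -
    have td: "t \<in> dom0 b" by (rule dom0_less[OF x t])
    have "energy b W c t \<le> energy b W c x" by (rule W.energy_mono[OF x en(2)[OF x] t])
    then have "energy b W c t = 0" using E0 W.energy_nonneg[of c t] by linarith
    moreover have "cmod (integral\<^sup>L (trunc b W t) c) \<le> sqrt (energy b W c t * W t)"
      by (rule W.Cauchy_Schwarz_trunc[OF td s(2)[OF td] en(2)[OF td]]) simp
    ultimately show ?thesis using s(4)[OF td] c0 by simp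
  qed
  have c1: "c t = 1" if t: "0 \<le> t" "t \<le> x" for t
  proof -
    have td: "t \<in> dom0 b" by (rule dom0_less[OF x t])
    have "integral\<^sup>L (trunc b R t) c' = integral\<^sup>L (trunc b R t) (\<lambda>_. 0)"
      by (rule integral_trunc_cong[OF td]) (use c' t in auto)
    then show ?thesis using s(3)[OF td] c0 by simp
  qed
  have "energy b W c x = integral\<^sup>L (trunc b W x) (\<lambda>_. 1)"
    unfolding energy_def by (rule integral_trunc_cong[OF x]) (use c1 in auto)
  then show False using E0 Wx W.integral_trunc_const[OF x, of 1] by simp
qed

text \<open>
  The limit point property. Suppose that the energy of \<open>c\<close> is bounded by \<open>K\<close>. By the energy identity
  \<open>|c c'|\<close> is bounded below, while the Cauchy--Schwarz inequality gives \<open>|c'|\<^sup>2 \<le> |z|\<^sup>2 K W\<close>. So \<open>|c|\<^sup>2\<close> is at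
  least \<open>\<kappa> / W\<close> for some \<open>\<kappa> > 0\<close>, which is not integrable with respect to \<open>dW\<close>, since the mass
  \<open>W(y) - W(x)\<close> exceeds \<open>W(y) / 2\<close> whenever \<open>W(y) > 2 W(x)\<close>.
\<close>

lemma cosine_not_L2:
  assumes sol: "solves_system b W R z c c'" and z: "0 < Im z" and c0: "c 0 = 1" "c' 0 = 0"
    and K: "\<And>x. x \<in> dom0 b \<Longrightarrow> energy b W c x \<le> K"
  shows False
proof -
  have z0: "z \<noteq> 0" using z by auto
  note s = solvesD[OF sol] and en = energy_identity[OF sol z0]
  let ?E = "energy b W c"
  have Emono: "?E t \<le> ?E x" if "t \<in> dom0 b" "x \<in> dom0 b" "t \<le> x" for t x
    using W.energy_mono[OF that(2) en(2)[OF that(2)], of t] that by (auto simp: dom0_def)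
  obtain x0 where x0: "x0 \<in> dom0 b" "0 < W x0" using W.ex_gt by blast
  have E0: "0 < ?E x0" by (rule cosine_energy_pos[OF sol z0 c0 x0])
  define d where "d = Im z * ?E x0"
  have d: "0 < d" using z E0 by (simp add: d_def)
  have Kpos: "0 < K" using E0 K[OF x0(1)] by linarith
  define \<kappa> where "\<kappa> = d\<^sup>2 / ((cmod z)\<^sup>2 * K)"
  have \<kappa>: "0 < \<kappa>" using d Kpos z0 by (simp add: \<kappa>_def)
  have low: "\<kappa> \<le> (cmod (c t))\<^sup>2 * W t" if t: "t \<in> dom0 b" "x0 \<le> t" for t
  proof -
    have "c t * cnj (c' t) = of_real (energy b R c' t) - cnj z * of_real (?E t)"
      using en(3)[OF t(1)] c0 by simp
    then have "Im (c t * cnj (c' t)) = Im z * ?E t" by simp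
    moreover have "Im (c t * cnj (c' t)) \<le> cmod (c t) * cmod (c' t)"
      using abs_Im_le_cmod[of "c t * cnj (c' t)"] by (simp add: norm_mult)
    moreover have "d \<le> Im z * ?E t"
      unfolding d_def using Emono[OF x0(1) t] z by simp
    ultimately have 1: "d \<le> cmod (c t) * cmod (c' t)" by linarith
    have "cmod (integral\<^sup>L (trunc b W t) c) \<le> sqrt (?E t * W t)"
      by (rule W.Cauchy_Schwarz_trunc[OF t(1) s(2)[OF t(1)] en(2)[OF t(1)]]) simp
    also have "\<dots> \<le> sqrt (K * W t)"
      by (intro real_sqrt_le_mono mult_right_mono K t W.nonneg)
    finally have "cmod z * cmod (integral\<^sup>L (trunc b W t) c) \<le> cmod z * sqrt (K * W t)"
      by (rule mult_left_mono) simp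
    then have "cmod (c' t) \<le> cmod z * sqrt (K * W t)"
      using s(4)[OF t(1)] c0 by (simp add: norm_mult)
    then have "cmod (c t) * cmod (c' t) \<le> cmod (c t) * (cmod z * sqrt (K * W t))"
      by (rule mult_left_mono) simp
    with 1 have "d \<le> cmod (c t) * (cmod z * sqrt (K * W t))" by linarith
    then have "d\<^sup>2 \<le> (cmod (c t) * (cmod z * sqrt (K * W t)))\<^sup>2" using d by (intro power_mono) auto
    also have "\<dots> = (cmod (c t))\<^sup>2 * W t * ((cmod z)\<^sup>2 * K)"
      using Kpos W.nonneg[OF t(1)] by (simp add: power_mult_distrib)
    finally show ?thesis unfolding \<kappa>_def using Kpos z0 by (simp add: pos_divide_le_eq)
  qed
  define S where "S = Sup (?E ` dom0 b)"
  have bdd: "bdd_above (?E ` dom0 b)" using K by (auto intro!: bdd_aboveI[of _ K])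
  have S: "?E x \<le> S" if "x \<in> dom0 b" for x
    unfolding S_def using that by (intro cSup_upper bdd) auto
  have "\<exists>e\<in>?E ` dom0 b. S - \<kappa> / 4 < e"
    unfolding S_def using \<kappa> W.zero_dom by (intro less_cSupD[of "?E ` dom0 b", unfolded Bex_def, folded Bex_def]) auto
  then obtain x2 where x2: "x2 \<in> dom0 b" "S - \<kappa> / 4 < ?E x2" by blast
  define x1 where "x1 = max x0 x2"
  have x1: "x1 \<in> dom0 b" "x0 \<le> x1" using x0(1) x2(1) by (auto simp: x1_def max_def)
  have "?E x2 \<le> ?E x1" by (rule Emono[OF x2(1) x1(1)]) (simp add: x1_def)
  then have near: "S - \<kappa> / 4 < ?E x1" using x2 by linarith
  have W1: "0 < W x1" using x0 W.le[OF x1(1), of x0] x1 by (auto simp: dom0_def)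
  obtain y where y: "y \<in> dom0 b" "2 * W x1 < W y" using W.ex_gt by blast
  have y1: "x1 < y"
  proof (rule ccontr)
    assume "\<not> x1 < y"
    then have "W y \<le> W x1" using W.le[OF x1(1), of y] y(1) by (auto simp: dom0_def)
    then show False using y(2) W1 by linarith
  qed
  have x10: "0 \<le> x1" "x1 \<le> y" using x1(1) y1 by (auto simp: dom0_def)
  have in_sets: "{x1..<y} \<inter> space (trunc b W y) \<in> sets (trunc b W y)"
    by (auto simp: sets_trunc[OF y(1)] space_trunc[OF y(1)] sets_restrict_space intro!: image_eqI[of _ _ "{x1..<y}"])
  have sub: "{x1..<y} \<inter> space (trunc b W y) = {x1..<y}" using x10 by (auto simp: space_trunc[OF y(1)])
  have ii: "integrable (trunc b W y) (\<lambda>t. indicator {x1..<y} t *\<^sub>R (\<kappa> / W y))"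
    by (rule integrable_mult_indicator[OF in_sets[unfolded sub] W.integrable_trunc_const[OF y(1)]])
  have "?E x1 + \<kappa> / W y * (W y - W x1) =
      (\<integral>t. indicator {..<x1} t *\<^sub>R (cmod (c t))\<^sup>2 + indicator {x1..<y} t *\<^sub>R (\<kappa> / W y) \<partial>trunc b W y)"
  proof -
    have "(\<integral>t. indicator {x1..<y} t *\<^sub>R (\<kappa> / W y) \<partial>trunc b W y) = measure (trunc b W y) {x1..<y} *\<^sub>R (\<kappa> / W y)"
    proof -
      interpret finite_measure "trunc b W y" by (rule W.finite_trunc[OF y(1)])
      show ?thesis using in_sets sub by (subst integral_scaleR_left) (auto simp: emeasure_eq_measure)
    qed
    moreover have "integrable (trunc b W y) (\<lambda>t. indicator {..<x1} t *\<^sub>R (cmod (c t))\<^sup>2)"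
      using integrable_trunc_iff[OF y(1) x10, of W "\<lambda>t. (cmod (c t))\<^sup>2"] en(2)[OF x1(1)] by blast
    moreover have "?E x1 = (\<integral>t. indicator {..<x1} t *\<^sub>R (cmod (c t))\<^sup>2 \<partial>trunc b W y)"
      unfolding energy_def by (rule integral_trunc_eq[OF y(1) x10])
    ultimately show ?thesis
      using ii W.measure_trunc[OF y(1) x10 order_refl] by (simp add: mult.commute sub)
  qed
  also have "\<dots> \<le> ?E y"
    unfolding energy_def
  proof (rule integral_mono)
    show "integrable (trunc b W y) (\<lambda>t. indicator {..<x1} t *\<^sub>R (cmod (c t))\<^sup>2 + indicator {x1..<y} t *\<^sub>R (\<kappa> / W y))"
      using integrable_trunc_iff[OF y(1) x10, of W "\<lambda>t. (cmod (c t))\<^sup>2"] en(2)[OF x1(1)] ii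
      by (intro Bochner_Integration.integrable_add) blast+
    show "integrable (trunc b W y) (\<lambda>t. (cmod (c t))\<^sup>2)" by (rule en(2)[OF y(1)])
    fix t assume "t \<in> space (trunc b W y)"
    then have t: "0 \<le> t" "t < y" by (auto simp: space_trunc[OF y(1)])
    have td: "t \<in> dom0 b" by (rule dom0_less[OF y(1)]) (use t in auto)
    have "\<kappa> / W y \<le> (cmod (c t))\<^sup>2" if "x1 \<le> t"
    proof -
      have "\<kappa> \<le> (cmod (c t))\<^sup>2 * W t" using low[OF td] that x1 by auto
      also have "\<dots> \<le> (cmod (c t))\<^sup>2 * W y" using W.le[OF y(1), of t] t by (intro mult_left_mono) auto
      finally show ?thesis using y W1 by (simp add: pos_divide_le_eq)
    qed
    then show "indicator {..<x1} t *\<^sub>R (cmod (c t))\<^sup>2 + indicator {x1..<y} t *\<^sub>R (\<kappa> / W y) \<le> (cmod (c t))\<^sup>2"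
      by (auto simp: indicator_def)
  qed
  finally have "?E x1 + \<kappa> / W y * (W y - W x1) \<le> S" using S[OF y(1)] by linarith
  moreover have "\<kappa> / W y * (W y - W x1) \<ge> \<kappa> / 2"
  proof -
    have "\<kappa> * W y \<le> \<kappa> * (2 * (W y - W x1))" using \<kappa> y by (intro mult_left_mono) auto
    then show ?thesis using y W1 by (simp add: field_simps)
  qed
  ultimately show False using near \<kappa> by linarith
qed

text \<open>
  The first condition alone describes the classical Weyl disc at \<open>x\<close>. The second one, on the
  quasi-derivative, is also preserved when \<open>x\<close> decreases, and it makes \<open>m = P - cnj z E\<close> with \<open>P\<close> and
  \<open>E\<close> bounding the two energies over \<open>[0,x)\<close>.
\<close>

definition weyl_disc :: "complex \<Rightarrow> (real \<Rightarrow> complex) \<Rightarrow> (real \<Rightarrow> complex) \<Rightarrow> (real \<Rightarrow> complex) \<Rightarrow> (real \<Rightarrow> complex) \<Rightarrow> real \<Rightarrow> complex set" where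
  "weyl_disc z c c' s s' x = {m. energy b W (\<lambda>t. s t - m * c t) x \<le> Im m / Im z \<and>
     energy b R (\<lambda>t. s' t - m * c' t) x \<le> Re m + Re z * (Im m / Im z)}"

lemma weyl_disc_facts:
  assumes z: "0 < Im z" and c: "solves_system b W R z c c'" "c 0 = 1" "c' 0 = 0"
    and s: "solves_system b W R z s s'" "s 0 = 0" "s' 0 = 1"
  shows weyl_disc_antimono: "t \<in> dom0 b \<Longrightarrow> x \<in> dom0 b \<Longrightarrow> t \<le> x \<Longrightarrow> weyl_disc z c c' s s' x \<subseteq> weyl_disc z c c' s s' t"
    and weyl_disc_nonempty: "x \<in> dom0 b \<Longrightarrow> 0 < W x \<Longrightarrow> weyl_disc z c c' s s' x \<noteq> {}"
    and weyl_disc_compact: "x \<in> dom0 b \<Longrightarrow> 0 < W x \<Longrightarrow> compact (weyl_disc z c c' s s' x)"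
proof -
  have z0: "z \<noteq> 0" using z by auto
  let ?u = "\<lambda>m t. s t - m * c t" and ?v = "\<lambda>m t. s' t - m * c' t"
  have sol: "solves_system b W R z (?u m) (?v m)" for m by (rule solves_combination[OF s(1) c(1)])
  note en = energy_identity[OF sol z0]
  show "weyl_disc z c c' s s' x \<subseteq> weyl_disc z c c' s s' t" if "t \<in> dom0 b" "x \<in> dom0 b" "t \<le> x"
  proof
    fix m assume m: "m \<in> weyl_disc z c c' s s' x"
    have "energy b W (?u m) t \<le> energy b W (?u m) x" "energy b R (?v m) t \<le> energy b R (?v m) x"
      using W.energy_mono[OF that(2) en(2)[OF that(2)], of t m] R.energy_mono[OF that(2) en(1)[OF that(2)], of t m] that
      by (auto simp: dom0_def)
    then show "m \<in> weyl_disc z c c' s s' t" using m by (auto simp: weyl_disc_def)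
  qed
  assume x: "x \<in> dom0 b" and Wx: "0 < W x"
  show "weyl_disc z c c' s s' x \<noteq> {}"
  proof -
    have "c' x \<noteq> 0"
    proof
      assume "c' x = 0"
      then have "complex_of_real (energy b R c' x) - cnj z * of_real (energy b W c x) = 0"
        using energy_identity(3)[OF c(1) z0 x] c by simp
      then have "Im (complex_of_real (energy b R c' x) - cnj z * of_real (energy b W c x)) = 0" by simp
      then have "Im z * energy b W c x = 0" by simp
      then show False using cosine_energy_pos[OF c(1) z0 c(2,3) x Wx] z by simp
    qed
    \<comment> \<open>The parameter for which the quasi-derivative vanishes at \<open>x\<close> attains both bounds.\<close>
    define m where "m = s' x / c' x"
    have "?v m x = 0" using \<open>c' x \<noteq> 0\<close> by (simp add: m_def)
    then have m: "m = of_real (energy b R (?v m) x) - cnj z * of_real (energy b W (?u m) x)"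
      using en(3)[OF x, of m] c s by simp
    have "Im m = Im z * energy b W (?u m) x" by (subst m) simp
    moreover have "Re m = energy b R (?v m) x - Re z * energy b W (?u m) x" by (subst m) simp
    ultimately have "m \<in> weyl_disc z c c' s s' x" using z by (simp add: weyl_disc_def)
    then show ?thesis by blast
  qed
  show "compact (weyl_disc z c c' s s' x)"
  proof (rule compact_eq_bounded_closed[THEN iffD2], intro conjI)
    have cW: "continuous_on UNIV (\<lambda>m. energy b W (?u m) x)"
      using solvesD[OF s(1) x] solvesD[OF c(1) x] energy_identity[OF s(1) z0 x] energy_identity[OF c(1) z0 x]
      by (intro W.continuous_energy x) auto
    have cR: "continuous_on UNIV (\<lambda>m. energy b R (?v m) x)"
      using solvesD[OF s(1) x] solvesD[OF c(1) x] energy_identity[OF s(1) z0 x] energy_identity[OF c(1) z0 x]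
      by (intro R.continuous_energy x) auto
    show "closed (weyl_disc z c c' s s' x)"
      unfolding weyl_disc_def using z
      by (intro closed_Collect_conj closed_Collect_le cW cR continuous_intros) auto
    define k where "k = 1 + \<bar>Re z\<bar> / Im z"
    define L where "L = sqrt (k * R x) + sqrt (1 / (Im z * W x))"
    have L0: "0 \<le> L" unfolding L_def using z W.nonneg[OF x] R.nonneg[OF x] by (simp add: k_def)
    have "cmod m \<le> L\<^sup>2" if m: "m \<in> weyl_disc z c c' s s' x" for m
    proof -
      have E: "energy b W (?u m) x \<le> Im m / Im z" and P: "energy b R (?v m) x \<le> Re m + Re z * (Im m / Im z)"
        using m by (auto simp: weyl_disc_def)
      have Im0: "0 \<le> Im m / Im z" using E W.energy_nonneg order_trans by blast
      have E': "Im m / Im z \<le> cmod m / Im z"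
        using abs_Im_le_cmod[of m] z by (intro divide_right_mono) auto
      have "Re z * (Im m / Im z) \<le> \<bar>Re z\<bar> * (cmod m / Im z)"
        using Im0 E' by (intro mult_mono) auto
      then have P': "Re m + Re z * (Im m / Im z) \<le> k * cmod m"
        using complex_Re_le_cmod[of m] by (simp add: k_def algebra_simps)
      have "cmod m \<le> sqrt (energy b R (?v m) x * R x) + sqrt (energy b W (?u m) x / W x)"
        using trial_function_mass[OF sol z0 x Wx, of m] c s by simp
      also have "\<dots> \<le> sqrt (k * cmod m * R x) + sqrt (cmod m / Im z / W x)"
        using P P' E E' Wx R.nonneg[OF x]
        by (intro add_mono real_sqrt_le_mono mult_right_mono divide_right_mono) auto
      also have "\<dots> = sqrt (cmod m) * L"
        by (simp add: L_def real_sqrt_mult[symmetric] algebra_simps)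
      finally have le: "cmod m \<le> sqrt (cmod m) * L" .
      show ?thesis
      proof (cases "m = 0")
        case False
        then have "sqrt (cmod m) * sqrt (cmod m) \<le> sqrt (cmod m) * L" using le by simp
        then have "sqrt (cmod m) \<le> L" using False by (subst (asm) mult_le_cancel_left_pos) auto
        then have "(sqrt (cmod m))\<^sup>2 \<le> L\<^sup>2" by (intro power_mono) auto
        then show ?thesis by simp
      qed simp
    qed
    then show "bounded (weyl_disc z c c' s s' x)" by (auto simp: bounded_iff)
  qed
qed

text \<open>
  The defining property of \<open>Neumann_m\<close>.
\<close>

definition is_weyl :: "complex \<Rightarrow> complex \<Rightarrow> bool" where
  "is_weyl z m \<longleftrightarrow> (\<exists>c c' s s'.
     solves_system b W R z c c' \<and> c 0 = 1 \<and> c' 0 = 0 \<and>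
     solves_system b W R z s s' \<and> s 0 = 0 \<and> s' 0 = 1 \<and>
     L2_on (LS_measure b W) {x. 0 < x \<and> ereal x < b} (\<lambda>x. s x - m * c x))"

lemma L2_solution_iff:
  assumes "solves_system b W R z u v" "z \<noteq> 0"
  shows "L2_on (LS_measure b W) {x. 0 < x \<and> ereal x < b} u \<longleftrightarrow> (\<exists>K. \<forall>x\<in>dom0 b. energy b W u x \<le> K)"
  by (rule W.L2_on_iff) (use solvesD[OF assms(1)] energy_identity[OF assms] in auto)

lemma weyl_exists:
  assumes z: "0 < Im z" and c: "solves_system b W R z c c'" "c 0 = 1" "c' 0 = 0"
    and s: "solves_system b W R z s s'" "s 0 = 0" "s' 0 = 1"
  shows "\<exists>m. is_weyl z m \<and> (\<forall>x\<in>dom0 b. m \<in> weyl_disc z c c' s s' x)"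
proof -
  have z0: "z \<noteq> 0" using z by auto
  let ?D = "weyl_disc z c c' s s'"
  let ?F = "?D ` {x \<in> dom0 b. 0 < W x}"
  have "\<Inter>?F \<noteq> {}"
  proof (rule compact_chain)
    show "compact S" if "S \<in> ?F" for S using that weyl_disc_compact[OF assms] by auto
    show "{} \<notin> ?F" using weyl_disc_nonempty[OF assms] by auto
    show "S \<subseteq> T \<or> T \<subseteq> S" if "S \<in> ?F \<and> T \<in> ?F" for S T
    proof -
      from that obtain x y where "x \<in> dom0 b" "y \<in> dom0 b" "S = ?D x" "T = ?D y" by auto
      then show ?thesis
        using weyl_disc_antimono[OF assms, of x y] weyl_disc_antimono[OF assms, of y x] by (cases "x \<le> y") auto
    qed
  qed
  then obtain m where m: "\<And>x. x \<in> dom0 b \<Longrightarrow> 0 < W x \<Longrightarrow> m \<in> ?D x" by auto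
  obtain x0 where x0: "x0 \<in> dom0 b" "0 < W x0" using W.ex_gt by blast
  have mD: "m \<in> ?D x" if x: "x \<in> dom0 b" for x
  proof (cases "x0 \<le> x")
    case True
    then have "0 < W x" using W.le[OF x, of x0] x0 by (auto simp: dom0_def)
    then show ?thesis using m x by blast
  next
    case False
    then show ?thesis using weyl_disc_antimono[OF assms x x0(1)] m[OF x0] by auto
  qed
  have "energy b W (\<lambda>t. s t - m * c t) x \<le> Im m / Im z" if "x \<in> dom0 b" for x
    using mD[OF that] by (simp add: weyl_disc_def)
  then have "L2_on (LS_measure b W) {x. 0 < x \<and> ereal x < b} (\<lambda>t. s t - m * c t)"
    using L2_solution_iff[OF solves_combination[OF s(1) c(1)] z0] by blast
  then have "is_weyl z m" using c s unfolding is_weyl_def by blast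
  then show ?thesis using mD by blast
qed

lemma weyl_unique:
  assumes z: "0 < Im z" and "is_weyl z m1" "is_weyl z m2"
  shows "m1 = m2"
proof (rule ccontr)
  assume ne: "m1 \<noteq> m2"
  have z0: "z \<noteq> 0" using z by auto
  obtain c c' s s' where c: "solves_system b W R z c c'" "c 0 = 1" "c' 0 = 0"
    and s: "solves_system b W R z s s'" "s 0 = 0" "s' 0 = 1"
    and L: "L2_on (LS_measure b W) {x. 0 < x \<and> ereal x < b} (\<lambda>x. s x - m1 * c x)"
    using assms(2) unfolding is_weyl_def by blast
  obtain d d' r r' where d: "solves_system b W R z d d'" "d 0 = 1" "d' 0 = 0"
    and r: "solves_system b W R z r r'" "r 0 = 0" "r' 0 = 1"
    and M: "L2_on (LS_measure b W) {x. 0 < x \<and> ereal x < b} (\<lambda>x. r x - m2 * d x)"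
    using assms(3) unfolding is_weyl_def by blast
  obtain K where K: "\<And>x. x \<in> dom0 b \<Longrightarrow> energy b W (\<lambda>x. s x - m1 * c x) x \<le> K"
    using L L2_solution_iff[OF solves_combination[OF s(1) c(1)] z0] by blast
  obtain K' where K': "\<And>x. x \<in> dom0 b \<Longrightarrow> energy b W (\<lambda>x. r x - m2 * d x) x \<le> K'"
    using M L2_solution_iff[OF solves_combination[OF r(1) d(1)] z0] by blast
  have eq: "d x = c x" "r x = s x" if "x \<in> dom0 b" for x
    using solves_unique(1)[OF d(1) c(1) z0 _ _ that] solves_unique(1)[OF r(1) s(1) z0 _ _ that] c d r s by auto
  let ?q = "(cmod (m2 - m1))\<^sup>2"
  have q: "0 < ?q" using ne by simp
  have "energy b W c x \<le> 2 * (K + K') / ?q" if x: "x \<in> dom0 b" for x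
  proof -
    let ?f = "\<lambda>x. s x - m1 * c x" and ?g = "\<lambda>x. r x - m2 * d x"
    note e1 = energy_identity(2)[OF solves_combination[OF s(1) c(1)] z0 x]
      and e2 = energy_identity(2)[OF solves_combination[OF r(1) d(1)] z0 x]
    have "?q * energy b W c x = (\<integral>t. ?q * (cmod (c t))\<^sup>2 \<partial>trunc b W x)" by (simp add: energy_def)
    also have "\<dots> \<le> (\<integral>t. 2 * (cmod (?f t))\<^sup>2 + 2 * (cmod (?g t))\<^sup>2 \<partial>trunc b W x)"
    proof (rule integral_mono)
      show "integrable (trunc b W x) (\<lambda>t. ?q * (cmod (c t))\<^sup>2)"
        using energy_identity(2)[OF c(1) z0 x] by simp
      show "integrable (trunc b W x) (\<lambda>t. 2 * (cmod (?f t))\<^sup>2 + 2 * (cmod (?g t))\<^sup>2)"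
        using e1 e2 by simp
      fix t assume "t \<in> space (trunc b W x)"
      then have "t \<in> dom0 b" using dom0_less[OF x] by (auto simp: space_trunc[OF x])
      then have "(m2 - m1) * c t = ?f t - ?g t" using eq by (simp add: algebra_simps)
      then have "?q * (cmod (c t))\<^sup>2 = (cmod (?f t - ?g t))\<^sup>2" by (metis norm_mult power_mult_distrib)
      also have "\<dots> \<le> (cmod (?f t) + cmod (?g t))\<^sup>2" by (intro power_mono norm_triangle_ineq4) auto
      also have "\<dots> \<le> 2 * (cmod (?f t))\<^sup>2 + 2 * (cmod (?g t))\<^sup>2"
        using sum_squares_bound[of "cmod (?f t)" "cmod (?g t)"] by (simp add: power2_sum)
      finally show "?q * (cmod (c t))\<^sup>2 \<le> 2 * (cmod (?f t))\<^sup>2 + 2 * (cmod (?g t))\<^sup>2" .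
    qed
    also have "\<dots> = 2 * energy b W ?f x + 2 * energy b W ?g x" using e1 e2 by (simp add: energy_def)
    also have "\<dots> \<le> 2 * (K + K')" using K[OF x] K'[OF x] by simp
    finally show ?thesis using q by (simp add: pos_le_divide_eq mult.commute)
  qed
  then show False by (rule cosine_not_L2[OF c(1) z c(2,3)])
qed

lemma Neumann_m_eqI:
  assumes "0 < Im z" "is_weyl z m"
  shows "Neumann_m b W R z = m"
  unfolding Neumann_m_def is_weyl_def[symmetric]
  using weyl_unique[OF assms(1)] assms(2) by (intro the_equality) auto

text \<open>
  The only information on the Neumann function that the asymptotic analysis uses.
\<close>

theorem Neumann_m_variational:
  assumes z: "0 < Im z"
  obtains P E where "0 \<le> P" "0 \<le> E" "Neumann_m b W R z = of_real P - cnj z * of_real E"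
    "\<And>x. x \<in> dom0 b \<Longrightarrow> 0 < R x \<Longrightarrow> 1 \<le> sqrt (P / R x) + cmod z * sqrt (E * W x)"
    "\<And>x. x \<in> dom0 b \<Longrightarrow> 0 < W x \<Longrightarrow> cmod (Neumann_m b W R z) \<le> sqrt (P * R x) + sqrt (E / W x)"
proof -
  have z0: "z \<noteq> 0" using z by auto
  obtain c c' where c: "solves_system b W R z c c'" "c 0 = 1" "c' 0 = 0" using exists_cosine by blast
  obtain s s' where s: "solves_system b W R z s s'" "s 0 = 0" "s' 0 = 1" using exists_sine by blast
  obtain m where m: "is_weyl z m" "\<And>x. x \<in> dom0 b \<Longrightarrow> m \<in> weyl_disc z c c' s s' x"
    using weyl_exists[OF z c s] by blast
  have Nm: "Neumann_m b W R z = m" by (rule Neumann_m_eqI[OF z m(1)])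
  define E where "E = Im m / Im z"
  define P where "P = Re m + Re z * E"
  let ?u = "\<lambda>t. s t - m * c t" and ?v = "\<lambda>t. s' t - m * c' t"
  have sol: "solves_system b W R z ?u ?v" by (rule solves_combination[OF s(1) c(1)])
  have le: "energy b W ?u x \<le> E" "energy b R ?v x \<le> P" if "x \<in> dom0 b" for x
    using m(2)[OF that] by (auto simp: weyl_disc_def E_def P_def)
  have E0: "0 \<le> E" using le(1)[OF W.zero_dom] W.energy_nonneg order_trans by blast
  have P0: "0 \<le> P" using le(2)[OF W.zero_dom] R.energy_nonneg order_trans by blast
  have eq: "m = of_real P - cnj z * of_real E"
    using z by (simp add: complex_eq_iff P_def) (simp add: E_def)
  show ?thesis
  proof (rule that[OF P0 E0])
    show "Neumann_m b W R z = of_real P - cnj z * of_real E" unfolding Nm by (rule eq)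
    fix x assume x: "x \<in> dom0 b"
    have nn: "0 \<le> R x" "0 \<le> W x" using W.nonneg R.nonneg x by auto
    show "1 \<le> sqrt (P / R x) + cmod z * sqrt (E * W x)" if "0 < R x"
    proof -
      have "1 \<le> sqrt (energy b R ?v x / R x) + cmod z * sqrt (energy b W ?u x * W x)"
        using trial_function_length[OF sol z0 x that] s c by simp
      also have "\<dots> \<le> sqrt (P / R x) + cmod z * sqrt (E * W x)"
        using le[OF x] nn by (intro add_mono mult_left_mono real_sqrt_le_mono mult_right_mono divide_right_mono) auto
      finally show ?thesis .
    qed
    show "cmod (Neumann_m b W R z) \<le> sqrt (P * R x) + sqrt (E / W x)" if "0 < W x"
    proof -
      have "cmod m \<le> sqrt (energy b R ?v x * R x) + sqrt (energy b W ?u x / W x)"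
        using trial_function_mass[OF sol z0 x that] s c by simp
      also have "\<dots> \<le> sqrt (P * R x) + sqrt (E / W x)"
        using le[OF x] nn by (intro add_mono mult_left_mono real_sqrt_le_mono mult_right_mono divide_right_mono) auto
      finally show ?thesis unfolding Nm .
    qed
  qed
qed

lemma solves_cnj:
  assumes "solves_system b W R z u v"
  shows "solves_system b W R (cnj z) (\<lambda>x. cnj (u x)) (\<lambda>x. cnj (v x))"
  unfolding solves_iff
proof (intro ballI conjI)
  fix x assume x: "x \<in> dom0 b"
  note s = solvesD[OF assms x]
  show "integrable (trunc b R x) (\<lambda>x. cnj (v x))" "integrable (trunc b W x) (\<lambda>x. cnj (u x))" using s by auto
  show "cnj (u x) = cnj (u 0) + (\<integral>x. cnj (v x) \<partial>trunc b R x)" by (subst s(3)) simp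
  show "cnj (v x) = cnj (v 0) - cnj z * (\<integral>x. cnj (u x) \<partial>trunc b W x)" by (subst s(4)) simp
qed

lemma is_weyl_cnj:
  assumes "is_weyl z m" "z \<noteq> 0"
  shows "is_weyl (cnj z) (cnj m)"
proof -
  obtain c c' s s' where c: "solves_system b W R z c c'" "c 0 = 1" "c' 0 = 0"
    and s: "solves_system b W R z s s'" "s 0 = 0" "s' 0 = 1"
    and L: "L2_on (LS_measure b W) {x. 0 < x \<and> ereal x < b} (\<lambda>x. s x - m * c x)"
    using assms(1) unfolding is_weyl_def by blast
  let ?u = "\<lambda>x. cnj (s x) - cnj m * cnj (c x)"
  note cc = solves_cnj[OF c(1)] and ss = solves_cnj[OF s(1)]
  have "energy b W ?u x = energy b W (\<lambda>x. s x - m * c x) x" for x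
  proof -
    have "cmod (?u t) = cmod (s t - m * c t)" for t
      by (metis complex_cnj_diff complex_cnj_mult complex_mod_cnj)
    then show ?thesis by (simp add: energy_def)
  qed
  then have "L2_on (LS_measure b W) {x. 0 < x \<and> ereal x < b} ?u"
    using L L2_solution_iff[OF solves_combination[OF s(1) c(1), of m] assms(2)]
      L2_solution_iff[OF solves_combination[OF ss cc, of "cnj m"]] assms(2) by simp
  moreover have "cnj (c 0) = 1" "cnj (c' 0) = 0" "cnj (s 0) = 0" "cnj (s' 0) = 1" using c s by auto
  ultimately show ?thesis unfolding is_weyl_def using cc ss by blast
qed

lemma Neumann_m_cnj:
  assumes z: "0 < Im z"
  shows "Neumann_m b W R (cnj z) = cnj (Neumann_m b W R z)"
proof -
  have z0: "z \<noteq> 0" using z by auto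
  obtain c c' where c: "solves_system b W R z c c'" "c 0 = 1" "c' 0 = 0" using exists_cosine by blast
  obtain s s' where s: "solves_system b W R z s s'" "s 0 = 0" "s' 0 = 1" using exists_sine by blast
  obtain m where m: "is_weyl z m" using weyl_exists[OF z c s] by blast
  have "m' = cnj m" if "is_weyl (cnj z) m'" for m'
    using weyl_unique[OF z m] is_weyl_cnj[OF that] z0 by (metis complex_cnj_cnj complex_cnj_zero_iff)
  then have "Neumann_m b W R (cnj z) = cnj m"
    unfolding Neumann_m_def is_weyl_def[symmetric] by (rule the_equality[of "is_weyl (cnj z)", OF is_weyl_cnj[OF m z0]])
  then show ?thesis using Neumann_m_eqI[OF z m] by simp
qed

end

section \<open>Positively increasing implies the bound in sectors\<close>

lemma (in stieltjes) exists_larger: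
  assumes "x \<in> dom0 b" "0 < d"
  obtains u where "u \<in> dom0 b" "x < u" "dist u x < d"
proof -
  obtain x1 where x1: "x1 \<in> dom0 b" "F x < F x1" using ex_gt by blast
  have "x < x1"
  proof (rule ccontr)
    assume "\<not> x < x1"
    then have "F x1 \<le> F x" using le[OF assms(1), of x1] x1(1) by (auto simp: dom0_def)
    then show False using x1(2) by linarith
  qed
  define u where "u = min x1 (x + d / 2)"
  have "x < u" "u \<le> x1" "dist u x < d" using \<open>x < x1\<close> assms(2) by (auto simp: u_def dist_real_def)
  moreover have "0 \<le> u" using \<open>x < u\<close> assms(1) by (auto simp: dom0_def)
  ultimately show thesis using dom0_less[OF x1(1)] that by blast
qed

lemma (in stieltjes) gen_inverse_facts:
  assumes y: "0 < y"
  shows gen_inverse_dom: "gen_inverse b F y \<in> dom0 b"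
    and gen_inverse_le: "F (gen_inverse b F y) \<le> y"
    and gen_inverse_less: "v \<in> dom0 b \<Longrightarrow> gen_inverse b F y < v \<Longrightarrow> y \<le> F v"
    and gen_inverse_ge: "v \<in> dom0 b \<Longrightarrow> F v < y \<Longrightarrow> v \<le> gen_inverse b F y"
proof -
  define A where "A = {v. 0 < v \<and> ereal v < b \<and> y \<le> F v}"
  let ?g = "gen_inverse b F y"
  have g: "?g = Inf A" by (simp add: gen_inverse_def A_def)
  obtain v0 where v0: "v0 \<in> dom0 b" "y < F v0" using ex_gt by blast
  then have A0: "v0 \<in> A" using zero y by (cases "v0 = 0") (auto simp: A_def dom0_def)
  have bdd: "bdd_below A" by (auto simp: A_def intro!: bdd_belowI[of _ 0])
  have g0: "0 \<le> ?g" unfolding g by (rule cInf_greatest) (use A0 in \<open>auto simp: A_def\<close>)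
  have "?g \<le> v0" unfolding g by (rule cInf_lower[OF A0 bdd])
  then show gd: "?g \<in> dom0 b" using dom0_less[OF v0(1) g0] by blast
  show less: "y \<le> F v" if v: "v \<in> dom0 b" "?g < v" for v
  proof -
    obtain u where "u \<in> A" "u < v" using cInf_lessD[of A v] v(2) A0 unfolding g by blast
    then show ?thesis using le[OF v(1), of u] by (auto simp: A_def)
  qed
  show "v \<le> ?g" if "v \<in> dom0 b" "F v < y" for v using less[OF that(1)] that(2) by force
  show "F ?g \<le> y"
  proof (rule ccontr)
    assume gt: "\<not> F ?g \<le> y"
    then have gpos: "0 < ?g" using g0 zero y by (cases "?g = 0") auto
    have "(F \<longlongrightarrow> F ?g) (at ?g within (dom0 b \<inter> {..?g}))"
      using left_cont gd by (auto simp: left_continuous_on_def continuous_within)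
    then have "\<forall>\<^sub>F u in at ?g within (dom0 b \<inter> {..?g}). y < F u"
      using gt by (intro order_tendstoD(1)) auto
    then obtain d where d: "d > 0" "\<And>u. u \<in> dom0 b \<Longrightarrow> u < ?g \<Longrightarrow> dist u ?g < d \<Longrightarrow> y < F u"
      unfolding eventually_at by (metis IntI atMost_iff less_imp_le less_irrefl)
    define u where "u = max (?g / 2) (?g - d / 2)"
    have u: "0 < u" "u < ?g" "dist u ?g < d" using gpos d(1) by (auto simp: u_def dist_real_def max_def)
    have ud: "u \<in> dom0 b" by (rule dom0_less[OF gd]) (use u in auto)
    have "u \<in> A" using d(2)[OF ud u(2,3)] ud u(1) by (auto simp: A_def dom0_def)
    then have "?g \<le> u" unfolding g by (rule cInf_lower[OF _ bdd])
    then show False using u by linarith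
  qed
qed

context string_system begin

text \<open>
  The length as a function of the mass.
\<close>

definition length_of_mass :: "real \<Rightarrow> real" where "length_of_mass = R \<circ> gen_inverse b W"

lemma length_of_mass_mono: "0 < x \<Longrightarrow> x \<le> y \<Longrightarrow> length_of_mass x \<le> length_of_mass y"
  using monotone_onD[OF gen_inverse_comp_mono[OF W.mono W.unbounded W.zero R.mono], of x y] by (simp add: length_of_mass_def)

lemma length_of_mass_nonneg: "0 < x \<Longrightarrow> 0 \<le> length_of_mass x"
  by (simp add: length_of_mass_def R.nonneg W.gen_inverse_dom)

text \<open>
  At \<open>W\<^sup>-\<^sup>1(y)\<close> the function \<open>W\<close> may still be below \<open>y\<close>, reaching it only by a jump. Then \<open>R\<close> is
  continuous there, and a point slightly to the right has mass at least \<open>y\<close> at almost no additional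
  length.
\<close>

lemma length_of_mass_approx:
  assumes y: "0 < y" and r: "length_of_mass y < r"
  obtains q where "q \<in> dom0 b" "y \<le> W q" "length_of_mass y \<le> R q" "R q < r"
proof -
  let ?g = "gen_inverse b W y"
  have gd: "?g \<in> dom0 b" by (rule W.gen_inverse_dom[OF y])
  have g0: "0 \<le> ?g" using gd by (simp add: dom0_def)
  consider "continuous (at ?g within dom0 b) W" | "continuous (at ?g within dom0 b) R"
    using no_common gd by blast
  then show thesis
  proof cases
    case 1
    have "y \<le> W ?g"
    proof (rule ccontr)
      assume "\<not> y \<le> W ?g"
      then have "0 < y - W ?g" by simp
      then obtain d where d: "d > 0" "\<And>u. u \<in> dom0 b \<Longrightarrow> dist u ?g < d \<Longrightarrow> dist (W u) (W ?g) < y - W ?g"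
        using 1 unfolding continuous_within_eps_delta by meson
      obtain u where u: "u \<in> dom0 b" "?g < u" "dist u ?g < d" using W.exists_larger[OF gd d(1)] .
      show False using d(2)[OF u(1,3)] W.gen_inverse_less[OF y u(1,2)] by (auto simp: dist_real_def)
    qed
    then show thesis using that[OF gd] r by (simp add: length_of_mass_def)
  next
    case 2
    have "0 < r - R ?g" using r by (simp add: length_of_mass_def)
    then obtain d where d: "d > 0" "\<And>u. u \<in> dom0 b \<Longrightarrow> dist u ?g < d \<Longrightarrow> dist (R u) (R ?g) < r - R ?g"
      using 2 unfolding continuous_within_eps_delta by meson
    obtain u where u: "u \<in> dom0 b" "?g < u" "dist u ?g < d" using W.exists_larger[OF gd d(1)] .
    have "R ?g \<le> R u" by (rule R.le[OF u(1) g0]) (use u in auto)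
    then show thesis
      using that[OF u(1) W.gen_inverse_less[OF y u(1,2)]] d(2)[OF u(1,3)] by (auto simp: length_of_mass_def dist_real_def)
  qed
qed

lemma length_of_mass_ge:
  assumes y: "0 < y" and L: "\<And>v. v \<in> dom0 b \<Longrightarrow> y \<le> W v \<Longrightarrow> L \<le> R v"
  shows "L \<le> length_of_mass y"
proof (rule ccontr)
  assume "\<not> L \<le> length_of_mass y"
  then obtain q where "q \<in> dom0 b" "y \<le> W q" "R q < L" using length_of_mass_approx[OF y, of L] by auto
  then show False using L by force
qed

lemma length_of_mass_eventually_ge: "\<forall>\<^sub>F x in at_top. K \<le> length_of_mass x"
proof -
  obtain v where v: "v \<in> dom0 b" "K < R v" using R.ex_gt by blast
  have "K \<le> length_of_mass x" if x: "x \<ge> W v + 1" for x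
  proof -
    have x0: "0 < x" using W.nonneg[OF v(1)] x by linarith
    have "v \<le> gen_inverse b W x" using W.gen_inverse_ge[OF x0 v(1)] x by linarith
    then have "R v \<le> length_of_mass x" unfolding length_of_mass_def comp_def
      using R.le[OF W.gen_inverse_dom[OF x0], of v] v(1) by (auto simp: dom0_def)
    then show ?thesis using v(2) by linarith
  qed
  then show ?thesis by (auto simp: eventually_at_top_linorder)
qed

lemma S_infinity_neq_1E:
  assumes t: "0 < t" "t < 1" and S: "S_infinity length_of_mass t \<noteq> 1"
  obtains q X where "0 \<le> q" "q < 1" "0 < X" "\<And>x. X \<le> x \<Longrightarrow> length_of_mass (x * t) \<le> q * length_of_mass x"
proof -
  have le: "length_of_mass (x * t) \<le> length_of_mass x" if "0 < x" for x
    using that t by (intro length_of_mass_mono) auto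
  have "S_infinity length_of_mass t \<le> 1"
    unfolding S_infinity_def
  proof (rule Limsup_bounded)
    show "\<forall>\<^sub>F x in at_top. ereal (length_of_mass (x * t) / length_of_mass x) \<le> 1"
      using eventually_gt_at_top[of 0]
    proof eventually_elim
      case (elim x)
      show ?case using le[OF elim] length_of_mass_nonneg[OF elim] by (auto simp: divide_le_eq_1 one_ereal_def)
    qed
  qed
  then have "S_infinity length_of_mass t < 1" using S by simp
  then obtain q0 where q0: "S_infinity length_of_mass t < ereal q0" "ereal q0 < 1" using ereal_dense2 by blast
  have "\<forall>\<^sub>F x in at_top. ereal (length_of_mass (x * t) / length_of_mass x) < ereal q0"
    by (rule Limsup_lessD) (use q0(1) in \<open>simp add: S_infinity_def\<close>)
  then obtain X0 where X0: "\<And>x. x \<ge> X0 \<Longrightarrow> length_of_mass (x * t) / length_of_mass x < q0"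
    by (auto simp: eventually_at_top_linorder)
  show thesis
  proof (rule that[of "max 0 q0" "max 1 X0"])
    fix x assume x: "max 1 X0 \<le> x"
    then have x0: "0 < x" by simp
    show "length_of_mass (x * t) \<le> max 0 q0 * length_of_mass x"
    proof (cases "length_of_mass x = 0")
      case True
      then show ?thesis using le[OF x0] by simp
    next
      case False
      then have "0 < length_of_mass x" using length_of_mass_nonneg[OF x0] by simp
      moreover from this have "length_of_mass (x * t) < q0 * length_of_mass x" using X0[of x] x by (simp add: pos_divide_less_eq)
      moreover have "q0 * length_of_mass x \<le> max 0 q0 * length_of_mass x" using length_of_mass_nonneg[OF x0] by (intro mult_right_mono) auto
      ultimately show ?thesis by linarith
    qed
  qed (use q0(2) in \<open>auto simp: one_ereal_def\<close>)
qed

lemma power_decay: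
  assumes q: "0 \<le> q" and t: "0 < t" "t < 1" and X: "0 < X" "\<And>x. X \<le> x \<Longrightarrow> length_of_mass (x * t) \<le> q * length_of_mass x"
    and w: "X \<le> t ^ n * w"
  shows "length_of_mass (t ^ n * w) \<le> q ^ n * length_of_mass w"
  using w
proof (induction n)
  case (Suc n)
  have w0: "0 < w" using Suc.prems X(1) t by (metis less_le_trans zero_less_mult_pos zero_less_power)
  have "t ^ Suc n * w \<le> t ^ n * w" using t w0 by (intro mult_right_mono power_decreasing) auto
  then have n: "X \<le> t ^ n * w" using Suc.prems by linarith
  have "length_of_mass (t ^ Suc n * w) = length_of_mass ((t ^ n * w) * t)" by (simp add: mult_ac)
  also have "\<dots> \<le> q * length_of_mass (t ^ n * w)" by (rule X(2)[OF n])
  also have "\<dots> \<le> q * (q ^ n * length_of_mass w)" by (rule mult_left_mono[OF Suc.IH[OF n] q])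
  finally show ?case by (simp add: mult_ac)
qed simp

text \<open>
  The bound on \<open>|Re z|\<close> describes a symmetric sector in the upper half-plane. It yields
  \<open>|P - cnj z E| \<ge> \<delta> P\<close> with the constant \<open>\<delta>\<close> chosen below.
\<close>

lemma Re_O_Im_upper:
  assumes S: "\<exists>t\<in>{0<..<1}. S_infinity length_of_mass t \<noteq> 1" and c: "0 \<le> c" "c < 1"
  obtains C d where "0 < d"
    "\<And>z. 0 < Im z \<Longrightarrow> cmod z < d \<Longrightarrow> \<bar>Re z\<bar> \<le> c * cmod z \<Longrightarrow>
      \<bar>Re (Neumann_m b W R z)\<bar> \<le> C * \<bar>Im (Neumann_m b W R z)\<bar>"
proof -
  obtain t where t: "0 < t" "t < 1" "S_infinity length_of_mass t \<noteq> 1" using S by auto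
  obtain q X where q: "0 \<le> q" "q < 1" and X: "0 < X" "\<And>x. X \<le> x \<Longrightarrow> length_of_mass (x * t) \<le> q * length_of_mass x"
    using S_infinity_neq_1E[OF t] by metis
  define \<delta> where "\<delta> = sqrt ((1 - c) / 2)"
  have \<delta>: "0 < \<delta>" "\<delta>\<^sup>2 = (1 - c) / 2" using c by (auto simp: \<delta>_def)
  have "0 < \<delta>\<^sup>2 / 16" using \<delta>(1) by simp
  then obtain n where n: "q ^ n < \<delta>\<^sup>2 / 16" using real_arch_pow_inv[OF _ q(2)] by blast
  \<comment> \<open>With this \<open>\<epsilon>\<close> the two scales \<open>w\<close> and \<open>8 \<epsilon> w / \<delta>\<^sup>2\<close> below are at least \<open>n\<close> factors of \<open>t\<close> apart;
    over these the length shrinks by a factor less than \<open>\<delta>\<^sup>2 / 16\<close>, more than (A) and (B) permit.\<close>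
  define \<epsilon> where "\<epsilon> = min (1 / 4) (\<delta>\<^sup>2 * t ^ n / 8)"
  have \<epsilon>: "0 < \<epsilon>" "\<epsilon> \<le> 1 / 4" "8 * \<epsilon> \<le> \<delta>\<^sup>2 * t ^ n"
  proof -
    show "0 < \<epsilon>" "\<epsilon> \<le> 1 / 4" using \<delta>(1) t by (auto simp: \<epsilon>_def)
    have "\<epsilon> \<le> \<delta>\<^sup>2 * t ^ n / 8" by (simp add: \<epsilon>_def)
    then show "8 * \<epsilon> \<le> \<delta>\<^sup>2 * t ^ n" by linarith
  qed
  \<comment> \<open>If \<open>w \<ge> Z\<close>, all scales between \<open>t ^ n * w\<close> and \<open>w\<close> are beyond \<open>X\<close>; \<open>d\<close> is chosen to ensure \<open>w \<ge> Z\<close>.\<close>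
  define Z where "Z = X / t ^ n"
  have Z: "0 < Z" using X t by (simp add: Z_def)
  obtain x1 where x1: "x1 \<in> dom0 b" "4 * Z / \<delta>\<^sup>2 < W x1" using W.ex_gt by blast
  have W1: "0 < W x1" using x1(2) Z \<delta> by (smt (verit) divide_pos_pos zero_less_power)
  have R1: "0 \<le> R x1" by (rule R.nonneg[OF x1(1)])
  define d where "d = \<delta>\<^sup>2 / (4 * Z * (R x1 + 1))"
  have d: "0 < d" using \<delta> Z R1 by (simp add: d_def)
  have key: "\<bar>Re (Neumann_m b W R z)\<bar> \<le> ((1 / \<epsilon> + 1) / (1 - c)) * \<bar>Im (Neumann_m b W R z)\<bar>"
    if z: "0 < Im z" "cmod z < d" "\<bar>Re z\<bar> \<le> c * cmod z" for z
  proof -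
    let ?m = "Neumann_m b W R z" and ?\<zeta> = "cmod z"
    have \<zeta>: "0 < ?\<zeta>" using z(1) by auto
    obtain P E where PE: "0 \<le> P" "0 \<le> E" and m: "?m = of_real P - cnj z * of_real E"
      and A: "\<And>x. x \<in> dom0 b \<Longrightarrow> 0 < R x \<Longrightarrow> 1 \<le> sqrt (P / R x) + ?\<zeta> * sqrt (E * W x)"
      and B: "\<And>x. x \<in> dom0 b \<Longrightarrow> 0 < W x \<Longrightarrow> cmod ?m \<le> sqrt (P * R x) + sqrt (E / W x)"
      using Neumann_m_variational[OF z(1)] by metis
    define Y where "Y = ?\<zeta> * E"
    have Y0: "0 \<le> Y" using PE by (simp add: Y_def)
    have EY: "E = Y / ?\<zeta>" using \<zeta> by (simp add: Y_def)
    have low: "\<delta> * P \<le> cmod ?m"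
    proof (rule power2_le_imp_le)
      have re: "Re ?m = P - Re z * E" and im: "Im ?m = Im z * E" by (simp_all add: m)
      have "Re z * E * P \<le> c * Y * P"
        using z(3) PE by (intro mult_right_mono) (auto simp: Y_def mult.assoc[symmetric] intro!: mult_right_mono)
      moreover have "(cmod ?m)\<^sup>2 = P\<^sup>2 - 2 * (Re z * E * P) + Y\<^sup>2"
        unfolding cmod_power2 re im Y_def power_mult_distrib cmod_power2
        by (simp add: power2_eq_square algebra_simps)
      moreover have "c * (2 * (Y * P)) \<le> c * (Y\<^sup>2 + P\<^sup>2)"
        using c sum_squares_bound[of Y P] by (intro mult_left_mono) (auto simp: mult.assoc)
      ultimately have "P\<^sup>2 + Y\<^sup>2 - c * (Y\<^sup>2 + P\<^sup>2) \<le> (cmod ?m)\<^sup>2" by (simp add: mult.assoc)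
      moreover have "P\<^sup>2 + Y\<^sup>2 - c * (Y\<^sup>2 + P\<^sup>2) = (1 - c) / 2 * P\<^sup>2 + (1 - c) * (P\<^sup>2 / 2 + Y\<^sup>2)"
        by (simp add: field_simps)
      moreover have "0 \<le> (1 - c) * (P\<^sup>2 / 2 + Y\<^sup>2)" using c by simp
      ultimately have "(1 - c) / 2 * P\<^sup>2 \<le> (cmod ?m)\<^sup>2" by linarith
      then show "(\<delta> * P)\<^sup>2 \<le> (cmod ?m)\<^sup>2" by (simp add: power_mult_distrib \<delta>)
    qed simp
    have main: "\<epsilon> * P \<le> Y"
    proof (rule ccontr)
      assume "\<not> \<epsilon> * P \<le> Y"
      then have YP: "Y < \<epsilon> * P" by simp
      then have P: "0 < P" using Y0 \<epsilon>(1) by (smt (verit) zero_less_mult_pos)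
      define w where "w = 1 / (?\<zeta> * P)"
      have w: "0 < w" using P \<zeta> by (simp add: w_def)
      have \<zeta>w: "?\<zeta> = 1 / (w * P)" using P \<zeta> by (simp add: w_def)
      \<comment> \<open>The estimate (A) at \<open>W\<^sup>-\<^sup>1(w)\<close>, where its second term is at most \<open>1 / 2\<close>.\<close>
      have up: "length_of_mass w \<le> 4 * P"
      proof (cases "length_of_mass w = 0")
        case False
        let ?x = "gen_inverse b W w"
        have x: "?x \<in> dom0 b" "W ?x \<le> w" by (rule W.gen_inverse_dom[OF w], rule W.gen_inverse_le[OF w])
        have Rx: "0 < R ?x" using False length_of_mass_nonneg[OF w] by (simp add: length_of_mass_def)
        have "?\<zeta> * sqrt (E * W ?x) = sqrt (?\<zeta>\<^sup>2 * (E * W ?x))" using \<zeta> by (simp add: real_sqrt_mult)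
        also have "\<dots> \<le> sqrt ((1 / 2)\<^sup>2)"
        proof (rule real_sqrt_le_mono)
          have "?\<zeta>\<^sup>2 * (E * W ?x) = ?\<zeta> * Y * W ?x" by (simp add: Y_def power2_eq_square)
          also have "\<dots> \<le> ?\<zeta> * (\<epsilon> * P) * w"
            using YP x(2) \<zeta> Y0 \<epsilon>(1) P W.nonneg[OF x(1)] by (intro mult_mono) auto
          also have "\<dots> = \<epsilon>" using \<zeta> P by (simp add: w_def)
          finally show "?\<zeta>\<^sup>2 * (E * W ?x) \<le> (1 / 2)\<^sup>2" using \<epsilon>(2) by (simp add: power2_eq_square)
        qed
        finally have "1 / 2 \<le> sqrt (P / R ?x)" using A[OF x(1) Rx] by simp
        then have "(1 / 2)\<^sup>2 \<le> (sqrt (P / R ?x))\<^sup>2" by (intro power_mono) auto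
        then have "1 / 4 \<le> P / R ?x" using P Rx by (simp add: power2_eq_square)
        then show ?thesis using Rx by (simp add: length_of_mass_def pos_le_divide_eq)
      qed (use P in simp)
      \<comment> \<open>The estimate (B), where the second term absorbs at most half of the left-hand side.\<close>
      have down: "\<delta>\<^sup>2 * P / 4 \<le> length_of_mass (8 * \<epsilon> * w / \<delta>\<^sup>2)"
      proof (rule length_of_mass_ge)
        show "0 < 8 * \<epsilon> * w / \<delta>\<^sup>2" using \<epsilon> w \<delta> by simp
        fix v assume v: "v \<in> dom0 b" "8 * \<epsilon> * w / \<delta>\<^sup>2 \<le> W v"
        have Wv: "0 < W v" using v(2) \<epsilon>(1) w \<delta>(1) by (smt (verit) divide_pos_pos mult_pos_pos zero_less_power)
        have "sqrt (E / W v) \<le> sqrt ((\<delta> * P / 2)\<^sup>2)"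
        proof (rule real_sqrt_le_mono)
          have "E = Y * (w * P)" using EY \<zeta>w by simp
          also have "\<dots> \<le> \<epsilon> * P * (w * P)" using YP w P by (intro mult_right_mono) auto
          finally have "E \<le> \<epsilon> * w * P\<^sup>2" by (simp add: power2_eq_square mult_ac)
          moreover have "4 * \<epsilon> * w \<le> \<delta>\<^sup>2 * W v"
          proof -
            have "8 * (\<epsilon> * w) \<le> \<delta>\<^sup>2 * W v" using v(2) \<delta>(1) by (simp add: pos_divide_le_eq mult_ac)
            moreover have "0 \<le> \<epsilon> * w" using \<epsilon> w by simp
            ultimately have "4 * (\<epsilon> * w) \<le> \<delta>\<^sup>2 * W v" by linarith
            then show ?thesis by (simp only: mult.assoc)
          qed
          then have "4 * \<epsilon> * w * P\<^sup>2 \<le> \<delta>\<^sup>2 * W v * P\<^sup>2" by (rule mult_right_mono) simp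
          ultimately have "4 * E \<le> \<delta>\<^sup>2 * P\<^sup>2 * W v" by (simp add: mult_ac)
          then show "E / W v \<le> (\<delta> * P / 2)\<^sup>2"
            using Wv by (simp add: pos_divide_le_eq power_mult_distrib power_divide)
        qed
        also have "\<dots> = \<delta> * P / 2" using \<delta> P by simp
        finally have "\<delta> * P / 2 \<le> sqrt (P * R v)" using B[OF v(1) Wv] low by linarith
        then have "(\<delta> * P / 2)\<^sup>2 \<le> (sqrt (P * R v))\<^sup>2" using \<delta> P by (intro power_mono) auto
        also have "\<dots> = P * R v" using P R.nonneg[OF v(1)] by simp
        finally have "P * (\<delta>\<^sup>2 * P / 4) \<le> P * R v" by (simp add: power2_eq_square mult_ac)
        then show "\<delta>\<^sup>2 * P / 4 \<le> R v" using P by (subst (asm) mult_le_cancel_left_pos)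
      qed
      \<comment> \<open>The scale \<open>w\<close> is large: (B) at the fixed point \<open>x1\<close> bounds \<open>P\<close>.\<close>
      have small: "?\<zeta> * P * Z \<le> 1"
      proof -
        have "\<delta> * P \<le> sqrt (P * R x1) + sqrt (E / W x1)" using B[OF x1(1) W1] low by linarith
        also have "\<dots> \<le> sqrt (P * R x1) + sqrt (P / (?\<zeta> * W x1))"
        proof -
          have "\<epsilon> * P \<le> 1 * P" using \<epsilon>(2) P by (intro mult_right_mono) auto
          then have "E / W x1 \<le> P / (?\<zeta> * W x1)"
            unfolding EY using YP W1 \<zeta> by (simp add: divide_right_mono)
          then show ?thesis by simp
        qed
        finally have "(\<delta> * P)\<^sup>2 \<le> (sqrt (P * R x1) + sqrt (P / (?\<zeta> * W x1)))\<^sup>2"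
          using \<delta> P by (intro power_mono) auto
        also have "\<dots> \<le> 2 * (P * R x1) + 2 * (P / (?\<zeta> * W x1))"
        proof -
          have "(a + e)\<^sup>2 \<le> 2 * a\<^sup>2 + 2 * e\<^sup>2" for a e :: real
            using sum_squares_bound[of a e] by (simp add: power2_sum)
          from this[of "sqrt (P * R x1)" "sqrt (P / (?\<zeta> * W x1))"] show ?thesis
            using P R1 \<zeta> W1 by simp
        qed
        finally have "P * (\<delta>\<^sup>2 * P) \<le> P * (2 * R x1 + 2 / (?\<zeta> * W x1))"
          by (simp add: power2_eq_square algebra_simps)
        then have "\<delta>\<^sup>2 * P \<le> 2 * R x1 + 2 / (?\<zeta> * W x1)" using P by (subst (asm) mult_le_cancel_left_pos)
        then have "?\<zeta> * (\<delta>\<^sup>2 * P) \<le> ?\<zeta> * (2 * R x1 + 2 / (?\<zeta> * W x1))"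
          by (rule mult_left_mono) simp
        then have 1: "?\<zeta> * P * \<delta>\<^sup>2 \<le> 2 * (?\<zeta> * R x1) + 2 / W x1"
          using \<zeta> by (simp add: algebra_simps)
        have 2: "2 / W x1 \<le> \<delta>\<^sup>2 / (2 * Z)"
          using x1(2) W1 Z \<delta>(1) by (simp add: field_simps)
        have "?\<zeta> * R x1 \<le> d * (R x1 + 1)" using z(2) R1 d by (intro mult_mono) auto
        also have "\<dots> = \<delta>\<^sup>2 / (4 * Z)"
        proof -
          have "R x1 + 1 \<noteq> 0" using R1 by linarith
          then show ?thesis unfolding d_def mult.assoc[symmetric] by simp
        qed
        finally have "?\<zeta> * P * \<delta>\<^sup>2 \<le> 2 * (\<delta>\<^sup>2 / (4 * Z)) + \<delta>\<^sup>2 / (2 * Z)" using 1 2 by linarith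
        also have "\<dots> = \<delta>\<^sup>2 / Z" using Z by (simp add: field_simps)
        finally have "?\<zeta> * P * Z * \<delta>\<^sup>2 \<le> 1 * \<delta>\<^sup>2" using Z by (simp add: pos_le_divide_eq mult_ac)
        then show ?thesis using \<delta>(1) by (subst (asm) mult_le_cancel_right_pos) auto
      qed
      have "Z \<le> w" using small \<zeta> P by (simp add: w_def pos_le_divide_eq mult_ac)
      then have "X \<le> t ^ n * w" using t by (simp add: Z_def pos_divide_le_eq mult.commute)
      then have "length_of_mass (t ^ n * w) \<le> q ^ n * length_of_mass w" by - (rule power_decay[OF q(1) t(1,2) X])
      moreover have "length_of_mass (8 * \<epsilon> * w / \<delta>\<^sup>2) \<le> length_of_mass (t ^ n * w)"
      proof (rule length_of_mass_mono)
        show "0 < 8 * \<epsilon> * w / \<delta>\<^sup>2" using \<epsilon> w \<delta> by simp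
        have "8 * \<epsilon> * w \<le> \<delta>\<^sup>2 * t ^ n * w" using \<epsilon>(3) w by (intro mult_right_mono) auto
        then show "8 * \<epsilon> * w / \<delta>\<^sup>2 \<le> t ^ n * w" using \<delta>(1) by (simp add: pos_divide_le_eq mult_ac)
      qed
      moreover have "q ^ n * length_of_mass w \<le> q ^ n * (4 * P)" using up q by (intro mult_left_mono) auto
      moreover have "q ^ n * (4 * P) < \<delta>\<^sup>2 / 16 * (4 * P)" using n P by (intro mult_strict_right_mono) auto
      ultimately show False using down by simp
    qed
    have imz: "(1 - c) * ?\<zeta> \<le> Im z" using cmod_le[of z] z by (simp add: algebra_simps)
    have "\<bar>Re ?m\<bar> \<le> P + \<bar>Re z\<bar> * E" using PE abs_triangle_ineq4[of P "Re z * E"] by (simp add: m abs_mult)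
    also have "\<dots> \<le> P + Y" using z(3) c PE \<zeta> unfolding Y_def
      by (intro add_left_mono mult_right_mono) (auto intro: order_trans[OF z(3)] mult_left_le_one_le)
    also have "\<dots> \<le> (1 / \<epsilon> + 1) * Y"
      using main \<epsilon>(1) by (simp add: field_simps)
    also have "\<dots> \<le> (1 / \<epsilon> + 1) * (\<bar>Im ?m\<bar> / (1 - c))"
    proof (rule mult_left_mono)
      have "(1 - c) * ?\<zeta> * E \<le> Im z * E" using imz PE by (intro mult_right_mono) auto
      then have "Y * (1 - c) \<le> \<bar>Im ?m\<bar>" using z PE by (simp add: m Y_def mult_ac)
      then show "Y \<le> \<bar>Im ?m\<bar> / (1 - c)" using c by (simp add: pos_le_divide_eq)
    qed (use \<epsilon> in simp)
    finally show ?thesis by simp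
  qed
  show thesis by (rule that[OF d key])
qed

lemma Re_O_Im:
  assumes S: "\<exists>t\<in>{0<..<1}. S_infinity length_of_mass t \<noteq> 1" and sec: "nonreal_sector S"
  shows "(\<lambda>z. \<bar>Re (Neumann_m b W R z)\<bar>) \<in> O[at 0 within S](\<lambda>z. \<bar>Im (Neumann_m b W R z)\<bar>)"
proof -
  obtain \<theta>1 \<theta>2 where \<theta>: "\<theta>1 \<le> \<theta>2" and Seq: "S = {of_real \<rho> * cis \<theta> | \<rho> \<theta>. 0 < \<rho> \<and> \<theta> \<in> {\<theta>1..\<theta>2}}"
    and nr: "S \<inter> \<real> = {}" using sec unfolding nonreal_sector_def by blast
  have "\<exists>\<theta>0\<in>{\<theta>1..\<theta>2}. \<forall>\<theta>\<in>{\<theta>1..\<theta>2}. \<bar>cos \<theta>\<bar> \<le> \<bar>cos \<theta>0\<bar>"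
    using \<theta> by (intro continuous_attains_sup continuous_intros) auto
  then obtain \<theta>0 where \<theta>0: "\<theta>0 \<in> {\<theta>1..\<theta>2}" "\<And>\<theta>. \<theta> \<in> {\<theta>1..\<theta>2} \<Longrightarrow> \<bar>cos \<theta>\<bar> \<le> \<bar>cos \<theta>0\<bar>" by blast
  have "of_real 1 * cis \<theta>0 \<in> S" unfolding Seq
    using \<theta>0(1) by (intro CollectI exI[of _ "1::real"] exI[of _ \<theta>0]) simp
  then have "cis \<theta>0 \<notin> \<real>" using nr by auto
  then have "sin \<theta>0 \<noteq> 0" by (auto simp: complex_is_Real_iff)
  then have "(cos \<theta>0)\<^sup>2 \<noteq> 1" using sin_squared_eq[of \<theta>0] by (metis diff_self power2_eq_iff_nonneg zero_eq_power2)
  then have "\<bar>cos \<theta>0\<bar> \<noteq> 1" by (metis power2_abs one_power2)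
  then have c: "0 \<le> \<bar>cos \<theta>0\<bar>" "\<bar>cos \<theta>0\<bar> < 1" using abs_cos_le_one[of \<theta>0]
    by (simp, metis order_le_less)
  have SS: "\<bar>Re z\<bar> \<le> \<bar>cos \<theta>0\<bar> * cmod z" "Im z \<noteq> 0" if zS: "z \<in> S" for z
  proof -
    obtain \<rho> \<theta> where z: "z = of_real \<rho> * cis \<theta>" "0 < \<rho>" "\<theta> \<in> {\<theta>1..\<theta>2}" using zS Seq by blast
    show "\<bar>Re z\<bar> \<le> \<bar>cos \<theta>0\<bar> * cmod z" using z \<theta>0(2)[OF z(3)] by (simp add: abs_mult norm_mult)
    show "Im z \<noteq> 0" using zS nr by (auto simp: complex_is_Real_iff)
  qed
  obtain C d where d: "0 < d" and C: "\<And>z. 0 < Im z \<Longrightarrow> cmod z < d \<Longrightarrow> \<bar>Re z\<bar> \<le> \<bar>cos \<theta>0\<bar> * cmod z \<Longrightarrow>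
      \<bar>Re (Neumann_m b W R z)\<bar> \<le> C * \<bar>Im (Neumann_m b W R z)\<bar>"
    using Re_O_Im_upper[OF S c] by metis
  have "\<bar>Re (Neumann_m b W R z)\<bar> \<le> C * \<bar>Im (Neumann_m b W R z)\<bar>" if z: "z \<in> S" "cmod z < d" for z
  proof (cases "0 < Im z")
    case True
    then show ?thesis using C z SS by blast
  next
    case False
    then have i: "0 < Im (cnj z)" using SS(2)[OF z(1)] by simp
    have "Neumann_m b W R z = cnj (Neumann_m b W R (cnj z))" using Neumann_m_cnj[OF i] by simp
    then show ?thesis using C[OF i] z SS(1)[OF z(1)] by simp
  qed
  then have "\<forall>\<^sub>F z in at 0 within S. norm \<bar>Re (Neumann_m b W R z)\<bar> \<le> C * norm \<bar>Im (Neumann_m b W R z)\<bar>"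
    unfolding eventually_at using d by (intro exI[of _ d]) auto
  then show ?thesis by (rule bigoI)
qed

end

section \<open>The converse\<close>

text \<open>
  Here \<open>a\<^sup>2\<close> and \<open>e\<^sup>2\<close> stand for real and imaginary part of \<open>m(iy)\<close>, divided by the length \<open>\<rho>\<close>. For \<open>\<eta> = 0\<close>
  the hypotheses read \<open>a \<ge> 1\<close> and \<open>a^4 + e^4 \<le> a\<^sup>2\<close>, so that \<open>a = 1\<close> and \<open>e = 0\<close>.
\<close>

lemma concentration_inequalities:
  fixes a e \<eta> :: real
  assumes \<eta>: "0 < \<eta>" "\<eta> \<le> 1 / 6" and ae: "0 \<le> a" "0 \<le> e"
    and 1: "1 - \<eta> \<le> a + \<eta> * e" and 2: "a ^ 4 + e ^ 4 \<le> (a + \<eta> * e)\<^sup>2"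
  shows "1 / 2 \<le> a" "e ^ 4 \<le> 18 * \<eta>"
proof -
  define M where "M = max a e"
  have M0: "0 \<le> M" using ae by (simp add: M_def)
  have "M ^ 4 \<le> a ^ 4 + e ^ 4" using ae by (auto simp: M_def max_def)
  also have "\<dots> \<le> (a + \<eta> * e)\<^sup>2" by (rule 2)
  also have "\<dots> \<le> (2 * M)\<^sup>2"
  proof (rule power_mono)
    have "\<eta> * e \<le> 1 * e" using \<eta> ae by (intro mult_right_mono) auto
    then show "a + \<eta> * e \<le> 2 * M" by (auto simp: M_def)
  qed (use ae \<eta> in auto)
  finally have M4: "M ^ 4 \<le> (2 * M)\<^sup>2" .
  have M2: "M \<le> 2"
  proof (rule ccontr)
    assume "\<not> M \<le> 2"
    then have "2\<^sup>2 * M\<^sup>2 < M\<^sup>2 * M\<^sup>2" by (intro mult_strict_right_mono power_strict_mono) auto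
    then show False using M4 by (simp add: power_mult_distrib power_add[symmetric] flip: power2_eq_square)
  qed
  have a2: "a \<le> 2" "e \<le> 2" using M2 by (auto simp: M_def)
  have "\<eta> * e \<le> \<eta> * 2" using a2 \<eta> by (intro mult_left_mono) auto
  then have a3: "1 - 3 * \<eta> \<le> a" using 1 by linarith
  then show "1 / 2 \<le> a" using \<eta> by linarith
  have b1: "(a + \<eta> * e)\<^sup>2 \<le> a\<^sup>2 + 12 * \<eta>"
  proof -
    have "a * e \<le> 2 * 2" using a2 ae by (intro mult_mono) auto
    then have "\<eta> * (a * e) \<le> \<eta> * 4" using \<eta> by (intro mult_left_mono) auto
    moreover have "\<eta> * (e * e) \<le> 1 * (2 * 2)" using a2 ae \<eta> by (intro mult_mono) auto
    then have "\<eta> * (\<eta> * (e * e)) \<le> \<eta> * 4" using \<eta> by (intro mult_left_mono) auto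
    ultimately show ?thesis by (simp add: power2_eq_square algebra_simps)
  qed
  have "a\<^sup>2 - a ^ 4 \<le> 6 * \<eta>"
  proof (cases "a \<le> 1")
    case True
    have "a\<^sup>2 - a ^ 4 = a\<^sup>2 * (1 + a) * (1 - a)" by (simp add: power2_eq_square power4_eq_xxxx algebra_simps)
    also have "\<dots> \<le> (1 * 2) * (3 * \<eta>)"
      using True ae a3 \<eta> by (intro mult_mono) (auto simp: power_le_one)
    finally show ?thesis by simp
  next
    case False
    then have "a\<^sup>2 \<le> a ^ 4" by (intro power_increasing) auto
    then show ?thesis using \<eta> by linarith
  qed
  then show "e ^ 4 \<le> 18 * \<eta>" using 2 b1 by linarith
qed

context string_system begin

text \<open>
  The estimate (A) is applied at \<open>p = W\<^sup>-\<^sup>1(\<eta>^4 x)\<close>, where the mass is at most \<open>\<eta>^4 x\<close>, and (B) at a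
  point \<open>q\<close> where the mass is at least \<open>x\<close>, while \<open>R(p)\<close> and \<open>R(q) = \<rho>\<close> nearly agree. The spectral
  parameter \<open>1 / (\<rho> x \<eta>\<^sup>2)\<close> is the geometric mean of \<open>1 / (\<rho> x)\<close> and \<open>1 / (\<rho> \<eta>^4 x)\<close>.
\<close>

lemma Re_div_Im_large:
  assumes S: "\<And>t. 0 < t \<Longrightarrow> t < 1 \<Longrightarrow> S_infinity length_of_mass t = 1" and K: "0 < K"
  obtains y where "0 < y" "y < 1"
    "K \<le> \<bar>Re (Neumann_m b W R (\<i> * of_real y))\<bar> / Im (Neumann_m b W R (\<i> * of_real y))"
proof -
  \<comment> \<open>The second bound makes \<open>e\<^sup>2 \<le> 1 / (4 K)\<close> in \<open>concentration_inequalities\<close>.\<close>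
  define \<eta> where "\<eta> = min (1 / 6) (1 / (18 * 16 * K\<^sup>2))"
  have \<eta>: "0 < \<eta>" "\<eta> \<le> 1 / 6" "18 * \<eta> \<le> 1 / (16 * K\<^sup>2)"
  proof -
    show "0 < \<eta>" "\<eta> \<le> 1 / 6" using K by (auto simp: \<eta>_def)
    have "\<eta> \<le> 1 / (18 * 16 * K\<^sup>2)" by (simp add: \<eta>_def)
    then have "18 * \<eta> \<le> 18 * (1 / (18 * 16 * K\<^sup>2))" by linarith
    then show "18 * \<eta> \<le> 1 / (16 * K\<^sup>2)" by simp
  qed
  define t where "t = \<eta> ^ 4"
  have t: "0 < t" "t < 1" using \<eta> by (auto simp: t_def power_less_one_iff)
  have "\<not> (\<forall>\<^sub>F x in at_top. ereal (length_of_mass (x * t) / length_of_mass x) \<le> ereal (1 - \<eta> / 2))"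
  proof
    assume "\<forall>\<^sub>F x in at_top. ereal (length_of_mass (x * t) / length_of_mass x) \<le> ereal (1 - \<eta> / 2)"
    then have "S_infinity length_of_mass t \<le> ereal (1 - \<eta> / 2)" unfolding S_infinity_def by (rule Limsup_bounded)
    then show False using S[OF t] \<eta>(1) by (simp add: one_ereal_def)
  qed
  moreover have ev: "\<forall>\<^sub>F x in at_top. 1 \<le> length_of_mass x \<and> 1 / \<eta>\<^sup>2 < x"
    using length_of_mass_eventually_ge eventually_gt_at_top by (rule eventually_conj)
  moreover have "\<forall>\<^sub>F x in at_top. ereal (length_of_mass (x * t) / length_of_mass x) \<le> ereal (1 - \<eta> / 2)"
    if "\<nexists>x. 1 - \<eta> / 2 < length_of_mass (x * t) / length_of_mass x \<and> 1 \<le> length_of_mass x \<and> 1 / \<eta>\<^sup>2 < x"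
    using ev by (rule eventually_mono) (use that in \<open>auto simp: not_less\<close>)
  ultimately obtain x where x: "1 - \<eta> / 2 < length_of_mass (x * t) / length_of_mass x" "1 \<le> length_of_mass x" "1 / \<eta>\<^sup>2 < x" by blast
  have x0: "0 < x" using x(3) \<eta>(1) by (smt (verit) divide_pos_pos zero_less_power)
  have xt: "0 < x * t" using x0 t by simp
  have f1: "(1 - \<eta> / 2) * length_of_mass x < length_of_mass (x * t)" using x by (simp add: pos_less_divide_eq)
  have "(1 - \<eta>) * length_of_mass x < (1 - \<eta> / 2) * length_of_mass x" using \<eta>(1) x(2) by (intro mult_strict_right_mono) auto
  then have "length_of_mass x < length_of_mass (x * t) / (1 - \<eta>)" using f1 \<eta>(2) by (simp add: pos_less_divide_eq mult.commute)
  then obtain q where q: "q \<in> dom0 b" "x \<le> W q" "length_of_mass x \<le> R q" "R q < length_of_mass (x * t) / (1 - \<eta>)"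
    using length_of_mass_approx[OF x0] by metis
  define p where "p = gen_inverse b W (x * t)"
  have p: "p \<in> dom0 b" "W p \<le> x * t" unfolding p_def
    by (rule W.gen_inverse_dom[OF xt], rule W.gen_inverse_le[OF xt])
  define \<rho> where "\<rho> = R q"
  have \<rho>: "1 \<le> \<rho>" using q(3) x(2) by (simp add: \<rho>_def)
  have Rp: "(1 - \<eta>) * \<rho> \<le> R p"
    using q(4) \<eta>(2) by (simp add: \<rho>_def p_def length_of_mass_def pos_less_divide_eq mult.commute)
  have "0 < (1 - \<eta>) * \<rho>" using \<rho> \<eta>(2) by (intro mult_pos_pos) auto
  then have Rp0: "0 < R p" using Rp by linarith
  define y where "y = 1 / (\<rho> * x * \<eta>\<^sup>2)"
  have xe: "1 < x * \<eta>\<^sup>2" using x(3) \<eta>(1) by (simp add: pos_divide_less_eq)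
  then have "1 < \<rho> * (x * \<eta>\<^sup>2)" using \<rho> by (metis less_1_mult mult_1 order_le_less)
  then have y: "0 < y" "y < 1" using \<rho> x0 \<eta>(1) by (auto simp: y_def mult.assoc)
  let ?z = "\<i> * complex_of_real y" let ?m = "Neumann_m b W R ?z"
  have z: "0 < Im ?z" "cmod ?z = y" using y by (simp_all add: norm_mult)
  obtain P E where PE: "0 \<le> P" "0 \<le> E" and m: "?m = of_real P - cnj ?z * of_real E"
    and A: "\<And>x. x \<in> dom0 b \<Longrightarrow> 0 < R x \<Longrightarrow> 1 \<le> sqrt (P / R x) + y * sqrt (E * W x)"
    and B: "\<And>x. x \<in> dom0 b \<Longrightarrow> 0 < W x \<Longrightarrow> cmod ?m \<le> sqrt (P * R x) + sqrt (E / W x)"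
    using Neumann_m_variational[OF z(1)] z(2) by metis
  define Y where "Y = y * E"
  have re: "Re ?m = P" and im: "Im ?m = Y" by (simp_all add: m Y_def)
  \<comment> \<open>Otherwise (A) would bound \<open>R\<close> by \<open>P\<close>.\<close>
  have Y: "0 < Y"
  proof (rule ccontr)
    assume "\<not> 0 < Y"
    then have E0: "E = 0" using PE y by (simp add: Y_def zero_less_mult_iff)
    obtain v where v: "v \<in> dom0 b" "P < R v" using R.ex_gt by blast
    then have "P / R v < 1" using PE by simp
    then have "sqrt (P / R v) < sqrt 1" by (rule real_sqrt_less_mono)
    then show False using A[OF v(1)] v(2) PE E0 by simp
  qed
  define a where "a = sqrt (P / \<rho>)"
  define e where "e = sqrt (Y / \<rho>)"
  have ae: "0 \<le> a" "0 \<le> e" using PE Y \<rho> by (auto simp: a_def e_def)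
  have a2: "a\<^sup>2 = P / \<rho>" and e2: "e\<^sup>2 = Y / \<rho>" using PE Y \<rho> by (auto simp: a_def e_def)
  have Pa: "P = \<rho> * a\<^sup>2" and Ye: "Y = \<rho> * e\<^sup>2" using \<rho> by (auto simp: a2 e2)
  have 1: "1 - \<eta> \<le> a + \<eta> * e"
  proof -
    have "y * sqrt (E * W p) = sqrt (y * (Y * W p))"
      using y by (simp add: Y_def real_sqrt_mult)
    also have "\<dots> \<le> sqrt (\<eta>\<^sup>2 * (Y / \<rho>))"
    proof (rule real_sqrt_le_mono)
      have "y * (Y * W p) \<le> y * (Y * (x * t))" using y Y p(2) by (intro mult_left_mono) auto
      also have "\<dots> = \<eta>\<^sup>2 * (Y / \<rho>)"
        using \<rho> x0 \<eta>(1) by (simp add: y_def t_def field_simps power2_eq_square power4_eq_xxxx)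
      finally show "y * (Y * W p) \<le> \<eta>\<^sup>2 * (Y / \<rho>)" .
    qed
    also have "\<dots> = \<eta> * e" unfolding e2[symmetric] power_mult_distrib[symmetric] using \<eta>(1) ae by simp
    finally have i1: "y * sqrt (E * W p) \<le> \<eta> * e" .
    have "sqrt (1 - \<eta>) * sqrt (P / R p) = sqrt ((1 - \<eta>) * P / R p)" by (simp add: real_sqrt_mult[symmetric])
    also have "\<dots> \<le> a"
      unfolding a_def
    proof (rule real_sqrt_le_mono)
      have "P * ((1 - \<eta>) * \<rho>) \<le> P * R p" using Rp PE by (intro mult_left_mono) auto
      then show "(1 - \<eta>) * P / R p \<le> P / \<rho>" using Rp0 \<rho> by (simp add: field_simps)
    qed
    finally have i2: "sqrt (1 - \<eta>) * sqrt (P / R p) \<le> a" .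
    have s1: "sqrt (1 - \<eta>) \<le> 1" "0 \<le> sqrt (1 - \<eta>)" using \<eta> by auto
    have "1 - \<eta> = sqrt (1 - \<eta>) * sqrt (1 - \<eta>)" using \<eta> by simp
    also have "\<dots> \<le> sqrt (1 - \<eta>) * 1" using s1 by (intro mult_left_mono) auto
    also have "\<dots> \<le> sqrt (1 - \<eta>) * (sqrt (P / R p) + y * sqrt (E * W p))"
      by (rule mult_left_mono[OF A[OF p(1) Rp0] s1(2)])
    also have "\<dots> \<le> a + 1 * (\<eta> * e)"
    proof -
      have "sqrt (1 - \<eta>) * (y * sqrt (E * W p)) \<le> sqrt (1 - \<eta>) * (\<eta> * e)"
        by (rule mult_left_mono[OF i1 s1(2)])
      also have "\<dots> \<le> 1 * (\<eta> * e)" using s1 ae \<eta>(1) by (intro mult_right_mono) auto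
      finally show ?thesis unfolding distrib_left using i2 by linarith
    qed
    finally show ?thesis by simp
  qed
  have 2: "a ^ 4 + e ^ 4 \<le> (a + \<eta> * e)\<^sup>2"
  proof -
    have Wq: "0 < W q" using q(2) x0 by linarith
    have "sqrt (E / W q) \<le> sqrt (\<eta>\<^sup>2 * (Y * \<rho>))"
    proof (rule real_sqrt_le_mono)
      have "E / W q \<le> E / x" using PE q(2) x0 by (intro divide_left_mono) auto
      also have "\<dots> = \<eta>\<^sup>2 * (Y * \<rho>)" using \<rho> x0 \<eta>(1) by (simp add: Y_def y_def field_simps)
      finally show "E / W q \<le> \<eta>\<^sup>2 * (Y * \<rho>)" .
    qed
    moreover have "sqrt (\<eta>\<^sup>2 * (Y * \<rho>)) = \<rho> * (\<eta> * e)"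
    proof -
      have "\<eta>\<^sup>2 * (Y * \<rho>) = (\<rho> * (\<eta> * e))\<^sup>2" unfolding Ye by (simp add: power2_eq_square mult_ac)
      then show ?thesis using \<rho> ae \<eta>(1) by simp
    qed
    moreover have "sqrt (P * R q) = \<rho> * a"
    proof -
      have "P * R q = (\<rho> * a)\<^sup>2" unfolding Pa \<rho>_def[symmetric] by (simp add: power2_eq_square mult_ac)
      then show ?thesis using \<rho> ae by simp
    qed
    ultimately have "cmod ?m \<le> \<rho> * (a + \<eta> * e)" using B[OF q(1) Wq] unfolding distrib_left by linarith
    then have "(cmod ?m)\<^sup>2 \<le> (\<rho> * (a + \<eta> * e))\<^sup>2" by (intro power_mono) auto
    moreover have "(cmod ?m)\<^sup>2 = P\<^sup>2 + Y\<^sup>2" unfolding cmod_power2 re im ..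
    moreover have "P\<^sup>2 + Y\<^sup>2 = \<rho>\<^sup>2 * (a ^ 4 + e ^ 4)"
      unfolding Pa Ye by (simp add: power_mult_distrib distrib_left power_mult[symmetric])
    ultimately have "\<rho>\<^sup>2 * (a ^ 4 + e ^ 4) \<le> \<rho>\<^sup>2 * (a + \<eta> * e)\<^sup>2"
      by (simp only: power_mult_distrib)
    then show ?thesis using \<rho> by (subst (asm) mult_le_cancel_left_pos) auto
  qed
  note conc = concentration_inequalities[OF \<eta>(1,2) ae 1 2]
  have "(e\<^sup>2)\<^sup>2 \<le> (1 / (4 * K))\<^sup>2"
    using conc(2) \<eta>(3) by (simp add: power_divide power_mult_distrib power_mult[symmetric])
  then have "e\<^sup>2 \<le> 1 / (4 * K)" by (rule power2_le_imp_le) (use K in simp)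
  then have "K * e\<^sup>2 \<le> 1 / 4" using K by (simp add: field_simps)
  also have "1 / 4 \<le> a\<^sup>2" using power_mono[OF conc(1), of 2] by (simp add: power2_eq_square)
  finally have "K * Y \<le> P" using \<rho> unfolding a2 e2 by (simp add: field_simps)
  then have "K \<le> \<bar>Re ?m\<bar> / Im ?m" unfolding re im using Y PE by (simp add: pos_le_divide_eq)
  then show thesis by (rule that[OF y])
qed

end

theorem theorem2p11:
  fixes b :: ereal and W R :: "real \<Rightarrow> real"
  assumes b: "0 < b"
    and range: "W \<in> dom0 b \<rightarrow> {0..}" "R \<in> dom0 b \<rightarrow> {0..}"
    and left_cont: "left_continuous_on (dom0 b) W" "left_continuous_on (dom0 b) R"
    and mono: "mono_on (dom0 b) W" "mono_on (dom0 b) R"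
    and unbounded: "\<not> bdd_above (W ` dom0 b)" "\<not> bdd_above (R ` dom0 b)"
    and zero: "W 0 = 0" "R 0 = 0"
    and no_common_disc:
      "\<forall>x\<in>dom0 b. continuous (at x within dom0 b) W \<or> continuous (at x within dom0 b) R"
  shows "((\<exists>t\<in>{0<..<1}. S_infinity (R \<circ> gen_inverse b W) t \<noteq> 1) \<longrightarrow>
            (\<forall>S. nonreal_sector S \<longrightarrow>
               (\<lambda>z. \<bar>Re (Neumann_m b W R z)\<bar>) \<in> O[at 0 within S](\<lambda>z. \<bar>Im (Neumann_m b W R z)\<bar>)))
       \<and> ((\<exists>t\<in>{0<..<1}. S_infinity (R \<circ> gen_inverse b W) t \<noteq> 1) \<longleftrightarrow>
            positively_increasing_at_infinity (R \<circ> gen_inverse b W))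
       \<and> ((\<forall>t\<in>{0<..<1}. S_infinity (R \<circ> gen_inverse b W) t = 1) \<longrightarrow>
            (SUP y\<in>{0<..<1::real}. ereal (\<bar>Re (Neumann_m b W R (\<i> * of_real y))\<bar> /
                                        Im (Neumann_m b W R (\<i> * of_real y)))) = \<infinity>)
       \<and> ((\<forall>t\<in>{0<..<1}. S_infinity (R \<circ> gen_inverse b W) t = 1) \<longleftrightarrow>
            \<not> positively_increasing_at_infinity (R \<circ> gen_inverse b W))"
proof -
  interpret string_system b W R
    by unfold_locales (fact b left_cont mono unbounded zero no_common_disc)+
  have "(SUP y\<in>{0<..<1::real}. ereal (\<bar>Re (Neumann_m b W R (\<i> * of_real y))\<bar> /
      Im (Neumann_m b W R (\<i> * of_real y)))) = \<infinity>"
    if S: "\<forall>t\<in>{0<..<1}. S_infinity (R \<circ> gen_inverse b W) t = 1"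
  proof (rule SUP_PInfty)
    fix n :: nat
    obtain y where "0 < y" "y < 1"
      "real n + 1 \<le> \<bar>Re (Neumann_m b W R (\<i> * of_real y))\<bar> / Im (Neumann_m b W R (\<i> * of_real y))"
      using Re_div_Im_large[of "real n + 1"] S by (auto simp: length_of_mass_def)
    then show "\<exists>y\<in>{0<..<1}. ereal (real n) \<le> ereal (\<bar>Re (Neumann_m b W R (\<i> * of_real y))\<bar> /
        Im (Neumann_m b W R (\<i> * of_real y)))"
      by (intro bexI[of _ y]) auto
  qed
  then show ?thesis
    using Re_O_Im unfolding positively_increasing_at_infinity_def length_of_mass_def by blast
qed

end
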